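(* Let $X$ be a finite set, let $\mathcal{U}$ and $\mathcal{V}$ be quantum graphs in $\mathbb{C}^X\otimes\mathbb{C}^X$, and let $P$ and $Q$ be the orthogonal projections of $\mathbb{C}^X\otimes\mathbb{C}^X$ onto $\mathcal{U}$ and $\mathcal{V}$, respectively. The following are equivalent: (i) $\mathcal{U}\cong_{\rm qc}\mathcal{V}$; (ii) there exist a tracial von Neumann algebra $\mathcal{N}\subseteq\mathcal{B}(H)$ and an $\mathcal{N}$-aligned bi-unitary $U=(U_{a,x})_{a,x}\in M_X(\mathcal{B}(H))$ such that $$(P\otimes I)U^{\rm t}_{1,3}U^*_{2,3}(Q^\perp\otimes I)=0\quad\text{and}\quad(\bar P^\perp\otimes I)U^{\rm t}_{1,3}U^*_{2,3}(\bar Q\otimes I)=0;$$ (iii) there exist a tracial von Neumann algebra $\mathcal{N}\subseteq\mathcal{B}(H)$ and an $\mathcal{N}$-aligned bi-unitary $U=(U_{a,x})_{a,x}\in M_X(\mathcal{B}(H))$ such that $$U(\tilde{\mathcal{S}}_{\mathcal{U}}\otimes1)U^*\subseteq\tilde{\mathcal{S}}_{\mathcal{V}}\otimes\mathcal{B}(H)\quad\text{and}\quad U^{\rm t}(\tilde{\mathcal{S}}_{\mathcal{V}}\otimes1)(U^{\rm t})^*\subseteq\tilde{\mathcal{S}}_{\mathcal{U}}\otimes\mathcal{B}(H).$$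
   Context: $M_X$: complex $X\times X$ matrices with matrix units $\epsilon_{x,x'}$; $(e_x)$ the canonical basis of $\mathbb{C}^X$; $M_{XX}=M_X\otimes M_X$; $\bar T=(T^{\rm t})^*$ is the entrywise complex conjugate of a matrix $T$; $T^\perp=I-T$ for a projection $T$. Quantum graphs: a subspace $\mathcal{U}\subseteq\mathbb{C}^X\otimes\mathbb{C}^X$ is a quantum graph if it is skew ($\langle\zeta,\sum_xe_x\otimes e_x\rangle=0$ for all $\zeta\in\mathcal{U}$) and symmetric ($\mathfrak{f}(\mathcal{U})=\mathcal{U}$, where $\mathfrak{f}(\xi\otimes\eta)=\eta\otimes\xi$). $\tilde{\mathcal{S}}_{\mathcal{U}}\subseteq\mathcal{L}(\mathbb{C}^X)=M_X$ is the image of $\mathcal{U}$ under the linear map determined by $e_x\otimes e_y\mapsto\epsilon_{y,x}$, where $\epsilon_{y,x}e_x=e_y$. QNS bicorrelations: a quantum channel $\Gamma:M_{XX}\to M_{XX}$ is a QNS correlation if $(\mathrm{Tr}\otimes\mathrm{id})\Gamma(\rho_1\otimes\rho_2)=0$ whenever $\mathrm{Tr}(\rho_1)=0$, and $(\mathrm{id}\otimes\mathrm{Tr})\Gamma(\rho_1\otimes\rho_2)=0$ whenever $\mathrm{Tr}(\rho_2)=0$. It is a QNS bicorrelation if $\Gamma(I)=I$ and $\Gamma^*$ is a QNS correlation, where $\mathrm{Tr}(\Gamma^*(\omega)\rho^{\rm t})=\mathrm{Tr}(\omega\Gamma(\rho)^{\rm t})$. It is quantum commuting if $\Gamma(\epsilon_{x,x'}\otimes\epsilon_{y,y'})=\sum_{a,a',b,b'}\langle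 E_{x,x',a,a'}F_{y,y',b,b'}\xi,\xi\rangle\epsilon_{a,a'}\otimes\epsilon_{b,b'}$ for some Hilbert space $K$, unit vector $\xi\in K$ and bistochastic operator matrices $E,F$ on $K$ such that each entry of $E$ commutes with each entry of $F$; here a bistochastic operator matrix is a positive $E=\sum\epsilon_{x,x'}\otimes\epsilon_{a,a'}\otimes E_{x,x',a,a'}$ in $M_X\otimes M_X\otimes\mathcal{B}(K)$ with $\sum_aE_{x,x',a,a}=\delta_{x,x'}I$ and $\sum_xE_{x,x,a,a'}=\delta_{a,a'}I$. It is concurrent if $\Gamma(J_X)=J_X$, $J_X=\frac1{|X|}\sum_{x,y}\epsilon_{x,y}\otimes\epsilon_{x,y}$. $\mathcal{Q}_{\rm qc}^{\rm bic}$ is the set of concurrent quantum commuting QNS bicorrelations. Isomorphism: $\Gamma$ is a perfect strategy for $\mathcal{U}\to\mathcal{V}$ if, for $\omega\in M_{XX}^+$, $\omega=P\omega P$ implies $\Gamma(\omega)=Q\Gamma(\omega)Q$ ($P,Q$ the projections onto $\mathcal{U},\mathcal{V}$). $\mathcal{U}\cong_{\rm qc}\mathcal{V}$ means there is $\Gamma\in\mathcal{Q}_{\rm qc}^{\rm bic}$ that is a perfect strategy for $\mathcal{U}\to\mathcal{V}$ and such that $\Gamma^*$ is a perfect strategy for $\mathcal{V}\to\mathcal{U}$. A von Neumann algebra is tracial if it admits a tracial state. $U=(U_{a,x})_{a,x\in X}=\sum\epsilon_{a,x}\otimes U_{a,x}\in M_X(\mathcal{B}(H))$ is a bi-unitary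 if $U$ and $U^{\rm t}=\sum\epsilon_{x,a}\otimes U_{a,x}$ are both unitary; it is $\mathcal{N}$-aligned if $U_{a,x}^*U_{b,y}\in\mathcal{N}$ for all $x,y,a,b\in X$. Leg numbering in $M_X\otimes M_X\otimes\mathcal{B}(H)$: $W_{2,3}=I_X\otimes W$ and $W_{1,3}$ is obtained from it by flipping the first two legs; thus $U^{\rm t}_{1,3}U^*_{2,3}=\sum_{x,y,a,b}\epsilon_{x,a}\otimes\epsilon_{y,b}\otimes U_{a,x}U_{b,y}^*$. *)

theory Defs
  imports "HOL-Analysis.Analysis" "HOL-Algebra.Module" "HOL-Library.Equipollence"
    "HOL-Library.Nonpos_Ints"
begin

text \<open>
  The finite set $X$ is the universe of a finite type \<open>'x\<close>. The space $C^X \otimes C^X$ is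
  \<open>complex ^ ('x \<times> 'x)\<close>, with $e_x \otimes e_y$ the basis vector at \<open>(x, y)\<close>, and
  $M_{XX}$ consists of the matrices over \<open>'x \<times> 'x\<close>. In \<open>A $ i $ j\<close> the row is \<open>i\<close>.
\<close>

section \<open>Complex matrices\<close>

definition cinner :: "complex^'n \<Rightarrow> complex^'n \<Rightarrow> complex" where
  "cinner u v = (\<Sum>i\<in>UNIV. u $ i * cnj (v $ i))"

definition mscale :: "complex \<Rightarrow> complex^'n^'m \<Rightarrow> complex^'n^'m" where
  "mscale c A = map_matrix ((*) c) A"

definition ctranspose :: "complex^'n^'m \<Rightarrow> complex^'m^'n" where
  "ctranspose A = map_matrix cnj (transpose A)"

definition mconj :: "complex^'n^'n \<Rightarrow> complex^'n^'n" where
  "mconj T = ctranspose (transpose T)"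

definition munit :: "'n \<Rightarrow> 'n \<Rightarrow> complex^'n^'n" where
  "munit i j = (\<chi> k l. if k = i \<and> l = j then 1 else 0)"

definition psd :: "complex^'n^'n \<Rightarrow> bool" where
  "psd A \<longleftrightarrow> (\<forall>v. cinner (A *v v) v \<in> \<real>\<^sub>\<ge>\<^sub>0)"

definition kron :: "complex^'x^'x \<Rightarrow> complex^'x^'x \<Rightarrow> complex^('x::finite\<times>'x)^('x\<times>'x)" where
  "kron A B = (\<chi> p q. A $ fst p $ fst q * B $ snd p $ snd q)"

definition ptrace1 :: "complex^('x::finite\<times>'x)^('x\<times>'x) \<Rightarrow> complex^'x^'x" where
  "ptrace1 M = (\<chi> b b'. \<Sum>a\<in>UNIV. M $ (a, b) $ (a, b'))"

definition ptrace2 :: "complex^('x::finite\<times>'x)^('x\<times>'x) \<Rightarrow> complex^'x^'x" where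
  "ptrace2 M = (\<chi> a a'. \<Sum>b\<in>UNIV. M $ (a, b) $ (a', b))"

definition orth_proj :: "(complex^'n) set \<Rightarrow> complex^'n^'n" where
  "orth_proj S = (THE P. P ** P = P \<and> ctranspose P = P \<and> range ((*v) P) = S)"


section \<open>Quantum graphs\<close>

definition flip :: "complex^('x::finite\<times>'x) \<Rightarrow> complex^('x::finite\<times>'x)" where
  "flip \<zeta> = (\<chi> p. \<zeta> $ (snd p, fst p))"

definition quantum_graph :: "(complex^('x::finite\<times>'x)) set \<Rightarrow> bool" where
  "quantum_graph \<U> \<longleftrightarrow> vec.subspace \<U> \<and>
     (\<forall>\<zeta>\<in>\<U>. cinner \<zeta> (\<Sum>x\<in>UNIV. axis (x, x) 1) = 0) \<and>
     flip ` \<U> = \<U>"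

definition S_tilde :: "(complex^('x::finite\<times>'x)) set \<Rightarrow> (complex^'x^'x) set" where
  "S_tilde \<U> = (\<lambda>\<zeta>. \<Sum>x\<in>UNIV. \<Sum>y\<in>UNIV. mscale (\<zeta> $ (x, y)) (munit y x)) ` \<U>"


section \<open>Channels and QNS bicorrelations\<close>

text \<open>
  An element of $M_n \otimes M_I$ is given by its blocks \<open>\<omega> i j\<close> for \<open>i, j < n\<close>;
  complete positivity says that $\mathrm{id}_n \otimes \Gamma$ preserves positivity for every $n$.
\<close>

definition block_psd :: "nat \<Rightarrow> (nat \<Rightarrow> nat \<Rightarrow> complex^'n^'n) \<Rightarrow> bool" where
  "block_psd n \<omega> \<longleftrightarrow>
     (\<forall>v. (\<Sum>i<n. \<Sum>j<n. cinner (\<omega> i j *v v j) (v i)) \<in> \<real>\<^sub>\<ge>\<^sub>0)"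

definition completely_positive :: "(complex^'n^'n \<Rightarrow> complex^'m^'m) \<Rightarrow> bool" where
  "completely_positive \<Gamma> \<longleftrightarrow>
     (\<forall>n \<omega>. block_psd n \<omega> \<longrightarrow> block_psd n (\<lambda>i j. \<Gamma> (\<omega> i j)))"

definition quantum_channel :: "(complex^'n^'n \<Rightarrow> complex^'m^'m) \<Rightarrow> bool" where
  "quantum_channel \<Gamma> \<longleftrightarrow>
     (\<forall>A B. \<Gamma> (A + B) = \<Gamma> A + \<Gamma> B) \<and> (\<forall>c A. \<Gamma> (mscale c A) = mscale c (\<Gamma> A)) \<and>
     completely_positive \<Gamma> \<and> (\<forall>A. trace (\<Gamma> A) = trace A)"

type_synonym 'x channel = "complex^('x\<times>'x)^('x\<times>'x) \<Rightarrow> complex^('x\<times>'x)^('x\<times>'x)"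

definition QNS_correlation :: "('x::finite) channel \<Rightarrow> bool" where
  "QNS_correlation \<Gamma> \<longleftrightarrow> quantum_channel \<Gamma> \<and>
     (\<forall>\<rho>\<^sub>1 \<rho>\<^sub>2. trace \<rho>\<^sub>1 = 0 \<longrightarrow> ptrace1 (\<Gamma> (kron \<rho>\<^sub>1 \<rho>\<^sub>2)) = 0) \<and>
     (\<forall>\<rho>\<^sub>1 \<rho>\<^sub>2. trace \<rho>\<^sub>2 = 0 \<longrightarrow> ptrace2 (\<Gamma> (kron \<rho>\<^sub>1 \<rho>\<^sub>2)) = 0)"

text \<open>The dual is taken with respect to the bilinear pairing \<open>trace (\<omega> ** transpose \<rho>)\<close>.\<close>

definition dual_map :: "('x::finite) channel \<Rightarrow> 'x channel" where
  "dual_map \<Gamma> = (THE \<Phi>. \<forall>\<omega> \<rho>.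
     trace (\<Phi> \<omega> ** transpose \<rho>) = trace (\<omega> ** transpose (\<Gamma> \<rho>)))"

definition QNS_bicorrelation :: "('x::finite) channel \<Rightarrow> bool" where
  "QNS_bicorrelation \<Gamma> \<longleftrightarrow>
     QNS_correlation \<Gamma> \<and> \<Gamma> (mat 1) = mat 1 \<and> QNS_correlation (dual_map \<Gamma>)"

definition J_mat :: "complex^('x::finite\<times>'x)^('x::finite\<times>'x)" where
  "J_mat = mscale (1 / of_nat CARD('x)) (\<Sum>x\<in>UNIV. \<Sum>y\<in>UNIV. kron (munit x y) (munit x y))"

definition concurrent :: "('x::finite) channel \<Rightarrow> bool" where
  "concurrent \<Gamma> \<longleftrightarrow> \<Gamma> J_mat = J_mat"

definition perfect_strategy ::
  "('x::finite) channel \<Rightarrow> (complex^('x::finite\<times>'x)) set \<Rightarrow> (complex^('x::finite\<times>'x)) set \<Rightarrow> bool" where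
  "perfect_strategy \<Gamma> \<U> \<V> \<longleftrightarrow>
     (\<forall>\<omega>. psd \<omega> \<longrightarrow> \<omega> = orth_proj \<U> ** \<omega> ** orth_proj \<U> \<longrightarrow>
        \<Gamma> \<omega> = orth_proj \<V> ** \<Gamma> \<omega> ** orth_proj \<V>)"


section \<open>Hilbert spaces and bounded operators\<close>

text \<open>
  Statements of the form ``there is a Hilbert space such that'' are rendered with Hilbert spaces
  whose underlying set is a subset of an arbitrary type \<open>'k\<close>. The fields \<open>mult\<close> and
  \<open>one\<close>, which a \<open>module\<close> record inherits from \<open>ring\<close>, play no role in a Hilbert space.
\<close>

definition complex_ring :: "complex ring" where
  "complex_ring = \<lparr>carrier = UNIV, mult = (*), one = 1, zero = 0, add = (+)\<rparr>"

record 'k hilbert = "(complex, 'k) module" +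
  hinner :: "'k \<Rightarrow> 'k \<Rightarrow> complex"

definition hnorm :: "'k hilbert \<Rightarrow> 'k \<Rightarrow> real" where
  "hnorm H v = sqrt (Re (hinner H v v))"

locale hilbert_space = module complex_ring H for H :: "'k hilbert" (structure) +
  assumes hinner_add: "\<lbrakk>u \<in> carrier H; v \<in> carrier H; w \<in> carrier H\<rbrakk> \<Longrightarrow>
      hinner H (u \<oplus> v) w = hinner H u w + hinner H v w"
    and hinner_smult: "\<lbrakk>v \<in> carrier H; w \<in> carrier H\<rbrakk> \<Longrightarrow>
      hinner H (c \<odot> v) w = c * hinner H v w"
    and hinner_commute: "\<lbrakk>v \<in> carrier H; w \<in> carrier H\<rbrakk> \<Longrightarrow>
      hinner H v w = cnj (hinner H w v)"
    and hinner_nonneg: "v \<in> carrier H \<Longrightarrow> hinner H v v \<in> \<real>\<^sub>\<ge>\<^sub>0"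
    and hinner_definite: "\<lbrakk>v \<in> carrier H; hinner H v v = 0\<rbrakk> \<Longrightarrow> v = \<zero>"
    and complete: "\<lbrakk>\<And>n::nat. s n \<in> carrier H;
        \<And>e. e > 0 \<Longrightarrow> \<exists>M. \<forall>m\<ge>M. \<forall>n\<ge>M. hnorm H (s m \<ominus> s n) < e\<rbrakk> \<Longrightarrow>
      \<exists>v\<in>carrier H. (\<lambda>n. hnorm H (s n \<ominus> v)) \<longlonglongrightarrow> 0"

text \<open>
  The algebra of bounded operators. Operators are extensional functions on the carrier of \<open>H\<close>, so
  that equality of operators is equality in HOL.
\<close>

definition bounded_ops :: "'k hilbert \<Rightarrow> (complex, 'k \<Rightarrow> 'k) module" ("\<B>") where
  "\<B> H = \<lparr>
     carrier = {T \<in> carrier H \<rightarrow>\<^sub>E carrier H.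
       (\<forall>v\<in>carrier H. \<forall>w\<in>carrier H. T (v \<oplus>\<^bsub>H\<^esub> w) = T v \<oplus>\<^bsub>H\<^esub> T w) \<and>
       (\<forall>c. \<forall>v\<in>carrier H. T (c \<odot>\<^bsub>H\<^esub> v) = c \<odot>\<^bsub>H\<^esub> T v) \<and>
       (\<exists>C. \<forall>v\<in>carrier H. hnorm H (T v) \<le> C * hnorm H v)},
     mult = compose (carrier H),
     one = (\<lambda>v\<in>carrier H. v),
     zero = (\<lambda>v\<in>carrier H. \<zero>\<^bsub>H\<^esub>),
     add = (\<lambda>S T. \<lambda>v\<in>carrier H. S v \<oplus>\<^bsub>H\<^esub> T v),
     smult = (\<lambda>c T. \<lambda>v\<in>carrier H. c \<odot>\<^bsub>H\<^esub> T v)\<rparr>"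

definition op_adj :: "'k hilbert \<Rightarrow> ('k \<Rightarrow> 'k) \<Rightarrow> ('k \<Rightarrow> 'k)" where
  "op_adj H T = (THE S. S \<in> carrier (\<B> H) \<and>
     (\<forall>v\<in>carrier H. \<forall>w\<in>carrier H. hinner H (T v) w = hinner H v (S w)))"

definition commutant :: "'k hilbert \<Rightarrow> ('k \<Rightarrow> 'k) set \<Rightarrow> ('k \<Rightarrow> 'k) set" where
  "commutant H N = {T \<in> carrier (\<B> H). \<forall>S\<in>N. T \<otimes>\<^bsub>\<B> H\<^esub> S = S \<otimes>\<^bsub>\<B> H\<^esub> T}"

definition von_neumann_algebra :: "'k hilbert \<Rightarrow> ('k \<Rightarrow> 'k) set \<Rightarrow> bool" where
  "von_neumann_algebra H N \<longleftrightarrow> N \<subseteq> carrier (\<B> H) \<and> (\<forall>T\<in>N. op_adj H T \<in> N) \<and>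
     commutant H (commutant H N) = N"

definition tracial_state ::
  "'k hilbert \<Rightarrow> ('k \<Rightarrow> 'k) set \<Rightarrow> (('k \<Rightarrow> 'k) \<Rightarrow> complex) \<Rightarrow> bool" where
  "tracial_state H N \<tau> \<longleftrightarrow>
     (\<forall>S\<in>N. \<forall>T\<in>N. \<tau> (S \<oplus>\<^bsub>\<B> H\<^esub> T) = \<tau> S + \<tau> T) \<and>
     (\<forall>c. \<forall>T\<in>N. \<tau> (c \<odot>\<^bsub>\<B> H\<^esub> T) = c * \<tau> T) \<and>
     (\<forall>T\<in>N. \<tau> (op_adj H T \<otimes>\<^bsub>\<B> H\<^esub> T) \<in> \<real>\<^sub>\<ge>\<^sub>0) \<and>
     \<tau> \<one>\<^bsub>\<B> H\<^esub> = 1 \<and>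
     (\<forall>S\<in>N. \<forall>T\<in>N. \<tau> (S \<otimes>\<^bsub>\<B> H\<^esub> T) = \<tau> (T \<otimes>\<^bsub>\<B> H\<^esub> S))"

definition tracial_von_neumann_algebra :: "'k hilbert \<Rightarrow> ('k \<Rightarrow> 'k) set \<Rightarrow> bool" where
  "tracial_von_neumann_algebra H N \<longleftrightarrow> von_neumann_algebra H N \<and> (\<exists>\<tau>. tracial_state H N \<tau>)"


section \<open>Operator matrices\<close>

text \<open>\<open>('i, 'k) opmat\<close> represents $M_I(B(H))$, identified with $M_I \otimes B(H)$.\<close>

type_synonym ('i, 'k) opmat = "'i \<Rightarrow> 'i \<Rightarrow> ('k \<Rightarrow> 'k)"

definition opmats :: "'k hilbert \<Rightarrow> ('i, 'k) opmat set" where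
  "opmats H = {A. \<forall>i j. A i j \<in> carrier (\<B> H)}"

definition om_mult ::
  "'k hilbert \<Rightarrow> ('i::finite, 'k) opmat \<Rightarrow> ('i, 'k) opmat \<Rightarrow> ('i, 'k) opmat"
  (infixl "\<star>\<index>" 70) where
  "A \<star>\<^bsub>H\<^esub> B = (\<lambda>i j. \<Oplus>\<^bsub>\<B> H\<^esub>k\<in>UNIV. A i k \<otimes>\<^bsub>\<B> H\<^esub> B k j)"

definition om_adj :: "'k hilbert \<Rightarrow> ('i, 'k) opmat \<Rightarrow> ('i, 'k) opmat" where
  "om_adj H A = (\<lambda>i j. op_adj H (A j i))"

definition om_transpose :: "('i, 'k) opmat \<Rightarrow> ('i, 'k) opmat" where
  "om_transpose A = (\<lambda>i j. A j i)"

definition om_one :: "'k hilbert \<Rightarrow> ('i, 'k) opmat" where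
  "om_one H = (\<lambda>i j. if i = j then \<one>\<^bsub>\<B> H\<^esub> else \<zero>\<^bsub>\<B> H\<^esub>)"

definition om_zero :: "'k hilbert \<Rightarrow> ('i, 'k) opmat" where
  "om_zero H = (\<lambda>i j. \<zero>\<^bsub>\<B> H\<^esub>)"

definition om_tensor :: "'k hilbert \<Rightarrow> complex^'i^'i \<Rightarrow> ('k \<Rightarrow> 'k) \<Rightarrow> ('i, 'k) opmat" where
  "om_tensor H S T = (\<lambda>i j. (S $ i $ j) \<odot>\<^bsub>\<B> H\<^esub> T)"

abbreviation om_scalar :: "'k hilbert \<Rightarrow> complex^'i^'i \<Rightarrow> ('i, 'k) opmat" where
  "om_scalar H S \<equiv> om_tensor H S \<one>\<^bsub>\<B> H\<^esub>"

text \<open>The tensor product of a subspace of $M_I$ with $B(H)$: all finite sums of elementary tensors.\<close>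

definition om_tensor_space :: "'k hilbert \<Rightarrow> (complex^'i^'i) set \<Rightarrow> ('i, 'k) opmat set" where
  "om_tensor_space H \<S> = {(\<lambda>i j. \<Oplus>\<^bsub>\<B> H\<^esub>k\<in>{..<n}. om_tensor H (S k) (T k) i j) | (n::nat) S T.
     (\<forall>k<n. S k \<in> \<S> \<and> T k \<in> carrier (\<B> H))}"

definition om_positive :: "'k hilbert \<Rightarrow> ('i::finite, 'k) opmat \<Rightarrow> bool" where
  "om_positive H A \<longleftrightarrow> A \<in> opmats H \<and>
     (\<forall>v. (\<forall>i. v i \<in> carrier H) \<longrightarrow>
        (\<Sum>i\<in>UNIV. \<Sum>j\<in>UNIV. hinner H (A i j (v j)) (v i)) \<in> \<real>\<^sub>\<ge>\<^sub>0)"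

definition om_unitary :: "'k hilbert \<Rightarrow> ('i::finite, 'k) opmat \<Rightarrow> bool" where
  "om_unitary H A \<longleftrightarrow> A \<in> opmats H \<and>
     om_adj H A \<star>\<^bsub>H\<^esub> A = om_one H \<and> A \<star>\<^bsub>H\<^esub> om_adj H A = om_one H"

definition bi_unitary :: "'k hilbert \<Rightarrow> ('x::finite, 'k) opmat \<Rightarrow> bool" where
  "bi_unitary H U \<longleftrightarrow> om_unitary H U \<and> om_unitary H (om_transpose U)"

definition aligned :: "'k hilbert \<Rightarrow> ('k \<Rightarrow> 'k) set \<Rightarrow> ('x, 'k) opmat \<Rightarrow> bool" where
  "aligned H N U \<longleftrightarrow> (\<forall>x y a b. op_adj H (U a x) \<otimes>\<^bsub>\<B> H\<^esub> U b y \<in> N)"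

definition leg13 :: "'k hilbert \<Rightarrow> ('x, 'k) opmat \<Rightarrow> ('x \<times> 'x, 'k) opmat" where
  "leg13 H W = (\<lambda>p q. if snd p = snd q then W (fst p) (fst q) else \<zero>\<^bsub>\<B> H\<^esub>)"

definition leg23 :: "'k hilbert \<Rightarrow> ('x, 'k) opmat \<Rightarrow> ('x \<times> 'x, 'k) opmat" where
  "leg23 H W = (\<lambda>p q. if fst p = fst q then W (snd p) (snd q) else \<zero>\<^bsub>\<B> H\<^esub>)"


section \<open>Quantum commuting bicorrelations and isomorphism\<close>

text \<open>
  \<open>E x x' a a'\<close> is the coefficient of $\epsilon_{x,x'} \otimes \epsilon_{a,a'}$, i.e. the entry in
  row \<open>(x, a)\<close> and column \<open>(x', a')\<close> of the operator matrix.
\<close>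

definition bistochastic ::
  "'k hilbert \<Rightarrow> ('x::finite \<Rightarrow> 'x \<Rightarrow> 'x \<Rightarrow> 'x \<Rightarrow> ('k \<Rightarrow> 'k)) \<Rightarrow> bool" where
  "bistochastic K E \<longleftrightarrow>
     om_positive K (\<lambda>p q. E (fst p) (fst q) (snd p) (snd q)) \<and>
     (\<forall>x x'. (\<Oplus>\<^bsub>\<B> K\<^esub>a\<in>UNIV. E x x' a a) = (if x = x' then \<one>\<^bsub>\<B> K\<^esub> else \<zero>\<^bsub>\<B> K\<^esub>)) \<and>
     (\<forall>a a'. (\<Oplus>\<^bsub>\<B> K\<^esub>x\<in>UNIV. E x x a a') = (if a = a' then \<one>\<^bsub>\<B> K\<^esub> else \<zero>\<^bsub>\<B> K\<^esub>))"

definition quantum_commuting :: "'k itself \<Rightarrow> ('x::finite) channel \<Rightarrow> bool" where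
  "quantum_commuting _ \<Gamma> \<longleftrightarrow>
     (\<exists>(K :: 'k hilbert) \<xi> E F. hilbert_space K \<and> \<xi> \<in> carrier K \<and> hnorm K \<xi> = 1 \<and>
        bistochastic K E \<and> bistochastic K F \<and>
        (\<forall>x x' a a' y y' b b'.
           E x x' a a' \<otimes>\<^bsub>\<B> K\<^esub> F y y' b b' = F y y' b b' \<otimes>\<^bsub>\<B> K\<^esub> E x x' a a') \<and>
        (\<forall>x x' y y'. \<Gamma> (kron (munit x x') (munit y y')) =
           (\<Sum>a\<in>UNIV. \<Sum>a'\<in>UNIV. \<Sum>b\<in>UNIV. \<Sum>b'\<in>UNIV.
              mscale (hinner K ((E x x' a a' \<otimes>\<^bsub>\<B> K\<^esub> F y y' b b') \<xi>) \<xi>)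
                (kron (munit a a') (munit b b')))))"

definition Q_qc_bic :: "'k itself \<Rightarrow> ('x::finite) channel set" where
  "Q_qc_bic k = {\<Gamma>. QNS_bicorrelation \<Gamma> \<and> quantum_commuting k \<Gamma> \<and> concurrent \<Gamma>}"

definition qc_isomorphic ::
  "'k itself \<Rightarrow> (complex^('x::finite\<times>'x)) set \<Rightarrow> (complex^('x::finite\<times>'x)) set \<Rightarrow> bool" where
  "qc_isomorphic k \<U> \<V> \<longleftrightarrow>
     (\<exists>\<Gamma>\<in>Q_qc_bic k. perfect_strategy \<Gamma> \<U> \<V> \<and> perfect_strategy (dual_map \<Gamma>) \<V> \<U>)"

text \<open>
  HOL cannot quantify existentially over types, so the Hilbert spaces in the three conditions of the
  theorem live on subsets of types \<open>'k\<close>, \<open>'h\<close>, \<open>'g\<close>. These are arbitrary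
  and mutually unrelated, apart from having at least continuum many elements, which gives room for
  every separable Hilbert space. Every Hilbert space lives on some such type (add continuum many
  elements to its underlying set), and an equivalence between conditions over unrelated types shows
  that none of the conditions depends on the choice of the type.
\<close>

end

theory Submission
  imports Defs
begin

text \<open>
  For a bi-unitary \<open>U\<close> write \<open>U\<^sub>p\<close> for $U_{a,x}$ when \<open>p = (x, a)\<close>, and put
  \<open>E\<^sub>p\<^sub>q = U\<^sub>p\<^sup>* U\<^sub>q\<close>. Let $n = |X|$. All three conditions say the same thing about the
  \<open>E\<^sub>p\<^sub>q\<close> alone: there is a positive trace \<open>\<phi>\<close> on words in these letters that respects the four
  identities expressing that \<open>U\<close> and its transpose are unitary (\<open>biunitary_trace\<close>), and for which
  the products \<open>U\<^sub>p U\<^sub>q\<^sup>*\<close>, multiplied by \<open>U\<^sub>r\<^sup>*\<close> and \<open>U\<^sub>s\<close> to become words, satisfy the linear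
  relations given by pairs of vectors in \<open>\<U>\<close> and in the orthogonal complement of \<open>\<V>\<close>, and the same
  with the roles exchanged (\<open>intertwines\<close>).

  From a concurrent commuting pair to a trace. Factor the operator matrix of the first family as
  \<open>E\<^sub>p\<^sub>q = V\<^sub>p\<^sup>* V\<^sub>q\<close>. The marginal conditions make \<open>V\<close> an isometry, so its adjoint is a contraction
  and $\sum \|E_{pq}\xi\|^2 \le n^2$, and likewise for the second family (\<open>isometry_adjoint\<close>).
  Concurrence says that $\sum \langle E_{pq}F_{pq}\xi, \xi\rangle = n^2$. This is the extreme case
  of the Cauchy-Schwarz inequality, so \<open>E\<^sub>p\<^sub>q \<xi> = F\<^sub>q\<^sub>p \<xi>\<close> (\<open>exchange\<close>). As the two families commute,
  the vector state is a trace on the words in the \<open>E\<^sub>p\<^sub>q\<close>. The adjoint of \<open>V\<close> is moreover isometric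
  on the vectors in question, and this is the missing half of unitarity. Finally
  the channel has, up to the factor $n^2$, the Gram matrix of the vectors \<open>E\<^sub>r\<^sub>p E\<^sub>q\<^sub>s \<xi>\<close> as its
  coefficients (\<open>coeff_gram\<close>), so that a perfect strategy forces combinations of
  these vectors to vanish (\<open>intertwines_of_quadratic\<close>).

  From an aligned bi-unitary to a trace. The tracial state is evaluated at words in the
  \<open>E\<^sub>p\<^sub>q\<close>, which alignment puts into the algebra (\<open>biunitary_trace_entry_trace\<close>).

  From a trace back to both. Left and right multiplications act on the Hilbert space \<open>K\<close> of \<open>\<phi>\<close>, and
  they are the two commuting families of a quantum commuting correlation
  (\<open>quantum_commuting_chan_coeff\<close>). The entries \<open>U\<^sub>p\<close> themselves only map \<open>K\<close> into a second space \<open>L\<close>.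
  But \<open>U\<close> identifies the sum of $n$ copies of \<open>K\<close> with the sum of $n$ copies of \<open>L\<close>, and
  composing \<open>n\<close> copies of \<open>U\<^sub>p\<close> with the inverse of this identification gives operators on
  $K \otimes C^X$ with the same products \<open>E\<^sub>p\<^sub>q\<close>. Their matrix entries are words, so \<open>L\<close> need not be constructed
  (\<open>big_unitary\<close>). The von Neumann algebra is the commutant of the right multiplications and the
  matrix units, and $\|T\Omega\| = \|T^*\Omega\|$ on it makes the vector state tracial
  (\<open>trace_algebra_tracial\<close>).

  There are countably many words, so \<open>K\<close> is separable. It is realised inside the square-summable sequences
  by a Cholesky factorisation (\<open>Kolmogorov\<close>), and thus fits into every type with at least continuum many
  elements.

  The second and third condition are two ways of writing the same linear relations between the
  operators \<open>U\<^sub>p U\<^sub>q\<^sup>*\<close>, once with projections onto a subspace and a complement, and once with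
  membership in a tensor product (\<open>op_intertwines_pair_iff\<close>).
\<close>

section \<open>Finite sums\<close>

lemma sum_rotate: "(\<Sum>a\<in>A. \<Sum>b\<in>B. \<Sum>c\<in>C. f a b c) = (\<Sum>b\<in>B. \<Sum>c\<in>C. \<Sum>a\<in>A. f a b c)"
  by (subst sum.swap, rule sum.cong[OF refl], rule sum.swap)

lemma sum_swap_pairs:
  "(\<Sum>i\<in>A. \<Sum>j\<in>B. \<Sum>r\<in>C. \<Sum>s\<in>D. f i j r s) = (\<Sum>r\<in>C. \<Sum>s\<in>D. \<Sum>i\<in>A. \<Sum>j\<in>B. f i j r s)"
proof -
  have "(\<Sum>i\<in>A. \<Sum>j\<in>B. \<Sum>r\<in>C. \<Sum>s\<in>D. f i j r s) = (\<Sum>i\<in>A. \<Sum>r\<in>C. \<Sum>s\<in>D. \<Sum>j\<in>B. f i j r s)"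
    by (rule sum.cong[OF refl], rule sum_rotate)
  then show ?thesis by (simp only: sum_rotate[of _ D C A])
qed

lemma sum_UNIV_prod: "(\<Sum>k\<in>UNIV. f k) = (\<Sum>a\<in>UNIV. \<Sum>b\<in>UNIV. f (a, b))"
  by (simp add: sum.cartesian_product)

lemma sum_if_const: "(\<Sum>i\<in>A. if P then f i else 0) = (if P then \<Sum>i\<in>A. f i else 0)"
  by simp

lemma sum_nonneg_Reals: "(\<And>i. i \<in> A \<Longrightarrow> f i \<in> \<real>\<^sub>\<ge>\<^sub>0) \<Longrightarrow> sum f A \<in> \<real>\<^sub>\<ge>\<^sub>0"
  by (induction A rule: infinite_finite_induct) (auto intro: nonneg_Reals_add_I)

section \<open>Inner products in a Hilbert space\<close>

context hilbert_space
begin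

lemma scalar_closed [simp]: "c \<in> carrier complex_ring"
  by (simp add: complex_ring_def)

lemma smult_in [simp, intro]: "v \<in> carrier H \<Longrightarrow> c \<odot> v \<in> carrier H"
  by (rule smult_closed) simp_all

lemma hinner_add_right:
  "\<lbrakk>u \<in> carrier H; v \<in> carrier H; w \<in> carrier H\<rbrakk> \<Longrightarrow>
    hinner H u (v \<oplus> w) = hinner H u v + hinner H u w"
  by (metis M.a_closed complex_cnj_add hinner_add hinner_commute)

lemma hinner_smult_right:
  "\<lbrakk>v \<in> carrier H; w \<in> carrier H\<rbrakk> \<Longrightarrow> hinner H v (c \<odot> w) = cnj c * hinner H v w"
  by (metis complex_cnj_mult hinner_commute hinner_smult smult_in)

lemma hinner_zero_left [simp]: "w \<in> carrier H \<Longrightarrow> hinner H \<zero> w = 0"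
  using hinner_add[of \<zero> \<zero> w] by simp

lemma hinner_zero_right [simp]: "w \<in> carrier H \<Longrightarrow> hinner H w \<zero> = 0"
  using hinner_add_right[of w \<zero> \<zero>] by simp

lemma hinner_diff_left:
  assumes "u \<in> carrier H" "v \<in> carrier H" "w \<in> carrier H"
  shows "hinner H (u \<ominus> v) w = hinner H u w - hinner H v w"
proof -
  have "hinner H (\<ominus> v) w + hinner H v w = 0"
    using hinner_add[of "\<ominus> v" v w] assms by (simp add: M.l_neg)
  then show ?thesis
    using assms by (simp add: a_minus_def hinner_add eq_neg_iff_add_eq_0)
qed

lemma hinner_diff_right:
  assumes "u \<in> carrier H" "v \<in> carrier H" "w \<in> carrier H"
  shows "hinner H w (u \<ominus> v) = hinner H w u - hinner H w v"
  using hinner_diff_left[OF assms] hinner_commute[of w "u \<ominus> v"] hinner_commute[of w u]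
    hinner_commute[of w v] assms by simp

lemmas hinner_linear = hinner_add hinner_add_right hinner_smult hinner_smult_right
  hinner_diff_left hinner_diff_right

lemma hinner_finsum_left:
  assumes "finite A" "\<And>i. i \<in> A \<Longrightarrow> f i \<in> carrier H" "w \<in> carrier H"
  shows "hinner H (finsum H f A) w = (\<Sum>i\<in>A. hinner H (f i) w)"
  using assms
proof (induction A rule: finite_induct)
  case (insert a A)
  then have "finsum H f (insert a A) = f a \<oplus> finsum H f A"
    by (intro M.finsum_insert) auto
  moreover have "finsum H f A \<in> carrier H"
    using insert by (intro M.finsum_closed) auto
  ultimately show ?case
    using insert by (simp add: hinner_add)
qed simp

lemma finsum_in: "(\<And>i. i \<in> A \<Longrightarrow> f i \<in> carrier H) \<Longrightarrow> finsum H f A \<in> carrier H"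
  by (rule M.finsum_closed) auto

lemma hinner_finsum_right:
  assumes "finite A" "\<And>i. i \<in> A \<Longrightarrow> f i \<in> carrier H" "w \<in> carrier H"
  shows "hinner H w (finsum H f A) = (\<Sum>i\<in>A. hinner H w (f i))"
proof -
  have "hinner H w (finsum H f A) = cnj (\<Sum>i\<in>A. hinner H (f i) w)"
    by (subst hinner_finsum_left[OF assms, symmetric]) (auto intro: hinner_commute assms finsum_in)
  also have "\<dots> = (\<Sum>i\<in>A. hinner H w (f i))"
    unfolding cnj_sum by (rule sum.cong) (use assms in \<open>simp_all add: hinner_commute[of w]\<close>)
  finally show ?thesis .
qed

text \<open>
  Testing against all vectors turns an identity between vectors into identities between complex
  numbers.
\<close>

lemma hinner_ext:
  assumes "u \<in> carrier H" "v \<in> carrier H" "\<And>w. w \<in> carrier H \<Longrightarrow> hinner H u w = hinner H v w"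
  shows "u = v"
proof -
  have "hinner H (u \<ominus> v) (u \<ominus> v) = 0"
    using assms by (simp add: hinner_diff_left)
  then have "u \<ominus> v = \<zero>"
    using assms by (intro hinner_definite) auto
  then show ?thesis
    using assms M.minus_equality[of u "\<ominus> v"] by (simp add: a_minus_def)
qed

lemma hnorm_nonneg [simp]: "0 \<le> hnorm H v" if "v \<in> carrier H"
  using hinner_nonneg[OF that] by (auto simp: hnorm_def complex_nonneg_Reals_iff)

lemma hinner_self: "v \<in> carrier H \<Longrightarrow> hinner H v v = of_real ((hnorm H v)\<^sup>2)"
  using hinner_nonneg[of v] by (auto simp: hnorm_def complex_nonneg_Reals_iff complex_eq_iff)

lemma hnorm_eq_0: "v \<in> carrier H \<Longrightarrow> hnorm H v = 0 \<Longrightarrow> v = \<zero>"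
  using hinner_self[of v] hinner_definite[of v] by simp

lemma hnorm_zero [simp]: "hnorm H \<zero> = 0"
  by (simp add: hnorm_def)

lemma Re_hinner_commute: "u \<in> carrier H \<Longrightarrow> v \<in> carrier H \<Longrightarrow> Re (hinner H u v) = Re (hinner H v u)"
  using arg_cong[OF hinner_commute[of u v], of Re] by simp

lemma Cauchy_Schwarz:
  assumes u: "u \<in> carrier H" and v: "v \<in> carrier H"
  shows "cmod (hinner H u v) \<le> hnorm H u * hnorm H v"
proof (cases "hnorm H v = 0")
  case True
  then show ?thesis using hnorm_eq_0[OF v] u by simp
next
  case False
  define d where "d = (hnorm H v)\<^sup>2"
  define a where "a = hinner H u v"
  define w where "w = (of_real d \<odot> u) \<ominus> (a \<odot> v)"
  have d: "d > 0" using False by (simp add: d_def)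
  have w: "w \<in> carrier H" using u v by (simp add: w_def)
  have vv: "hinner H v v = of_real d" using hinner_self[OF v] by (simp add: d_def)
  have vu: "hinner H v u = cnj a" using hinner_commute[OF v u] by (simp add: a_def)
  have "hinner H w w = of_real d * (of_real d * hinner H u u - a * cnj a)"
    using u v by (simp add: w_def hinner_linear vv vu a_def[symmetric] algebra_simps)
  then have "(hnorm H w)\<^sup>2 = d * (d * (hnorm H u)\<^sup>2 - (cmod a)\<^sup>2)"
    using hinner_self[OF w] hinner_self[OF u]
    by (simp add: complex_norm_square[symmetric] flip: of_real_mult of_real_diff of_real_power)
  then have "0 \<le> d * (hnorm H u)\<^sup>2 - (cmod a)\<^sup>2"
    using d by (metis mult_nonneg_nonneg zero_le_mult_iff zero_le_power2 not_less)
  then have "(cmod a)\<^sup>2 \<le> (hnorm H u * hnorm H v)\<^sup>2"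
    by (simp add: d_def power_mult_distrib mult.commute)
  then show ?thesis
    unfolding a_def using u v by (meson power2_le_imp_le hnorm_nonneg mult_nonneg_nonneg)
qed

lemma hinner_tendsto:
  assumes "\<And>n. s n \<in> carrier H" "v \<in> carrier H" "w \<in> carrier H"
    and "(\<lambda>n. hnorm H (s n \<ominus> v)) \<longlonglongrightarrow> 0"
  shows "(\<lambda>n. hinner H (s n) w) \<longlonglongrightarrow> hinner H v w"
proof -
  have "(\<lambda>n. hinner H (s n) w - hinner H v w) \<longlonglongrightarrow> 0"
  proof (rule Lim_null_comparison)
    show "\<forall>\<^sub>F n in sequentially. cmod (hinner H (s n) w - hinner H v w)
            \<le> hnorm H (s n \<ominus> v) * hnorm H w"
      using Cauchy_Schwarz[of "s _ \<ominus> v" w] assms by (simp add: hinner_diff_left)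
    show "(\<lambda>n. hnorm H (s n \<ominus> v) * hnorm H w) \<longlonglongrightarrow> 0"
      using tendsto_mult_right[OF assms(4), of "hnorm H w"] by simp
  qed
  then show ?thesis by (rule LIM_zero_cancel)
qed

section \<open>The Riesz representation theorem\<close>

text \<open>
  The graph \<open>D\<close> of a bounded linear functional on a subspace that need not be closed. The vector
  minimising $\|u\|^2 - 2\,\mathrm{Re}\,s$ over \<open>(u, s) \<in> D\<close> represents the functional: a
  minimising sequence is Cauchy by the parallelogram law, and varying its limit in the direction
  of an element of \<open>D\<close> gives the identity.
\<close>

lemma riesz_graph:
  assumes D: "\<And>u s. (u, s) \<in> D \<Longrightarrow> u \<in> carrier H"
    and bound: "\<And>u s. (u, s) \<in> D \<Longrightarrow> cmod s \<le> C * hnorm H u"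
    and zero: "(\<zero>, 0) \<in> D"
    and lin: "\<And>u s u' s' c. (u, s) \<in> D \<Longrightarrow> (u', s') \<in> D \<Longrightarrow> (u \<oplus> c \<odot> u', s + c * s') \<in> D"
  obtains v us where "v \<in> carrier H" "\<And>u s. (u, s) \<in> D \<Longrightarrow> hinner H u v = s"
    "\<And>n. us n \<in> fst ` D" "(\<lambda>n::nat. hnorm H (us n \<ominus> v)) \<longlonglongrightarrow> 0"
proof -
  define q where "q = (\<lambda>(u, s). Re (hinner H u u) - 2 * Re s)"
  define m where "m = Inf (q ` D)"
  have q_ge: "- C\<^sup>2 \<le> q z" if z: "z \<in> D" for z
  proof -
    obtain u s where us: "z = (u, s)" by (cases z)
    have "Re s \<le> C * hnorm H u"
      using bound[of u s] complex_Re_le_cmod[of s] z us by simp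
    moreover have "0 \<le> (hnorm H u - C)\<^sup>2" by simp
    moreover have "Re (hinner H u u) = (hnorm H u)\<^sup>2"
      using hinner_self[of u] D z us by simp
    ultimately show ?thesis
      using us by (simp add: q_def power2_diff mult.commute)
  qed
  have bdd: "bdd_below (q ` D)" using q_ge by (meson bdd_belowI2)
  have m_le: "m \<le> q z" if "z \<in> D" for z
    unfolding m_def using that bdd by (simp add: cInf_lower)
  have "\<exists>z\<in>D. q z < m + 1 / (real n + 1)" for n
  proof -
    have "Inf (q ` D) < m + 1 / (real n + 1)" by (simp add: m_def add_pos_nonneg)
    then show ?thesis using cInf_lessD[of "q ` D"] zero by fastforce
  qed
  then obtain z where z: "\<And>n. z n \<in> D" "\<And>n::nat. q (z n) < m + 1 / (real n + 1)" by metis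
  define us where "us n = fst (z n)" for n
  define ss where "ss n = snd (z n)" for n
  have zD: "(us n, ss n) \<in> D" for n using z by (simp add: us_def ss_def)
  have uc: "us n \<in> carrier H" for n using zD D by blast
  have qn: "Re (hinner H (us n) (us n)) - 2 * Re (ss n) < m + 1 / (real n + 1)" for n
    using z(2)[of n] by (simp add: q_def us_def ss_def split_beta)
  have close: "(hnorm H (us i \<ominus> us j))\<^sup>2 \<le> 2 / (real i + 1) + 2 / (real j + 1)" for i j
  proof -
    define h where "h = (1/2 :: complex)"
    have "((\<zero> \<oplus> h \<odot> us i) \<oplus> h \<odot> us j, (0 + h * ss i) + h * ss j) \<in> D"
      using zD zero lin by blast
    then have mid: "m \<le> q ((\<zero> \<oplus> h \<odot> us i) \<oplus> h \<odot> us j, (0 + h * ss i) + h * ss j)"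
      by (rule m_le)
    have "4 * q ((\<zero> \<oplus> h \<odot> us i) \<oplus> h \<odot> us j, (0 + h * ss i) + h * ss j)
      = Re (hinner H (us i) (us i)) + Re (hinner H (us j) (us j)) + 2 * Re (hinner H (us i) (us j))
        - 4 * Re (ss i) - 4 * Re (ss j)"
      using uc[of i] uc[of j] Re_hinner_commute[of "us i" "us j"]
      by (simp add: q_def hinner_linear h_def algebra_simps)
    moreover have "(hnorm H (us i \<ominus> us j))\<^sup>2
      = Re (hinner H (us i) (us i)) + Re (hinner H (us j) (us j)) - 2 * Re (hinner H (us i) (us j))"
    proof -
      have "(hnorm H (us i \<ominus> us j))\<^sup>2 = Re (hinner H (us i \<ominus> us j) (us i \<ominus> us j))"
        using hinner_self[of "us i \<ominus> us j"] uc by simp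
      then show ?thesis
        using uc[of i] uc[of j] Re_hinner_commute[of "us i" "us j"]
        by (simp add: hinner_linear)
    qed
    ultimately show ?thesis using mid qn[of i] qn[of j] by argo
  qed
  have "\<exists>M. \<forall>i\<ge>M. \<forall>j\<ge>M. hnorm H (us i \<ominus> us j) < e" if e: "e > 0" for e
  proof -
    obtain M where M: "4 / e\<^sup>2 < real M" using reals_Archimedean2 by blast
    have "hnorm H (us i \<ominus> us j) < e" if "i \<ge> M" "j \<ge> M" for i j
    proof -
      have a: "2 / (real k + 1) < e\<^sup>2 / 2" if "k \<ge> M" for k
      proof -
        have "4 / e\<^sup>2 < real k + 1" using M that by linarith
        then show ?thesis using e by (simp add: field_simps)
      qed
      have "(hnorm H (us i \<ominus> us j))\<^sup>2 < e\<^sup>2"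
        using close[of i j] a[OF that(1)] a[OF that(2)] by linarith
      then show ?thesis using e by (simp add: power2_less_imp_less)
    qed
    then show ?thesis by blast
  qed
  then obtain v where v: "v \<in> carrier H" and lim: "(\<lambda>n. hnorm H (us n \<ominus> v)) \<longlonglongrightarrow> 0"
    using complete[of us] uc by blast
  have "hinner H u v = s" if us: "(u, s) \<in> D" for u s
  proof -
    have u: "u \<in> carrier H" using D us by blast
    define N where "N = Re (hinner H u u)"
    define a where "a = hinner H u v - s"
    have N0: "0 \<le> N" using hinner_nonneg[OF u] by (auto simp: N_def complex_nonneg_Reals_iff)
    have vary: "- (1 / (real n + 1)) \<le> 2 * Re (c * (cnj (hinner H (us n) u) - s)) + (cmod c)\<^sup>2 * N"
      for n c
    proof -
      have cc: "Re (c * (cnj c * hinner H u u)) = (cmod c)\<^sup>2 * N"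
        by (simp add: N_def complex_norm_square[symmetric] flip: mult.assoc of_real_power)
      have "m \<le> q (us n \<oplus> c \<odot> u, ss n + c * s)"
        using lin zD us m_le by blast
      also have "\<dots> = q (us n, ss n) + 2 * Re (c * (cnj (hinner H (us n) u) - s)) + (cmod c)\<^sup>2 * N"
        using uc[of n] u hinner_commute[of u "us n"] cc
        by (simp add: q_def hinner_linear algebra_simps)
      finally show ?thesis using qn[of n] by (simp add: q_def)
    qed
    have lim_u: "(\<lambda>n. cnj (hinner H (us n) u)) \<longlonglongrightarrow> hinner H u v"
      using tendsto_cnj[OF hinner_tendsto[OF uc v u lim]] hinner_commute[OF u v] by simp
    have pos: "0 \<le> 2 * Re (c * a) + (cmod c)\<^sup>2 * N" for c
    proof (rule LIMSEQ_le)
      show "(\<lambda>n. - (1 / (real n + 1))) \<longlonglongrightarrow> 0"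
        using tendsto_minus[OF LIMSEQ_inverse_real_of_nat] by (simp add: inverse_eq_divide add.commute)
      show "(\<lambda>n. 2 * Re (c * (cnj (hinner H (us n) u) - s)) + (cmod c)\<^sup>2 * N)
        \<longlonglongrightarrow> 2 * Re (c * a) + (cmod c)\<^sup>2 * N"
        unfolding a_def by (intro tendsto_intros lim_u)
    qed (use vary in auto)
    \<comment> \<open>in the direction \<open>- t a\<^sup>*\<close> the linear term dominates for small positive \<open>t\<close>\<close>
    have "a = 0"
    proof (rule ccontr)
      assume "a \<noteq> 0"
      then have a0: "(cmod a)\<^sup>2 > 0" by simp
      define t where "t = 1 / (N + 1)"
      have t: "t > 0" "t * N < 1" using N0 by (auto simp: t_def divide_simps)
      have "Re (- (of_real t * cnj a) * a) = - t * (cmod a)\<^sup>2"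
        by (simp add: cmod_power2) (simp add: power2_eq_square algebra_simps)
      moreover have "(cmod (- (of_real t * cnj a)))\<^sup>2 = t\<^sup>2 * (cmod a)\<^sup>2"
        by (simp add: norm_mult power_mult_distrib)
      ultimately have "0 \<le> (cmod a)\<^sup>2 * t * (t * N - 2)"
        using pos[of "- (of_real t * cnj a)"] by (simp add: power2_eq_square algebra_simps)
      moreover have "(cmod a)\<^sup>2 * t * (t * N - 2) < 0"
        using a0 t by (intro mult_pos_neg) auto
      ultimately show False by linarith
    qed
    then show ?thesis by (simp add: a_def)
  qed
  moreover have "us n \<in> fst ` D" for n using zD by force
  ultimately show thesis using that v lim by blast
qed

text \<open>
  The representing vector is a limit of vectors on which it is known to pair boundedly. The bound
  therefore holds for the vector itself, which need not lie in the subspace.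
\<close>

lemma riesz_norm_bound:
  assumes v: "v \<in> carrier H" and us: "\<And>n. us n \<in> carrier H"
    and lim: "(\<lambda>n. hnorm H (us n \<ominus> v)) \<longlonglongrightarrow> 0"
    and bound: "\<And>n. cmod (hinner H (us n) v) \<le> C * hnorm H (us n)"
  shows "(hnorm H v)\<^sup>2 \<le> C * hnorm H v"
proof -
  have lim1: "(\<lambda>n. hinner H (us n) v) \<longlonglongrightarrow> hinner H v v"
    by (rule hinner_tendsto[OF us v v lim])
  have "hnorm H (us n) = sqrt ((hnorm H (us n \<ominus> v))\<^sup>2 + 2 * Re (hinner H (us n) v) - (hnorm H v)\<^sup>2)"
    for n
  proof -
    have "(hnorm H (us n))\<^sup>2 = (hnorm H (us n \<ominus> v))\<^sup>2 + 2 * Re (hinner H (us n) v) - (hnorm H v)\<^sup>2"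
      using arg_cong[OF hinner_self[of "us n"], of Re] arg_cong[OF hinner_self[of v], of Re]
        us[of n] v
        Re_hinner_commute[of v "us n"] arg_cong[OF hinner_self[of "us n \<ominus> v"], of Re]
      by (simp add: hinner_linear)
    then show ?thesis using us[of n] by (metis hnorm_nonneg real_sqrt_abs abs_of_nonneg)
  qed
  moreover have "(\<lambda>n. sqrt ((hnorm H (us n \<ominus> v))\<^sup>2 + 2 * Re (hinner H (us n) v) - (hnorm H v)\<^sup>2))
      \<longlonglongrightarrow> sqrt (0\<^sup>2 + 2 * Re (hinner H v v) - (hnorm H v)\<^sup>2)"
    by (intro tendsto_intros lim lim1)
  moreover have "sqrt (0\<^sup>2 + 2 * Re (hinner H v v) - (hnorm H v)\<^sup>2) = hnorm H v"
    using hinner_self[OF v] v by simp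
  ultimately have lim2: "(\<lambda>n. hnorm H (us n)) \<longlonglongrightarrow> hnorm H v" by simp
  have "cmod (hinner H v v) \<le> C * hnorm H v"
    by (rule LIMSEQ_le[OF tendsto_norm[OF lim1] tendsto_mult_left[OF lim2]]) (use bound in auto)
  then show ?thesis using hinner_self[OF v] by (simp add: norm_power)
qed

end

section \<open>Bounded operators and their adjoints\<close>

context hilbert_space
begin

abbreviation ops :: "('k \<Rightarrow> 'k) set" where "ops \<equiv> carrier (\<B> H)"

lemma ops_iff: "T \<in> ops \<longleftrightarrow> T \<in> carrier H \<rightarrow>\<^sub>E carrier H \<and>
    (\<forall>v\<in>carrier H. \<forall>w\<in>carrier H. T (v \<oplus> w) = T v \<oplus> T w) \<and>
    (\<forall>c. \<forall>v\<in>carrier H. T (c \<odot> v) = c \<odot> T v) \<and>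
    (\<exists>C. \<forall>v\<in>carrier H. hnorm H (T v) \<le> C * hnorm H v)"
  by (simp add: bounded_ops_def)

lemma op_in [simp, intro]: "T \<in> ops \<Longrightarrow> v \<in> carrier H \<Longrightarrow> T v \<in> carrier H"
  by (auto simp: ops_iff)

lemma op_add: "T \<in> ops \<Longrightarrow> v \<in> carrier H \<Longrightarrow> w \<in> carrier H \<Longrightarrow> T (v \<oplus> w) = T v \<oplus> T w"
  by (simp add: ops_iff)

lemma op_smult: "T \<in> ops \<Longrightarrow> v \<in> carrier H \<Longrightarrow> T (c \<odot> v) = c \<odot> T v"
  by (simp add: ops_iff)

lemma op_bounded:
  assumes "T \<in> ops"
  obtains C where "C \<ge> 0" "\<And>v. v \<in> carrier H \<Longrightarrow> hnorm H (T v) \<le> C * hnorm H v"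
proof -
  obtain C where C: "\<forall>v\<in>carrier H. hnorm H (T v) \<le> C * hnorm H v"
    using assms by (auto simp: ops_iff)
  have "hnorm H (T v) \<le> \<bar>C\<bar> * hnorm H v" if v: "v \<in> carrier H" for v
    using C v by (meson abs_ge_self hnorm_nonneg mult_right_mono order_trans)
  then show thesis using that[of "\<bar>C\<bar>"] by simp
qed

lemma restrict_ops:
  assumes "\<And>v. v \<in> carrier H \<Longrightarrow> f v \<in> carrier H"
    and "\<And>v w. v \<in> carrier H \<Longrightarrow> w \<in> carrier H \<Longrightarrow> f (v \<oplus> w) = f v \<oplus> f w"
    and "\<And>c v. v \<in> carrier H \<Longrightarrow> f (c \<odot> v) = c \<odot> f v"
    and "\<And>v. v \<in> carrier H \<Longrightarrow> hnorm H (f v) \<le> C * hnorm H v"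
  shows "restrict f (carrier H) \<in> ops"
  using assms by (auto simp: ops_iff intro!: exI[of _ C])

lemma op_eqI:
  assumes "S \<in> ops" "T \<in> ops" "\<And>v. v \<in> carrier H \<Longrightarrow> S v = T v"
  shows "S = T"
  using assms by (auto simp: ops_iff intro: PiE_ext)

lemma op_hinner_eqI:
  assumes "S \<in> ops" "T \<in> ops"
    and "\<And>v w. v \<in> carrier H \<Longrightarrow> w \<in> carrier H \<Longrightarrow> hinner H (S v) w = hinner H (T v) w"
  shows "S = T"
  using assms by (intro op_eqI hinner_ext) auto

lemma op_mult_apply [simp]: "v \<in> carrier H \<Longrightarrow> (S \<otimes>\<^bsub>\<B> H\<^esub> T) v = S (T v)"
  by (simp add: bounded_ops_def compose_def)

lemma op_add_apply [simp]: "v \<in> carrier H \<Longrightarrow> (S \<oplus>\<^bsub>\<B> H\<^esub> T) v = S v \<oplus> T v"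
  by (simp add: bounded_ops_def)

lemma op_smult_apply [simp]: "v \<in> carrier H \<Longrightarrow> (c \<odot>\<^bsub>\<B> H\<^esub> T) v = c \<odot> T v"
  by (simp add: bounded_ops_def)

lemma op_one_apply [simp]: "v \<in> carrier H \<Longrightarrow> \<one>\<^bsub>\<B> H\<^esub> v = v"
  by (simp add: bounded_ops_def)

lemma op_zero_apply [simp]: "v \<in> carrier H \<Longrightarrow> \<zero>\<^bsub>\<B> H\<^esub> v = \<zero>"
  by (simp add: bounded_ops_def)

lemma hnorm_smult: "v \<in> carrier H \<Longrightarrow> hnorm H (c \<odot> v) = cmod c * hnorm H v"
proof -
  assume v: "v \<in> carrier H"
  have "complex_of_real ((hnorm H (c \<odot> v))\<^sup>2) = of_real ((cmod c * hnorm H v)\<^sup>2)"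
    using hinner_self[of "c \<odot> v"] hinner_self[OF v] v complex_norm_square[of c]
    by (simp add: hinner_smult hinner_smult_right power_mult_distrib mult_ac)
  then show ?thesis
    using v by (metis hnorm_nonneg mult_nonneg_nonneg norm_ge_zero of_real_eq_iff power2_eq_iff_nonneg smult_in)
qed

lemma hnorm_triangle:
  assumes "u \<in> carrier H" "v \<in> carrier H"
  shows "hnorm H (u \<oplus> v) \<le> hnorm H u + hnorm H v"
proof -
  have "(hnorm H (u \<oplus> v))\<^sup>2 = (hnorm H u)\<^sup>2 + (hnorm H v)\<^sup>2 + 2 * Re (hinner H u v)"
    using arg_cong[OF hinner_self[of "u \<oplus> v"], of Re] arg_cong[OF hinner_self[of u], of Re]
      arg_cong[OF hinner_self[of v], of Re] assms Re_hinner_commute[of u v]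
    by (simp add: hinner_linear)
  also have "\<dots> \<le> (hnorm H u + hnorm H v)\<^sup>2"
    using Cauchy_Schwarz[OF assms] complex_Re_le_cmod[of "hinner H u v"]
    by (simp add: power2_sum)
  finally show ?thesis
    using assms by (meson add_nonneg_nonneg hnorm_nonneg power2_le_imp_le)
qed

lemma op_mult_closed [simp, intro]:
  assumes S: "S \<in> ops" and T: "T \<in> ops" shows "S \<otimes>\<^bsub>\<B> H\<^esub> T \<in> ops"
proof -
  obtain C where C: "C \<ge> 0" "\<And>v. v \<in> carrier H \<Longrightarrow> hnorm H (S v) \<le> C * hnorm H v"
    using op_bounded[OF S] by blast
  obtain D where D: "D \<ge> 0" "\<And>v. v \<in> carrier H \<Longrightarrow> hnorm H (T v) \<le> D * hnorm H v"
    using op_bounded[OF T] by blast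
  have "hnorm H (S (T v)) \<le> (C * D) * hnorm H v" if "v \<in> carrier H" for v
    using C(2)[of "T v"] mult_left_mono[OF D(2)[OF that] C(1)] that T by (simp add: mult.assoc)
  then have "restrict (\<lambda>v. S (T v)) (carrier H) \<in> ops"
    by (intro restrict_ops[where C = "C * D"]) (use S T in \<open>auto simp: op_add op_smult\<close>)
  then show ?thesis by (simp add: bounded_ops_def compose_def)
qed

lemma op_add_closed [simp, intro]:
  assumes S: "S \<in> ops" and T: "T \<in> ops" shows "S \<oplus>\<^bsub>\<B> H\<^esub> T \<in> ops"
proof -
  obtain C where C: "C \<ge> 0" "\<And>v. v \<in> carrier H \<Longrightarrow> hnorm H (S v) \<le> C * hnorm H v"
    using op_bounded[OF S] by blast
  obtain D where D: "D \<ge> 0" "\<And>v. v \<in> carrier H \<Longrightarrow> hnorm H (T v) \<le> D * hnorm H v"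
    using op_bounded[OF T] by blast
  have "hnorm H (S v \<oplus> T v) \<le> (C + D) * hnorm H v" if "v \<in> carrier H" for v
    using hnorm_triangle[of "S v" "T v"] C(2)[OF that] D(2)[OF that] that S T
    by (simp add: distrib_right)
  then have "restrict (\<lambda>v. S v \<oplus> T v) (carrier H) \<in> ops"
    by (intro restrict_ops[where C = "C + D"])
       (use S T in \<open>auto simp: op_add op_smult M.a_ac smult_r_distr\<close>)
  then show ?thesis by (simp add: bounded_ops_def)
qed

lemma smult_smult: "v \<in> carrier H \<Longrightarrow> c \<odot> (d \<odot> v) = (c * d) \<odot> v"
  by (rule hinner_ext) (auto simp: hinner_smult)

lemma op_smult_closed [simp, intro]:
  assumes T: "T \<in> ops" shows "c \<odot>\<^bsub>\<B> H\<^esub> T \<in> ops"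
proof -
  obtain D where D: "D \<ge> 0" "\<And>v. v \<in> carrier H \<Longrightarrow> hnorm H (T v) \<le> D * hnorm H v"
    using op_bounded[OF T] by blast
  have "hnorm H (c \<odot> T v) \<le> (cmod c * D) * hnorm H v" if "v \<in> carrier H" for v
    using D(2)[OF that] that T by (simp add: hnorm_smult mult.assoc mult_left_mono)
  then have "restrict (\<lambda>v. c \<odot> T v) (carrier H) \<in> ops"
    by (intro restrict_ops[where C = "cmod c * D"])
       (use T in \<open>auto simp: op_add op_smult smult_r_distr smult_smult mult.commute\<close>)
  then show ?thesis by (simp add: bounded_ops_def)
qed

lemma op_one_closed [simp, intro]: "\<one>\<^bsub>\<B> H\<^esub> \<in> ops"
  using restrict_ops[of "\<lambda>v. v" 1] by (simp add: bounded_ops_def)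

lemma op_zero_closed [simp, intro]: "\<zero>\<^bsub>\<B> H\<^esub> \<in> ops"
  using restrict_ops[of "\<lambda>v. \<zero>" 0] by (simp add: bounded_ops_def)

lemma ops_abelian_monoid: "abelian_monoid (\<B> H)"
  by (rule abelian_monoidI; (intro op_eqI)?) (auto simp: M.a_ac)

lemma op_finsum:
  assumes "finite A" "\<And>i. i \<in> A \<Longrightarrow> T i \<in> ops"
  shows op_finsum_closed: "finsum (\<B> H) T A \<in> ops"
    and op_finsum_apply: "\<And>v. v \<in> carrier H \<Longrightarrow> finsum (\<B> H) T A v = finsum H (\<lambda>i. T i v) A"
proof -
  interpret O: abelian_monoid "\<B> H" by (rule ops_abelian_monoid)
  have "finsum (\<B> H) T A \<in> ops \<and>
      (\<forall>v \<in> carrier H. finsum (\<B> H) T A v = finsum H (\<lambda>i. T i v) A)"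
    using assms
  proof (induction A rule: finite_induct)
    case (insert a A)
    then have "finsum (\<B> H) T (insert a A) = T a \<oplus>\<^bsub>\<B> H\<^esub> finsum (\<B> H) T A"
      by (intro O.finsum_insert) auto
    moreover have "finsum H (\<lambda>i. T i v) (insert a A) = T a v \<oplus> finsum H (\<lambda>i. T i v) A"
      if "v \<in> carrier H" for v
      using insert that by (intro M.finsum_insert) auto
    ultimately show ?case using insert by auto
  qed simp
  then show "finsum (\<B> H) T A \<in> ops"
    and "\<And>v. v \<in> carrier H \<Longrightarrow> finsum (\<B> H) T A v = finsum H (\<lambda>i. T i v) A"
    by auto
qed

lemma hinner_op_finsum:
  assumes "finite A" "\<And>i. i \<in> A \<Longrightarrow> T i \<in> ops" "v \<in> carrier H" "w \<in> carrier H"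
  shows "hinner H (finsum (\<B> H) T A v) w = (\<Sum>i\<in>A. hinner H (T i v) w)"
  using assms by (simp add: op_finsum_apply hinner_finsum_left)

text \<open>
  The vector that represents \<open>u \<mapsto> \<langle>T u, w\<rangle>\<close> is the value of the adjoint at \<open>w\<close>.
\<close>

lemma op_adj_exists:
  assumes T: "T \<in> ops"
  shows "\<exists>S\<in>ops. \<forall>v\<in>carrier H. \<forall>w\<in>carrier H. hinner H (T v) w = hinner H v (S w)"
proof -
  obtain C where C: "C \<ge> 0" "\<And>v. v \<in> carrier H \<Longrightarrow> hnorm H (T v) \<le> C * hnorm H v"
    using op_bounded[OF T] by blast
  have ex: "\<exists>v\<in>carrier H. \<forall>u\<in>carrier H. hinner H u v = hinner H (T u) w"
    if w: "w \<in> carrier H" for w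
  proof -
    define D where "D = {(u, hinner H (T u) w) | u. u \<in> carrier H}"
    obtain v where "v \<in> carrier H" "\<And>u s. (u, s) \<in> D \<Longrightarrow> hinner H u v = s"
    proof (rule riesz_graph[of D "C * hnorm H w"])
      fix u s assume us: "(u, s) \<in> D"
      then have "cmod s \<le> hnorm H (T u) * hnorm H w"
        using Cauchy_Schwarz[of "T u" w] T w by (auto simp: D_def)
      also have "\<dots> \<le> C * hnorm H w * hnorm H u"
        using mult_right_mono[OF C(2)[of u] hnorm_nonneg[OF w]] us
        by (auto simp: D_def mult_ac)
      finally show "cmod s \<le> C * hnorm H w * hnorm H u" .
    next
      have "T \<zero> = \<zero>" using op_smult[OF T M.zero_closed, of 0]
        by (metis M.zero_closed T hinner_ext hinner_smult mult_zero_left op_in smult_in hinner_zero_left)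
      then show "(\<zero>, 0) \<in> D" using w by (auto simp: D_def intro!: exI[of _ \<zero>])
    qed (use T w in \<open>auto simp: D_def op_add op_smult hinner_linear\<close>)
    then show ?thesis unfolding D_def by blast
  qed
  define f where "f w = (SOME v. v \<in> carrier H \<and> (\<forall>u\<in>carrier H. hinner H u v = hinner H (T u) w))"
    for w
  have f: "f w \<in> carrier H" "\<And>u. u \<in> carrier H \<Longrightarrow> hinner H u (f w) = hinner H (T u) w"
    if "w \<in> carrier H" for w
    using someI_ex[OF ex[OF that, unfolded Bex_def]] unfolding f_def by auto
  have f': "hinner H (f w) u = hinner H w (T u)" if "w \<in> carrier H" "u \<in> carrier H" for w u
    using f[of w] that hinner_commute[of "f w" u] hinner_commute[of w "T u"] T by simp
  have "restrict f (carrier H) \<in> ops"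
  proof (rule restrict_ops[where C = C])
    fix w assume w: "w \<in> carrier H"
    have "(hnorm H (f w))\<^sup>2 = cmod (hinner H (f w) (f w))"
      using hinner_self[of "f w"] f w by (simp add: norm_power)
    also have "\<dots> \<le> hnorm H (T (f w)) * hnorm H w"
      using Cauchy_Schwarz[of "T (f w)" w] f w T by simp
    also have "\<dots> \<le> C * hnorm H (f w) * hnorm H w"
      using f w C by (simp add: mult_right_mono)
    finally have "hnorm H (f w) * hnorm H (f w) \<le> hnorm H (f w) * (C * hnorm H w)"
      by (simp add: power2_eq_square mult_ac)
    then show "hnorm H (f w) \<le> C * hnorm H w"
      using C(1) w f(1)[OF w] hnorm_nonneg
      by (metis mult_left_le_imp_le mult_nonneg_nonneg order_le_less)
  qed (auto simp: f intro!: hinner_ext simp: hinner_linear f' T)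
  then show ?thesis
    using f by (intro bexI[of _ "restrict f (carrier H)"]) auto
qed

lemma op_adj_eqI:
  assumes "T \<in> ops" "S \<in> ops"
    and "\<And>v w. v \<in> carrier H \<Longrightarrow> w \<in> carrier H \<Longrightarrow> hinner H (T v) w = hinner H v (S w)"
  shows "op_adj H T = S"
  unfolding op_adj_def
proof (rule the_equality)
  fix R assume R: "R \<in> ops \<and> (\<forall>v\<in>carrier H. \<forall>w\<in>carrier H. hinner H (T v) w = hinner H v (R w))"
  show "R = S"
  proof (rule op_eqI)
    fix w assume w: "w \<in> carrier H"
    show "R w = S w"
    proof (rule hinner_ext)
      fix v assume v: "v \<in> carrier H"
      have "hinner H v (R w) = hinner H v (S w)" using R assms v w by metis
      then show "hinner H (R w) v = hinner H (S w) v"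
        using hinner_commute[of "R w" v] hinner_commute[of "S w" v] R assms v w by auto
    qed (use R assms w in auto)
  qed (use R assms in auto)
qed (use assms in auto)

lemma
  assumes T: "T \<in> ops"
  shows op_adj_closed [simp, intro]: "op_adj H T \<in> ops"
    and hinner_op_adj_right: "\<And>v w. v \<in> carrier H \<Longrightarrow> w \<in> carrier H \<Longrightarrow>
      hinner H v (op_adj H T w) = hinner H (T v) w"
    and hinner_op_adj_left: "\<And>v w. v \<in> carrier H \<Longrightarrow> w \<in> carrier H \<Longrightarrow>
      hinner H (op_adj H T v) w = hinner H v (T w)"
proof -
  obtain S where S: "S \<in> ops" "\<forall>v\<in>carrier H. \<forall>w\<in>carrier H. hinner H (T v) w = hinner H v (S w)"
    using op_adj_exists[OF T] by blast
  have eq: "op_adj H T = S" using S T by (intro op_adj_eqI) auto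
  show "op_adj H T \<in> ops" using S eq by simp
  show 1: "hinner H v (op_adj H T w) = hinner H (T v) w" if "v \<in> carrier H" "w \<in> carrier H" for v w
    using S eq that by simp
  show "hinner H (op_adj H T v) w = hinner H v (T w)" if "v \<in> carrier H" "w \<in> carrier H" for v w
    using 1[OF that(2,1)] hinner_commute[of "op_adj H T v" w] hinner_commute[of v "T w"] S eq that T
    by simp
qed

lemma op_zero [simp]: "T \<in> ops \<Longrightarrow> T \<zero> = \<zero>"
  by (rule hinner_ext) (auto simp: hinner_op_adj_right[symmetric])

lemma op_adj_adj [simp]: "T \<in> ops \<Longrightarrow> op_adj H (op_adj H T) = T"
  by (rule op_adj_eqI) (auto simp: hinner_op_adj_left)

lemma op_adj_mult:
  "S \<in> ops \<Longrightarrow> T \<in> ops \<Longrightarrow> op_adj H (S \<otimes>\<^bsub>\<B> H\<^esub> T) = op_adj H T \<otimes>\<^bsub>\<B> H\<^esub> op_adj H S"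
  by (rule op_adj_eqI) (auto simp: hinner_op_adj_right)

lemma op_mult_assoc:
  "R \<in> ops \<Longrightarrow> S \<in> ops \<Longrightarrow> T \<in> ops \<Longrightarrow>
    (R \<otimes>\<^bsub>\<B> H\<^esub> S) \<otimes>\<^bsub>\<B> H\<^esub> T = R \<otimes>\<^bsub>\<B> H\<^esub> (S \<otimes>\<^bsub>\<B> H\<^esub> T)"
  by (rule op_eqI) auto

lemma op_commute_iff:
  assumes "S \<in> ops" "T \<in> ops"
  shows "S \<otimes>\<^bsub>\<B> H\<^esub> T = T \<otimes>\<^bsub>\<B> H\<^esub> S \<longleftrightarrow> (\<forall>v\<in>carrier H. S (T v) = T (S v))"
proof
  assume eq: "S \<otimes>\<^bsub>\<B> H\<^esub> T = T \<otimes>\<^bsub>\<B> H\<^esub> S"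
  show "\<forall>v\<in>carrier H. S (T v) = T (S v)"
  proof
    fix v assume "v \<in> carrier H"
    then show "S (T v) = T (S v)" using fun_cong[OF eq, of v] by simp
  qed
next
  assume "\<forall>v\<in>carrier H. S (T v) = T (S v)"
  then show "S \<otimes>\<^bsub>\<B> H\<^esub> T = T \<otimes>\<^bsub>\<B> H\<^esub> S"
    using assms by (intro op_eqI) auto
qed


lemma commutant_von_neumann:
  assumes C: "C \<subseteq> ops" and adj: "\<And>S. S \<in> C \<Longrightarrow> op_adj H S \<in> C"
  shows "von_neumann_algebra H (commutant H C)"
proof -
  have anti: "commutant H B \<subseteq> commutant H A" if "A \<subseteq> B" for A B
    using that by (auto simp: commutant_def)
  have unit: "A \<subseteq> commutant H (commutant H A)" if "A \<subseteq> ops" for A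
    using that by (auto simp: commutant_def)
  have "op_adj H T \<in> commutant H C" if T: "T \<in> commutant H C" for T
  proof -
    have "op_adj H T \<otimes>\<^bsub>\<B> H\<^esub> S = S \<otimes>\<^bsub>\<B> H\<^esub> op_adj H T" if S: "S \<in> C" for S
    proof -
      have "T \<otimes>\<^bsub>\<B> H\<^esub> op_adj H S = op_adj H S \<otimes>\<^bsub>\<B> H\<^esub> T"
        using T adj[OF S] by (auto simp: commutant_def)
      then have "op_adj H (T \<otimes>\<^bsub>\<B> H\<^esub> op_adj H S) = op_adj H (op_adj H S \<otimes>\<^bsub>\<B> H\<^esub> T)" by simp
      then show ?thesis using T S C by (subst (asm) (1 2) op_adj_mult) (auto simp: commutant_def subset_iff)
    qed
    then show ?thesis using T by (auto simp: commutant_def)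
  qed
  moreover have "commutant H (commutant H (commutant H C)) = commutant H C"
  proof
    show "commutant H (commutant H (commutant H C)) \<subseteq> commutant H C"
      using anti[OF unit[OF C]] .
    show "commutant H C \<subseteq> commutant H (commutant H (commutant H C))"
      by (rule unit) (auto simp: commutant_def)
  qed
  ultimately show ?thesis by (auto simp: von_neumann_algebra_def commutant_def)
qed

section \<open>Total families of vectors\<close>

definition comb :: "('i \<Rightarrow> 'k) \<Rightarrow> 'i set \<Rightarrow> ('i \<Rightarrow> complex) \<Rightarrow> 'k" where
  "comb g A c = finsum H (\<lambda>i. c i \<odot> g i) A"

lemma comb_in [simp, intro]: "(\<And>i. g i \<in> carrier H) \<Longrightarrow> comb g A c \<in> carrier H"
  unfolding comb_def by (rule finsum_in) auto

lemma hinner_comb_left: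
  "finite A \<Longrightarrow> (\<And>i. g i \<in> carrier H) \<Longrightarrow> w \<in> carrier H \<Longrightarrow>
    hinner H (comb g A c) w = (\<Sum>i\<in>A. c i * hinner H (g i) w)"
  by (simp add: comb_def hinner_finsum_left hinner_smult)

lemma hinner_comb_right:
  "finite A \<Longrightarrow> (\<And>i. g i \<in> carrier H) \<Longrightarrow> w \<in> carrier H \<Longrightarrow>
    hinner H w (comb g A c) = (\<Sum>i\<in>A. cnj (c i) * hinner H w (g i))"
  by (simp add: comb_def hinner_finsum_right hinner_smult_right)

text \<open>
  A vector with prescribed inner products against a family exists as soon as the prescription is
  bounded on the linear combinations of the family.
\<close>

lemma riesz_family:
  assumes g: "\<And>i. g i \<in> carrier H" and C: "C \<ge> 0"
    and bound: "\<And>A c. finite A \<Longrightarrow> cmod (\<Sum>i\<in>A. c i * f i) \<le> C * hnorm H (comb g A c)"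
  obtains v As cs where "v \<in> carrier H" "hnorm H v \<le> C" "\<And>i. hinner H (g i) v = f i"
    "\<And>n::nat. finite (As n)" "(\<lambda>n. hnorm H (comb g (As n) (cs n) \<ominus> v)) \<longlonglongrightarrow> 0"
proof -
  define D where "D = {(comb g A c, \<Sum>i\<in>A. c i * f i) | A c. finite A}"
  have DI: "finite A \<Longrightarrow> (comb g A c, \<Sum>i\<in>A. c i * f i) \<in> D" for A c
    by (auto simp: D_def)
  obtain v us where v: "v \<in> carrier H" "\<And>u s. (u, s) \<in> D \<Longrightarrow> hinner H u v = s"
    "\<And>n. us n \<in> fst ` D" "(\<lambda>n::nat. hnorm H (us n \<ominus> v)) \<longlonglongrightarrow> 0"
  proof (rule riesz_graph[of D C])
    show "(\<zero>, 0) \<in> D" using DI[of "{}"] by (simp add: comb_def)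
  next
    fix u s u' s' d assume "(u, s) \<in> D" "(u', s') \<in> D"
    then obtain A c A' c' where A: "finite A" "u = comb g A c" "s = (\<Sum>i\<in>A. c i * f i)"
      and A': "finite A'" "u' = comb g A' c'" "s' = (\<Sum>i\<in>A'. c' i * f i)"
      by (auto simp: D_def)
    define e where "e i = (if i \<in> A then c i else 0) + d * (if i \<in> A' then c' i else 0)" for i
    have e: "(\<Sum>i\<in>A \<union> A'. e i * F i) = (\<Sum>i\<in>A. c i * F i) + d * (\<Sum>i\<in>A'. c' i * F i)" for F
    proof -
      have "(\<Sum>i\<in>A \<union> A'. (if i \<in> A then c i else 0) * F i) = (\<Sum>i\<in>A. c i * F i)"
        using A A' by (intro sum.mono_neutral_cong_right) auto
      moreover have "(\<Sum>i\<in>A \<union> A'. (if i \<in> A' then c' i else 0) * F i) = (\<Sum>i\<in>A'. c' i * F i)"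
        using A A' by (intro sum.mono_neutral_cong_right) auto
      ultimately show ?thesis
        by (simp add: e_def distrib_right sum.distrib mult.assoc flip: sum_distrib_left)
    qed
    have "u \<oplus> d \<odot> u' = comb g (A \<union> A') e"
      by (rule hinner_ext) (use A A' g in \<open>auto simp: hinner_linear hinner_comb_left e\<close>)
    then show "(u \<oplus> d \<odot> u', s + d * s') \<in> D"
      using DI[of "A \<union> A'" e] A A' e[of f] by simp
  next
    fix u s assume "(u, s) \<in> D"
    then show "cmod s \<le> C * hnorm H u" using bound by (auto simp: D_def)
  qed (use g in \<open>auto simp: D_def\<close>)
  have us_in: "us n \<in> carrier H" for n using v(3)[of n] g by (auto simp: D_def)
  have "(hnorm H v)\<^sup>2 \<le> C * hnorm H v"
  proof (rule riesz_norm_bound[OF v(1) us_in v(4)])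
    fix n
    obtain A c where A: "finite A" "us n = comb g A c" using v(3)[of n] by (auto simp: D_def)
    then show "cmod (hinner H (us n) v) \<le> C * hnorm H (us n)"
      using v(2)[OF DI[OF A(1), of c]] bound[OF A(1), of c] by simp
  qed
  then have norm: "hnorm H v \<le> C"
    using C hnorm_nonneg[OF v(1)] by (simp add: power2_eq_square mult_le_cancel_right order_le_less)
      (auto simp: order_le_less)
  have "hinner H (g i) v = f i" for i
  proof -
    have "comb g {i} (\<lambda>_. 1) = g i"
      by (rule hinner_ext) (use g in \<open>auto simp: hinner_comb_left\<close>)
    then show ?thesis using v(2)[OF DI[of "{i}" "\<lambda>_. 1"]] by simp
  qed
  note represents = this
  have "\<exists>A c. finite A \<and> us n = comb g A c" for n
    using v(3)[of n] unfolding D_def by force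
  then obtain As cs where "\<And>n. finite (As n)" "\<And>n. us n = comb g (As n) (cs n)" by metis
  then show thesis using v norm represents by (intro that[of v As cs]) simp_all
qed

text \<open>
  For a family with dense span. This form is the one that can be checked without approximation, and
  \<open>total_dense\<close> recovers the approximation.
\<close>

definition total :: "('i \<Rightarrow> 'k) \<Rightarrow> bool" where
  "total g \<longleftrightarrow> (\<forall>i. g i \<in> carrier H) \<and>
    (\<forall>v\<in>carrier H. (\<forall>i. hinner H v (g i) = 0) \<longrightarrow> v = \<zero>)"

lemma total_in: "total g \<Longrightarrow> g i \<in> carrier H"
  by (simp add: total_def)

lemma total_ext:
  assumes "total g" "u \<in> carrier H" "v \<in> carrier H" "\<And>i. hinner H u (g i) = hinner H v (g i)"
  shows "u = v"
proof -
  have "u \<ominus> v = \<zero>"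
    using assms by (auto simp: total_def hinner_diff_left)
  then show ?thesis
    using assms M.minus_equality[of u "\<ominus> v"] by (simp add: a_minus_def)
qed

lemma total_op_ext:
  assumes g: "total g" and S: "S \<in> ops" and T: "T \<in> ops" and eq: "\<And>i. S (g i) = T (g i)"
  shows "S = T"
proof -
  have "op_adj H S = op_adj H T"
  proof (rule op_eqI)
    fix w assume w: "w \<in> carrier H"
    show "op_adj H S w = op_adj H T w"
    proof (rule total_ext[OF g])
      fix i
      show "hinner H (op_adj H S w) (g i) = hinner H (op_adj H T w) (g i)"
        using w S T eq total_in[OF g] by (simp add: hinner_op_adj_left)
    qed (use S T w in auto)
  qed (use S T in auto)
  then show ?thesis using S T by (metis op_adj_adj)
qed

text \<open>
  Restricted to the span, the functional of \<open>v\<close> is represented by some limit of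
  combinations. By totality that limit is \<open>v\<close>.
\<close>

lemma total_dense:
  assumes g: "total g" and v: "v \<in> carrier H"
  obtains As cs where "\<And>n::nat. finite (As n)"
    "(\<lambda>n. hnorm H (comb g (As n) (cs n) \<ominus> v)) \<longlonglongrightarrow> 0"
proof -
  have *: "cmod (\<Sum>i\<in>A. c i * hinner H (g i) v) \<le> hnorm H v * hnorm H (comb g A c)"
    if "finite A" for A c
    using Cauchy_Schwarz[of "comb g A c" v] total_in[OF g] v that
    by (simp add: hinner_comb_left mult.commute)
  obtain v' As cs where v': "v' \<in> carrier H" "\<And>i. hinner H (g i) v' = hinner H (g i) v"
    "\<And>n::nat. finite (As n)" "(\<lambda>n. hnorm H (comb g (As n) (cs n) \<ominus> v')) \<longlonglongrightarrow> 0"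
    by (rule riesz_family[of g "hnorm H v" "\<lambda>i. hinner H (g i) v",
          OF total_in[OF g] hnorm_nonneg[OF v]]) (erule *, (rule that; assumption))
  have "hinner H v' (g i) = hinner H v (g i)" for i
    using v'(1,2) v total_in[OF g] hinner_commute[of v' "g i"] hinner_commute[of v "g i"] by simp
  then have "v' = v"
    using v' v by (intro total_ext[OF g])
  then show thesis using v'(3,4) by (intro that[of As cs]) simp_all
qed

text \<open>
  A column of operators \<open>(T k)\<close> with $\sum_k T_k^* T_k = 1$ is determined by its values on a total
  family, and any values with the right Gram matrix occur: each entry is then a contraction on the
  span of the family. Formal adjoints on the family are adjoints.
\<close>

lemma column_operators:
  fixes h h' :: "'j::finite \<Rightarrow> 'i \<Rightarrow> 'k"
  assumes g: "total g" and h: "\<And>k i. h k i \<in> carrier H" and h': "\<And>k i. h' k i \<in> carrier H"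
    and gram: "\<And>i j. (\<Sum>k\<in>UNIV. hinner H (h k i) (h k j)) = hinner H (g i) (g j)"
    and adj: "\<And>k i j. hinner H (h k i) (g j) = hinner H (g i) (h' k j)"
  obtains T where "\<And>k. T k \<in> ops" "\<And>k i. T k (g i) = h k i" "\<And>k i. op_adj H (T k) (g i) = h' k i"
proof -
  have "\<exists>T\<in>ops. \<forall>i. T (g i) = h k i \<and> op_adj H T (g i) = h' k i" for k
  proof -
    have contr: "hnorm H (comb (h k) A c) \<le> hnorm H (comb g A c)" if A: "finite A" for A c
    proof -
      have "complex_of_real (\<Sum>k\<in>UNIV. (hnorm H (comb (h k) A c))\<^sup>2) = (\<Sum>k\<in>UNIV. hinner H (comb (h k) A c) (comb (h k) A c))"
        using h by (simp add: hinner_self)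
      also have "\<dots> = (\<Sum>k\<in>UNIV. \<Sum>i\<in>A. \<Sum>j\<in>A. c j * cnj (c i) * hinner H (h k j) (h k i))"
        using h A by (simp add: hinner_comb_left hinner_comb_right sum_distrib_left mult_ac)
      also have "\<dots> = (\<Sum>i\<in>A. \<Sum>j\<in>A. \<Sum>k\<in>UNIV. c j * cnj (c i) * hinner H (h k j) (h k i))"
        by (rule sum_rotate)
      also have "\<dots> = (\<Sum>i\<in>A. \<Sum>j\<in>A. c j * cnj (c i) * hinner H (g j) (g i))"
        by (simp add: gram flip: sum_distrib_left)
      also have "\<dots> = hinner H (comb g A c) (comb g A c)"
        using total_in[OF g] A
        by (simp add: hinner_comb_left hinner_comb_right sum_distrib_left mult_ac)
      also have "\<dots> = of_real ((hnorm H (comb g A c))\<^sup>2)"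
        using total_in[OF g] by (simp add: hinner_self)
      finally have "(\<Sum>k\<in>UNIV. (hnorm H (comb (h k) A c))\<^sup>2) = (hnorm H (comb g A c))\<^sup>2"
        unfolding of_real_eq_iff .
      moreover have "(hnorm H (comb (h k) A c))\<^sup>2 \<le> (\<Sum>k\<in>UNIV. (hnorm H (comb (h k) A c))\<^sup>2)"
        using member_le_sum[of k UNIV "\<lambda>k. (hnorm H (comb (h k) A c))\<^sup>2"] by simp
      ultimately have "(hnorm H (comb (h k) A c))\<^sup>2 \<le> (hnorm H (comb g A c))\<^sup>2" by argo
      moreover have "0 \<le> hnorm H (comb g A c)" by (intro hnorm_nonneg comb_in total_in[OF g])
      ultimately show ?thesis by (rule power2_le_imp_le)
    qed
    have ex: "\<exists>v\<in>carrier H. hnorm H v \<le> hnorm H w \<and> (\<forall>i. hinner H (g i) v = hinner H (h k i) w)"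
      if w: "w \<in> carrier H" for w
    proof -
      have bdd: "cmod (\<Sum>i\<in>A. c i * hinner H (h k i) w) \<le> hnorm H w * hnorm H (comb g A c)"
        if A: "finite A" for A c
      proof -
        have "cmod (\<Sum>i\<in>A. c i * hinner H (h k i) w) \<le> hnorm H (comb (h k) A c) * hnorm H w"
          using Cauchy_Schwarz[of "comb (h k) A c" w] h w A by (simp add: hinner_comb_left)
        also have "\<dots> \<le> hnorm H w * hnorm H (comb g A c)"
          using mult_left_mono[OF contr[OF A, of c] hnorm_nonneg[OF w]] by (simp add: mult.commute)
        finally show ?thesis .
      qed
      show ?thesis
      proof (rule riesz_family[of g "hnorm H w" "\<lambda>i. hinner H (h k i) w",
          OF total_in[OF g] hnorm_nonneg[OF w]])
        fix v assume "v \<in> carrier H" "hnorm H v \<le> hnorm H w"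
          "\<And>i. hinner H (g i) v = hinner H (h k i) w"
        then show ?thesis by (intro bexI[of _ v] conjI allI)
      qed (rule bdd)
    qed
    define f where "f w = (SOME v. v \<in> carrier H \<and> hnorm H v \<le> hnorm H w \<and>
      (\<forall>i. hinner H (g i) v = hinner H (h k i) w))" for w
    have f: "f w \<in> carrier H" "hnorm H (f w) \<le> hnorm H w" "\<And>i. hinner H (g i) (f w) = hinner H (h k i) w"
      if "w \<in> carrier H" for w
      using someI_ex[OF ex[OF that, unfolded Bex_def]] unfolding f_def by auto
    have f': "hinner H (f w) (g i) = hinner H w (h k i)" if "w \<in> carrier H" for w i
      using f(1,3)[OF that] that hinner_commute[of "f w" "g i"] hinner_commute[of w "h k i"]
        total_in[OF g] h by simp
    define S where "S = restrict f (carrier H)"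
    have S: "S \<in> ops"
      unfolding S_def
      by (rule restrict_ops[where C = 1])
         (use g h in \<open>auto simp: f f' hinner_linear total_in intro!: total_ext[OF g]\<close>)
    have T1: "op_adj H S (g i) = h k i" for i
    proof (rule hinner_ext)
      fix w assume "w \<in> carrier H"
      then show "hinner H (op_adj H S (g i)) w = hinner H (h k i) w"
        using S total_in[OF g] f by (simp add: hinner_op_adj_left) (simp add: S_def)
    qed (use S h g in \<open>auto simp: total_in\<close>)
    have "S (g i) = h' k i" for i
    proof (rule total_ext[OF g])
      fix j
      have "hinner H (S (g i)) (g j) = hinner H (g i) (h k j)"
        using T1[of j] S total_in[OF g] by (simp flip: T1 add: hinner_op_adj_right)
      also have "\<dots> = hinner H (h' k i) (g j)"
        using adj[of k j i] h h' total_in[OF g] hinner_commute by metis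
      finally show "hinner H (S (g i)) (g j) = hinner H (h' k i) (g j)" .
    qed (use S h' g in \<open>auto simp: total_in\<close>)
    then show ?thesis using S T1 by (intro bexI[of _ "op_adj H S"]) auto
  qed
  then show thesis using that by metis
qed

end

section \<open>Cholesky factorisation of positive kernels\<close>

definition pos_kernel :: "('i \<Rightarrow> 'i \<Rightarrow> complex) \<Rightarrow> bool" where
  "pos_kernel K \<longleftrightarrow>
     (\<forall>A c. finite A \<longrightarrow> (\<Sum>i\<in>A. \<Sum>j\<in>A. c i * cnj (c j) * K i j) \<in> \<real>\<^sub>\<ge>\<^sub>0)"

lemma pos_kernelD:
  "pos_kernel K \<Longrightarrow> finite A \<Longrightarrow> (\<Sum>i\<in>A. \<Sum>j\<in>A. c i * cnj (c j) * K i j) \<in> \<real>\<^sub>\<ge>\<^sub>0"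
  by (auto simp: pos_kernel_def)

lemma pos_kernel_diag: "pos_kernel K \<Longrightarrow> K i i \<in> \<real>\<^sub>\<ge>\<^sub>0"
  using pos_kernelD[of K "{i}" "\<lambda>_. 1"] by simp

lemma pos_kernel_pair:
  assumes "pos_kernel K" "i \<noteq> j"
  shows "K i i + cnj z * K i j + z * K j i + z * cnj z * K j j \<in> \<real>\<^sub>\<ge>\<^sub>0"
  using pos_kernelD[OF assms(1), of "{i, j}" "\<lambda>k. if k = i then 1 else z"] assms(2)
  by (simp add: add_ac)

text \<open>
  The numbers are the values of a form at pairs from two vectors \<open>u\<close>, \<open>v\<close>, and the assumption is
  positivity at \<open>u + z v\<close>.
\<close>

lemma nonneg_hermitian_form:
  fixes a b b' d :: complex
  assumes pos: "\<And>z. a + cnj z * b + z * b' + z * cnj z * d \<in> \<real>\<^sub>\<ge>\<^sub>0"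
    and a: "a \<in> \<real>\<^sub>\<ge>\<^sub>0" and d: "d \<in> \<real>\<^sub>\<ge>\<^sub>0"
  shows "b' = cnj b" and "d = 0 \<Longrightarrow> b = 0"
proof -
  show herm: "b' = cnj b"
    using pos[of 1] pos[of \<i>] a d by (auto simp: complex_nonneg_Reals_iff complex_eq_iff)
  assume d0: "d = 0"
  show "b = 0"
  proof (rule ccontr)
    assume nz: "b \<noteq> 0"
    define N where "N = (cmod b)\<^sup>2"
    have N: "N > 0" using nz by (simp add: N_def)
    \<comment> \<open>a multiple of \<open>b\<close> so large that the term linear in \<open>z\<close> outweighs \<open>a\<close>\<close>
    define t where "t = Re a / N + 1"
    have bb: "b * cnj b = of_real N" by (simp add: N_def complex_norm_square del: of_real_power)
    have "a - of_real (2 * t * N) \<in> \<real>\<^sub>\<ge>\<^sub>0"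
    proof -
      have "a + cnj (- of_real t * b) * b + (- of_real t * b) * cnj b = a - 2 * of_real t * (b * cnj b)"
        by (simp add: algebra_simps)
      also have "\<dots> = a - of_real (2 * t * N)" unfolding bb by simp
      finally show ?thesis using pos[of "- of_real t * b"] by (simp only: herm d0 mult_zero_right add_0_right)
    qed
    then have "2 * t * N \<le> Re a" by (simp add: complex_nonneg_Reals_iff)
    moreover have "t * N = Re a + N" using N by (simp add: t_def field_simps)
    moreover have "0 \<le> Re a" using a by (simp add: complex_nonneg_Reals_iff)
    ultimately show False using N by argo
  qed
qed

lemma pos_kernel_hermitian:
  assumes K: "pos_kernel K"
  shows "K j i = cnj (K i j)"
proof (cases "i = j")
  case True
  then show ?thesis
    using pos_kernel_diag[OF K, of i] by (auto simp: complex_nonneg_Reals_iff complex_eq_iff)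
next
  case False
  show ?thesis
    by (rule nonneg_hermitian_form[OF pos_kernel_pair[OF K False] pos_kernel_diag[OF K] pos_kernel_diag[OF K]])
qed

lemma pos_kernel_null:
  assumes K: "pos_kernel K" and jj: "K j j = 0"
  shows "K i j = 0"
proof (cases "i = j")
  case False
  then show ?thesis
    by (rule nonneg_hermitian_form(2)[OF pos_kernel_pair[OF K] pos_kernel_diag[OF K] pos_kernel_diag[OF K] jj])
qed (use jj in simp)

text \<open>
  The Schur complement of a diagonal entry; when that entry vanishes, so do its row and column, and
  division by zero makes this the kernel itself.
\<close>

definition schur :: "('i \<Rightarrow> 'i \<Rightarrow> complex) \<Rightarrow> 'i \<Rightarrow> 'i \<Rightarrow> 'i \<Rightarrow> complex" where
  "schur K j = (\<lambda>u v. K u v - K u j * K j v / K j j)"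

lemma pos_kernel_schur:
  fixes K :: "'i \<Rightarrow> 'i \<Rightarrow> complex"
  assumes K: "pos_kernel K"
  shows "pos_kernel (schur K j)"
  unfolding pos_kernel_def
proof (intro allI impI)
  fix A :: "'i set" and c
  assume A: "finite A"
  define d where "d = K j j"
  show "(\<Sum>u\<in>A. \<Sum>v\<in>A. c u * cnj (c v) * schur K j u v) \<in> \<real>\<^sub>\<ge>\<^sub>0"
  proof (cases "d = 0")
    case True
    then show ?thesis using pos_kernelD[OF K A, of c] by (simp add: schur_def d_def)
  next
    case d: False
    define B where "B = insert j A"
    \<comment> \<open>changing the coefficient at \<open>j\<close> by \<open>s / d\<close> completes the square\<close>
    define c1 where "c1 u = (if u \<in> A then c u else 0)" for u
    define s where "s = (\<Sum>u\<in>B. c1 u * K u j)"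
    define c2 where "c2 u = c1 u - (if u = j then s / d else 0)" for u
    have B: "finite B" "j \<in> B" "A \<subseteq> B" using A by (auto simp: B_def)
    have cnj_d: "cnj d = d" using pos_kernel_hermitian[OF K, of j j] by (simp add: d_def)
    have s': "(\<Sum>v\<in>B. cnj (c1 v) * K j v) = cnj s"
      unfolding s_def cnj_sum complex_cnj_mult
      by (rule sum.cong) (simp_all flip: pos_kernel_hermitian[OF K])
    have lin: "(\<Sum>u\<in>B. c2 u * F u) = (\<Sum>u\<in>B. c1 u * F u) - s / d * F j" for F
      using B by (simp add: c2_def left_diff_distrib sum_subtractf if_distrib[of "\<lambda>x. x * _"] sum.delta cong: if_cong)
    have lin': "(\<Sum>u\<in>B. cnj (c2 u) * F u) = (\<Sum>u\<in>B. cnj (c1 u) * F u) - cnj s / d * F j" for F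
    proof -
      have "cnj (c2 u) = cnj (c1 u) - (if u = j then cnj s / d else 0)" for u
        using cnj_d by (simp add: c2_def)
      then show ?thesis
        using B by (simp add: left_diff_distrib sum_subtractf if_distrib[of "\<lambda>x. x * _"] sum.delta cong: if_cong)
    qed
    have "(\<Sum>u\<in>B. \<Sum>v\<in>B. c2 u * cnj (c2 v) * K u v)
        = (\<Sum>u\<in>B. c2 u * (\<Sum>v\<in>B. cnj (c2 v) * K u v))"
      by (simp add: sum_distrib_left mult.assoc)
    also have "\<dots> = (\<Sum>u\<in>B. c1 u * (\<Sum>v\<in>B. cnj (c1 v) * K u v)) - cnj s / d * s
        - s / d * (cnj s - cnj s / d * d)"
    proof -
      have "(\<Sum>u\<in>B. c1 u * (Q u - t * K u j)) = (\<Sum>u\<in>B. c1 u * Q u) - t * s" for Q t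
        by (simp add: right_diff_distrib sum_subtractf s_def sum_distrib_left mult_ac)
      then show ?thesis unfolding lin unfolding lin' s' d_def[symmetric] by (simp only:)
    qed
    also have "\<dots> = (\<Sum>u\<in>B. c1 u * (\<Sum>v\<in>B. cnj (c1 v) * K u v)) - s * cnj s / d"
      using d by (simp add: mult_ac)
    also have "\<dots> = (\<Sum>u\<in>B. \<Sum>v\<in>B. c1 u * cnj (c1 v) * schur K j u v)"
    proof -
      have "(\<Sum>u\<in>B. \<Sum>v\<in>B. c1 u * cnj (c1 v) * schur K j u v)
        = (\<Sum>u\<in>B. c1 u * (\<Sum>v\<in>B. cnj (c1 v) * K u v)) - (\<Sum>u\<in>B. c1 u * K u j / d * (\<Sum>v\<in>B. cnj (c1 v) * K j v))"
        by (simp add: schur_def d_def right_diff_distrib sum_subtractf sum_distrib_left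
            sum_divide_distrib mult_ac)
      then show ?thesis unfolding s' by (simp add: s_def flip: sum_distrib_right sum_divide_distrib)
    qed
    also have "\<dots> = (\<Sum>u\<in>A. \<Sum>v\<in>A. c u * cnj (c v) * schur K j u v)"
      using B by (intro sum.mono_neutral_cong_right ballI sum.neutral) (auto simp: c1_def)
    finally show ?thesis using pos_kernelD[OF K B(1), of c2] by simp
  qed
qed

primrec eliminate :: "(nat \<Rightarrow> nat \<Rightarrow> complex) \<Rightarrow> nat \<Rightarrow> nat \<Rightarrow> nat \<Rightarrow> complex" where
  "eliminate K 0 = K"
| "eliminate K (Suc n) = schur (eliminate K n) n"

lemma pos_kernel_eliminate: "pos_kernel K \<Longrightarrow> pos_kernel (eliminate K n)"
  by (induction n) (auto intro: pos_kernel_schur)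

lemma eliminate_eq_0: "pos_kernel K \<Longrightarrow> i < n \<Longrightarrow> eliminate K n i j = 0"
proof (induction n arbitrary: j)
  case (Suc n)
  show ?case
  proof (cases "i = n")
    case True
    have "eliminate K n n j = 0" if "eliminate K n n n = 0"
    proof -
      have "eliminate K n n j = cnj (eliminate K n j n)"
        by (rule pos_kernel_hermitian[OF pos_kernel_eliminate[OF Suc.prems(1)]])
      then show ?thesis
        using pos_kernel_null[OF pos_kernel_eliminate[OF Suc.prems(1)] that] by simp
    qed
    then show ?thesis using True by (auto simp: schur_def)
  next
    case False
    then show ?thesis using Suc by (simp add: schur_def)
  qed
qed simp

text \<open>
  Eliminating the indices one after the other leaves a lower triangular factor. A pivot vanishes only
  with its whole column.
\<close>

lemma Cholesky:
  fixes K :: "nat \<Rightarrow> nat \<Rightarrow> complex"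
  assumes K: "pos_kernel K"
  obtains G where "\<And>u n. u < n \<Longrightarrow> G u n = 0"
    "\<And>u v N. u < N \<Longrightarrow> K u v = (\<Sum>n<N. G u n * cnj (G v n))"
    "\<And>n v. G n n = 0 \<Longrightarrow> G v n = 0"
proof -
  define G where "G u n = eliminate K n u n / of_real (sqrt (Re (eliminate K n n n)))" for u n
  note pos = pos_kernel_eliminate[OF K]
  have Re0: "0 \<le> Re (eliminate K n n n)" and real: "eliminate K n n n = of_real (Re (eliminate K n n n))" for n
    using pos_kernel_diag[OF pos, of n n] by (auto simp: complex_nonneg_Reals_iff complex_eq_iff)
  have step: "eliminate K n u v = G u n * cnj (G v n) + eliminate K (Suc n) u v" for n u v
  proof -
    have "G u n * cnj (G v n) = eliminate K n u n * eliminate K n n v / eliminate K n n n"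
    proof -
      have "complex_of_real (sqrt (Re (eliminate K n n n))) * of_real (sqrt (Re (eliminate K n n n)))
          = eliminate K n n n"
        using Re0[of n] real[of n] by (simp flip: of_real_mult)
      then show ?thesis
        by (simp add: G_def pos_kernel_hermitian[OF pos, of n v n])
    qed
    then show ?thesis by (simp add: schur_def)
  qed
  have split: "K u v = (\<Sum>n<N. G u n * cnj (G v n)) + eliminate K N u v" for u v N
  proof (induction N)
    case (Suc N)
    then show ?case using step[of N u v] by simp
  qed simp
  then have "K u v = (\<Sum>n<N. G u n * cnj (G v n))" if "u < N" for u v N
    using split[of u v N] eliminate_eq_0[OF K that] by simp
  moreover have "G u n = 0" if "u < n" for u n
    using eliminate_eq_0[OF K that] by (simp add: G_def)
  moreover have "G v n = 0" if "G n n = 0" for n v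
  proof -
    have "Re (eliminate K n n n) = 0"
      using that real[of n] by (auto simp: G_def)
    then show ?thesis by (simp add: G_def)
  qed
  ultimately show thesis by (intro that[of G])
qed

section \<open>Square-summable sequences\<close>

definition l2 :: "nat set \<Rightarrow> (nat \<Rightarrow> complex) set" where
  "l2 S = {f. (\<forall>n. n \<notin> S \<longrightarrow> f n = 0) \<and> summable (\<lambda>n. (cmod (f n))\<^sup>2)}"

definition l2_inner :: "(nat \<Rightarrow> complex) \<Rightarrow> (nat \<Rightarrow> complex) \<Rightarrow> complex" where
  "l2_inner f h = (\<Sum>n. f n * cnj (h n))"

lemma l2_summable:
  assumes "f \<in> l2 S" "h \<in> l2 S"
  shows "summable (\<lambda>n. f n * cnj (h n))"
proof (rule summable_comparison_test)
  have "norm (f n * cnj (h n)) \<le> (cmod (f n))\<^sup>2 + (cmod (h n))\<^sup>2" for n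
    unfolding norm_mult complex_mod_cnj
    using sum_squares_bound[of "cmod (f n)" "cmod (h n)"]
      mult_nonneg_nonneg[OF norm_ge_zero[of "f n"] norm_ge_zero[of "h n"]]
    by linarith
  then show "\<exists>N. \<forall>n\<ge>N. norm (f n * cnj (h n)) \<le> (cmod (f n))\<^sup>2 + (cmod (h n))\<^sup>2" by blast
  show "summable (\<lambda>n. (cmod (f n))\<^sup>2 + (cmod (h n))\<^sup>2)"
    using assms by (auto simp: l2_def intro: summable_add)
qed

lemma l2_zero [simp]: "(\<lambda>_. 0) \<in> l2 S"
  by (simp add: l2_def)

lemma l2_smult [simp]: "f \<in> l2 S \<Longrightarrow> (\<lambda>n. c * f n) \<in> l2 S"
  by (auto simp: l2_def norm_mult power_mult_distrib intro: summable_mult)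

lemma l2_add [simp]:
  assumes "f \<in> l2 S" "h \<in> l2 S" shows "(\<lambda>n. f n + h n) \<in> l2 S"
proof -
  have "summable (\<lambda>n. (cmod (f n + h n))\<^sup>2)"
  proof (rule summable_comparison_test)
    have "(cmod (f n + h n))\<^sup>2 \<le> 2 * ((cmod (f n))\<^sup>2 + (cmod (h n))\<^sup>2)" for n
    proof -
      have "(cmod (f n + h n))\<^sup>2 \<le> (cmod (f n) + cmod (h n))\<^sup>2"
        by (simp add: norm_triangle_ineq power_mono)
      also have "\<dots> \<le> 2 * ((cmod (f n))\<^sup>2 + (cmod (h n))\<^sup>2)"
        using sum_squares_bound[of "cmod (f n)" "cmod (h n)"] by (simp add: power2_sum)
      finally show ?thesis .
    qed
    then show "\<exists>N. \<forall>n\<ge>N. norm ((cmod (f n + h n))\<^sup>2) \<le> 2 * ((cmod (f n))\<^sup>2 + (cmod (h n))\<^sup>2)"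
      by simp
    show "summable (\<lambda>n. 2 * ((cmod (f n))\<^sup>2 + (cmod (h n))\<^sup>2))"
      using assms by (auto simp: l2_def intro!: summable_add summable_mult)
  qed
  then show ?thesis using assms by (auto simp: l2_def)
qed

lemma l2_diff [simp]:
  assumes "f \<in> l2 S" "h \<in> l2 S" shows "(\<lambda>n. f n - h n) \<in> l2 S"
  using l2_add[OF assms(1) l2_smult[OF assms(2), of "-1"]] by simp

lemma l2_inner_self:
  assumes "f \<in> l2 S"
  shows "l2_inner f f = of_real (\<Sum>n. (cmod (f n))\<^sup>2)"
proof -
  have "f n * cnj (f n) = of_real ((cmod (f n))\<^sup>2)" for n
    by (simp add: complex_norm_square del: of_real_power)
  then show ?thesis
    using assms by (simp add: l2_inner_def l2_def suminf_of_real del: of_real_power)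
qed

lemma l2_inner_commute: "f \<in> l2 S \<Longrightarrow> h \<in> l2 S \<Longrightarrow> l2_inner f h = cnj (l2_inner h f)"
  using bounded_linear.suminf[OF bounded_linear_cnj l2_summable[of h S f]]
  by (simp add: l2_inner_def mult.commute)

text \<open>
  The limit is taken entrywise, and the bounds on finite partial sums survive in the limit.
\<close>

lemma l2_complete:
  assumes s: "\<And>k. s k \<in> l2 S"
    and Cauchy: "\<And>e. e > 0 \<Longrightarrow> \<exists>M. \<forall>m\<ge>M. \<forall>k\<ge>M. (\<Sum>n. (cmod (s m n - s k n))\<^sup>2) < e"
  obtains f where "f \<in> l2 S" "(\<lambda>k. \<Sum>n. (cmod (s k n - f n))\<^sup>2) \<longlonglongrightarrow> 0"
proof -
  have part: "(\<Sum>n<N. (cmod (s m n - s k n))\<^sup>2) \<le> (\<Sum>n. (cmod (s m n - s k n))\<^sup>2)" for m k N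
    using l2_diff[OF s[of m] s[of k]] by (intro sum_le_suminf) (auto simp: l2_def)
  have "convergent (\<lambda>k. s k n)" for n
  proof (rule Cauchy_convergent, rule CauchyI)
    fix e :: real assume e: "e > 0"
    then obtain M where M: "\<forall>m\<ge>M. \<forall>k\<ge>M. (\<Sum>n. (cmod (s m n - s k n))\<^sup>2) < e\<^sup>2"
      using Cauchy[of "e\<^sup>2"] by auto
    have "cmod (s m n - s k n) < e" if "m \<ge> M" "k \<ge> M" for m k
    proof -
      have "(cmod (s m n - s k n))\<^sup>2 \<le> (\<Sum>n<Suc n. (cmod (s m n - s k n))\<^sup>2)"
        by (simp add: sum_nonneg)
      then have "(cmod (s m n - s k n))\<^sup>2 < e\<^sup>2"
        using part[where m = m and k = k and N = "Suc n"] M that by fastforce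
      then show ?thesis using e by (simp add: power2_less_imp_less)
    qed
    then show "\<exists>M. \<forall>m\<ge>M. \<forall>k\<ge>M. norm (s m n - s k n) < e" by blast
  qed
  then obtain f where f: "\<And>n. (\<lambda>k. s k n) \<longlonglongrightarrow> f n"
    unfolding convergent_def by metis
  have bound: "summable (\<lambda>n. (cmod (s m n - f n))\<^sup>2) \<and> (\<Sum>n. (cmod (s m n - f n))\<^sup>2) \<le> e"
    if M: "\<forall>m\<ge>M. \<forall>k\<ge>M. (\<Sum>n. (cmod (s m n - s k n))\<^sup>2) < e" and m: "m \<ge> M" for m M e
  proof -
    have le: "(\<Sum>n<N. (cmod (s m n - f n))\<^sup>2) \<le> e" for N
    proof (rule LIMSEQ_le_const2)
      show "(\<lambda>k. \<Sum>n<N. (cmod (s m n - s k n))\<^sup>2) \<longlonglongrightarrow> (\<Sum>n<N. (cmod (s m n - f n))\<^sup>2)"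
        by (intro tendsto_intros f)
      show "\<exists>K. \<forall>k\<ge>K. (\<Sum>n<N. (cmod (s m n - s k n))\<^sup>2) \<le> e"
      proof (intro exI[of _ M] allI impI)
        fix k assume "k \<ge> M"
        then show "(\<Sum>n<N. (cmod (s m n - s k n))\<^sup>2) \<le> e"
          using part[where m = m and k = k and N = N] M m by force
      qed
    qed
    have "summable (\<lambda>n. (cmod (s m n - f n))\<^sup>2)"
      by (rule summableI_nonneg_bounded[where x = e]) (use le in auto)
    then show ?thesis using le by (auto intro: suminf_le_const)
  qed
  obtain M1 where M1: "\<forall>m\<ge>M1. \<forall>k\<ge>M1. (\<Sum>n. (cmod (s m n - s k n))\<^sup>2) < 1"
    using Cauchy[of 1] by auto
  have zero: "f n = 0" if "n \<notin> S" for n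
  proof -
    have "(\<lambda>k. s k n) = (\<lambda>k. 0)" using s that by (auto simp: l2_def)
    then show ?thesis using f[of n] LIMSEQ_unique[of "\<lambda>k. 0" "f n" 0] by simp
  qed
  have "(\<lambda>n. s M1 n - f n) \<in> l2 S"
    using bound[OF M1, of M1] s[of M1] zero by (auto simp: l2_def)
  from l2_diff[OF s[of M1] this] have fS: "f \<in> l2 S" by simp
  have "(\<lambda>k. \<Sum>n. (cmod (s k n - f n))\<^sup>2) \<longlonglongrightarrow> 0"
  proof (rule LIMSEQ_I)
    fix e :: real assume e: "e > 0"
    then obtain M where M: "\<forall>m\<ge>M. \<forall>k\<ge>M. (\<Sum>n. (cmod (s m n - s k n))\<^sup>2) < e / 2"
      using Cauchy[of "e / 2"] by auto
    have "norm ((\<Sum>n. (cmod (s k n - f n))\<^sup>2) - 0) < e" if "k \<ge> M" for k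
    proof -
      have "0 \<le> (\<Sum>n. (cmod (s k n - f n))\<^sup>2)"
        using bound[OF M that] by (intro suminf_nonneg) auto
      then show ?thesis using bound[OF M that] e by auto
    qed
    then show "\<exists>M. \<forall>k\<ge>M. norm ((\<Sum>n. (cmod (s k n - f n))\<^sup>2) - 0) < e" by blast
  qed
  then show thesis using that fS by blast
qed

text \<open>Square-summable sequences form a Hilbert space on any type that contains their copies.\<close>

definition l2_hilbert :: "((nat \<Rightarrow> complex) \<Rightarrow> 'k) \<Rightarrow> nat set \<Rightarrow> 'k hilbert" where
  "l2_hilbert \<iota> S = \<lparr>carrier = \<iota> ` l2 S, mult = undefined, one = undefined,
     zero = \<iota> (\<lambda>_. 0), add = (\<lambda>x y. \<iota> (\<lambda>n. the_inv \<iota> x n + the_inv \<iota> y n)),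
     smult = (\<lambda>c x. \<iota> (\<lambda>n. c * the_inv \<iota> x n)),
     hinner = (\<lambda>x y. l2_inner (the_inv \<iota> x) (the_inv \<iota> y))\<rparr>"

lemma cring_complex_ring: "cring complex_ring"
proof (rule cringI)
  show "abelian_group complex_ring"
    by (rule abelian_groupI) (auto simp: complex_ring_def intro: exI[of _ "- _"])
  show "comm_monoid complex_ring"
    by (rule comm_monoidI) (auto simp: complex_ring_def)
qed (auto simp: complex_ring_def distrib_right)

lemma hilbert_space_l2:
  fixes \<iota> :: "(nat \<Rightarrow> complex) \<Rightarrow> 'k"
  assumes inj: "inj \<iota>"
  shows "hilbert_space (l2_hilbert \<iota> S)" (is "hilbert_space ?H")
proof -
  have inv [simp]: "the_inv \<iota> (\<iota> f) = f" for f using inj by (rule the_inv_f_f)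
  have ag: "abelian_group ?H"
  proof (rule abelian_groupI)
    fix x assume "x \<in> carrier ?H"
    then obtain f where f: "x = \<iota> f" "f \<in> l2 S" by (auto simp: l2_hilbert_def)
    then show "\<exists>y\<in>carrier ?H. y \<oplus>\<^bsub>?H\<^esub> x = \<zero>\<^bsub>?H\<^esub>"
      using l2_smult[of f S "-1"] by (auto simp: l2_hilbert_def intro!: bexI[of _ "\<lambda>n. - f n"])
  qed (auto simp: l2_hilbert_def add_ac)
  have md: "module complex_ring ?H"
    by (rule moduleI[OF cring_complex_ring ag]) (auto simp: l2_hilbert_def complex_ring_def algebra_simps)
  interpret M: module complex_ring ?H by (rule md)
  have minus: "\<iota> f \<ominus>\<^bsub>?H\<^esub> \<iota> h = \<iota> (\<lambda>n. f n - h n)" if fh: "f \<in> l2 S" "h \<in> l2 S" for f h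
  proof -
    have "\<ominus>\<^bsub>?H\<^esub> \<iota> h = \<iota> (\<lambda>n. - h n)"
      using fh l2_smult[of h S "-1"] by (intro M.minus_equality) (auto simp: l2_hilbert_def)
    then show ?thesis by (simp add: a_minus_def) (simp add: l2_hilbert_def)
  qed
  have norm: "hnorm ?H (\<iota> f) = sqrt (\<Sum>n. (cmod (f n))\<^sup>2)" if "f \<in> l2 S" for f
    using l2_inner_self[OF that] by (simp add: hnorm_def l2_hilbert_def)
  have sum0: "0 \<le> (\<Sum>n. (cmod (f n))\<^sup>2)" if "f \<in> l2 S" for f
    using that by (auto simp: l2_def intro: suminf_nonneg)
  have "hilbert_space_axioms ?H"
  proof
    fix v assume "v \<in> carrier ?H"
    then obtain f where f: "v = \<iota> f" "f \<in> l2 S" by (auto simp: l2_hilbert_def)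
    show "hinner ?H v v \<in> \<real>\<^sub>\<ge>\<^sub>0"
      using l2_inner_self[OF f(2)] sum0[OF f(2)] f(1) by (simp add: l2_hilbert_def)
    assume "hinner ?H v v = 0"
    then have "(\<Sum>n. (cmod (f n))\<^sup>2) = 0"
      using l2_inner_self[OF f(2)] f(1) by (simp add: l2_hilbert_def)
    then have "f n = 0" for n
      using f(2) by (subst (asm) suminf_eq_zero_iff) (auto simp: l2_def)
    then have "f = (\<lambda>_. 0)" by blast
    then show "v = \<zero>\<^bsub>?H\<^esub>" using f(1) by (simp add: l2_hilbert_def)
  next
    fix s :: "nat \<Rightarrow> 'k"
    assume s: "\<And>n. s n \<in> carrier ?H"
      and C: "\<And>e. e > 0 \<Longrightarrow> \<exists>M. \<forall>m\<ge>M. \<forall>n\<ge>M. hnorm ?H (s m \<ominus>\<^bsub>?H\<^esub> s n) < e"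
    have "\<forall>n. \<exists>f. s n = \<iota> f \<and> f \<in> l2 S" using s by (auto simp: l2_hilbert_def)
    then obtain t where t: "\<And>n. s n = \<iota> (t n)" "\<And>n. t n \<in> l2 S" by metis
    have dist: "hnorm ?H (s m \<ominus>\<^bsub>?H\<^esub> s n) = sqrt (\<Sum>i. (cmod (t m i - t n i))\<^sup>2)" for m n
      using t minus norm by simp
    obtain f where f: "f \<in> l2 S" "(\<lambda>k. \<Sum>n. (cmod (t k n - f n))\<^sup>2) \<longlonglongrightarrow> 0"
    proof (rule l2_complete[of t S])
      fix e :: real assume "e > 0"
      then obtain M where "\<forall>m\<ge>M. \<forall>n\<ge>M. sqrt (\<Sum>i. (cmod (t m i - t n i))\<^sup>2) < sqrt e"
        using C[of "sqrt e"] by (auto simp: dist)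
      then show "\<exists>M. \<forall>m\<ge>M. \<forall>n\<ge>M. (\<Sum>i. (cmod (t m i - t n i))\<^sup>2) < e" by auto
    qed (use t in auto)
    have "(\<lambda>n. hnorm ?H (s n \<ominus>\<^bsub>?H\<^esub> \<iota> f)) \<longlonglongrightarrow> 0"
      using tendsto_real_sqrt[OF f(2)] t minus norm f(1) by simp
    then show "\<exists>v\<in>carrier ?H. (\<lambda>n. hnorm ?H (s n \<ominus>\<^bsub>?H\<^esub> v)) \<longlonglongrightarrow> 0"
      using f(1) by (intro bexI[of _ "\<iota> f"]) (auto simp: l2_hilbert_def)
  next
    fix u v w assume "u \<in> carrier ?H" "v \<in> carrier ?H" "w \<in> carrier ?H"
    then show "hinner ?H (u \<oplus>\<^bsub>?H\<^esub> v) w = hinner ?H u w + hinner ?H v w"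
      by (auto simp: l2_hilbert_def l2_inner_def distrib_right l2_summable intro!: suminf_add[symmetric])
  next
    fix c v w assume "v \<in> carrier ?H" "w \<in> carrier ?H"
    then show "hinner ?H (c \<odot>\<^bsub>?H\<^esub> v) w = c * hinner ?H v w"
      by (auto simp: l2_hilbert_def l2_inner_def mult.assoc l2_summable intro!: suminf_mult)
  next
    fix v w assume "v \<in> carrier ?H" "w \<in> carrier ?H"
    then show "hinner ?H v w = cnj (hinner ?H w v)"
      by (auto simp: l2_hilbert_def intro: l2_inner_commute)
  qed
  then show ?thesis using md by (intro hilbert_space.intro)
qed

text \<open>
  Real numbers can be coded by sets of natural numbers. A sequence is coded by the disjoint union of
  the sets that code the real and imaginary parts of its entries.
\<close>

lemma complex_sequences_lepoll:
  assumes "(UNIV :: real set) \<lesssim> (UNIV :: 'k set)"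
  obtains \<iota> :: "(nat \<Rightarrow> complex) \<Rightarrow> 'k" where "inj \<iota>"
proof -
  obtain e :: "real \<Rightarrow> nat set" where e: "inj e"
    using nat_sets_eqpoll_reals eqpoll_sym eqpoll_imp_lepoll unfolding lepoll_def by blast
  obtain e' :: "nat set \<Rightarrow> 'k" where e': "inj e'"
    using lepoll_trans1[OF nat_sets_eqpoll_reals assms] unfolding lepoll_def by blast
  define code where "code f = to_nat ` {(n :: nat, b, k). k \<in> e (if b then Re (f n) else Im (f n))}"
    for f :: "nat \<Rightarrow> complex"
  have "inj code"
  proof (rule injI, rule ext)
    fix f h n assume "code f = code h"
    then have eq: "{(n :: nat, b, k). k \<in> e (if b then Re (f n) else Im (f n))}
        = {(n, b, k). k \<in> e (if b then Re (h n) else Im (h n))}"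
      unfolding code_def by (simp add: inj_image_eq_iff)
    have "e (if b then Re (f n) else Im (f n)) = e (if b then Re (h n) else Im (h n))" for b
      using eq by (auto simp: set_eq_iff)
    from this[of True] this[of False] show "f n = h n"
      using e by (auto simp: inj_eq complex_eq_iff)
  qed
  then have "inj (e' \<circ> code)" using e' by (intro inj_compose)
  then show thesis using that by blast
qed

section \<open>The Hilbert space of a positive kernel\<close>

text \<open>
  The elimination runs through the indices in order, so the kernel is moved to the
  natural numbers. It is zero at numbers that are not codes.
\<close>

definition kernel_on_nat :: "('i::countable \<Rightarrow> 'i \<Rightarrow> complex) \<Rightarrow> nat \<Rightarrow> nat \<Rightarrow> complex" where
  "kernel_on_nat K m n = (if m \<in> range (to_nat :: 'i \<Rightarrow> nat) \<and> n \<in> range (to_nat :: 'i \<Rightarrow> nat)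
     then K (from_nat m) (from_nat n) else 0)"

lemma kernel_on_nat_to_nat [simp]: "kernel_on_nat K (to_nat i) (to_nat j) = K i j"
  by (simp add: kernel_on_nat_def)

lemma pos_kernel_on_nat:
  fixes K :: "'i::countable \<Rightarrow> 'i \<Rightarrow> complex"
  assumes K: "pos_kernel K"
  shows "pos_kernel (kernel_on_nat K)"
  unfolding pos_kernel_def
proof (intro allI impI)
  fix A :: "nat set" and c assume A: "finite A"
  define B where "B = (to_nat :: 'i \<Rightarrow> nat) -` A"
  have B: "finite B" unfolding B_def using A by (intro finite_vimageI) auto
  have AR: "A \<inter> range (to_nat :: 'i \<Rightarrow> nat) = to_nat ` B" by (auto simp: B_def)
  have "(\<Sum>i\<in>A. \<Sum>j\<in>A. c i * cnj (c j) * kernel_on_nat K i j) = (\<Sum>i\<in>A \<inter> range (to_nat :: 'i \<Rightarrow> nat). \<Sum>j\<in>A \<inter> range (to_nat :: 'i \<Rightarrow> nat). c i * cnj (c j) * kernel_on_nat K i j)"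
    using A by (intro sum.mono_neutral_cong_right ballI sum.neutral) (auto simp: kernel_on_nat_def)
  also have "\<dots> = (\<Sum>i\<in>B. \<Sum>j\<in>B. c (to_nat i) * cnj (c (to_nat j)) * K i j)"
    unfolding AR by (simp add: sum.reindex kernel_on_nat_def)
  finally show "(\<Sum>i\<in>A. \<Sum>j\<in>A. c i * cnj (c j) * kernel_on_nat K i j) \<in> \<real>\<^sub>\<ge>\<^sub>0"
    using pos_kernelD[OF K B, of "\<lambda>i. c (to_nat i)"] by simp
qed

text \<open>
  The rows of the Cholesky factor have the kernel as their Gram matrix. As the factor is triangular, the
  rows span all entries with a nonzero pivot, and all other entries vanish in every row.
\<close>

lemma Kolmogorov:
  fixes K :: "'i::countable \<Rightarrow> 'i \<Rightarrow> complex"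
  assumes K: "pos_kernel K" and big: "(UNIV :: real set) \<lesssim> (UNIV :: 'k set)"
  obtains H :: "'k hilbert" and g where
    "hilbert_space H" "hilbert_space.total H g" "\<And>i j. hinner H (g i) (g j) = K i j"
proof -
  define R where "R = range (to_nat :: 'i \<Rightarrow> nat)"
  obtain G where G: "\<And>u n. u < n \<Longrightarrow> G u n = 0"
    "\<And>u v N. u < N \<Longrightarrow> kernel_on_nat K u v = (\<Sum>n<N. G u n * cnj (G v n))"
    "\<And>n v. G n n = 0 \<Longrightarrow> G v n = 0"
    by (rule Cholesky[OF pos_kernel_on_nat[OF K]]) (rule that; assumption)
  define S where "S = {n. G n n \<noteq> 0}"
  have SR: "n \<in> R" if "n \<in> S" for n
  proof (rule ccontr)
    assume "n \<notin> R"
    then have "(\<Sum>k<Suc n. G n k * cnj (G n k)) = 0" using G(2)[of n "Suc n" n] by (simp add: kernel_on_nat_def R_def)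
    moreover have "(\<Sum>k<Suc n. G n k * cnj (G n k)) = of_real (\<Sum>k<Suc n. (cmod (G n k))\<^sup>2)"
      by (simp add: complex_norm_square del: of_real_power)
    ultimately have "(\<Sum>k<Suc n. (cmod (G n k))\<^sup>2) = 0" by (metis of_real_eq_0_iff)
    then have "G n n = 0" by (subst (asm) sum_nonneg_eq_0_iff) auto
    then show False using that by (simp add: S_def)
  qed
  obtain \<iota> :: "(nat \<Rightarrow> complex) \<Rightarrow> 'k" where \<iota>: "inj \<iota>"
    using complex_sequences_lepoll[OF big] .
  define H where "H = l2_hilbert \<iota> S"
  interpret H: hilbert_space H unfolding H_def by (rule hilbert_space_l2[OF \<iota>])
  have GS: "G u \<in> l2 S" for u
  proof -
    have "summable (\<lambda>n. (cmod (G u n))\<^sup>2)"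
      by (rule summable_finite[of "{..u}"]) (use G(1) in auto)
    then show ?thesis using G(3) by (auto simp: l2_def S_def)
  qed
  define g where "g i = \<iota> (G (to_nat i))" for i :: 'i
  have inner: "hinner H (\<iota> f) (g i) = (\<Sum>n<Suc (to_nat i). f n * cnj (G (to_nat i) n))" for f i
  proof -
    have "hinner H (\<iota> f) (g i) = (\<Sum>n. f n * cnj (G (to_nat i) n))"
      using the_inv_f_f[OF \<iota>] by (simp add: H_def l2_hilbert_def l2_inner_def g_def)
    also have "\<dots> = (\<Sum>n<Suc (to_nat i). f n * cnj (G (to_nat i) n))"
      by (rule suminf_finite) (use G(1) in \<open>auto simp: not_less_eq\<close>)
    finally show ?thesis .
  qed
  have "hinner H (g i) (g j) = K i j" for i j
  proof -
    have "hinner H (g i) (g j) = kernel_on_nat K (to_nat i) (to_nat j)"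
    proof -
      have "kernel_on_nat K (to_nat i) (to_nat j) = (\<Sum>n<Suc (to_nat i + to_nat j). G (to_nat i) n * cnj (G (to_nat j) n))"
        by (rule G(2)) simp
      also have "\<dots> = (\<Sum>n<Suc (to_nat j). G (to_nat i) n * cnj (G (to_nat j) n))"
        by (rule sum.mono_neutral_right) (use G(1) in auto)
      finally show ?thesis using inner[of "G (to_nat i)" j] by (simp add: g_def[symmetric])
    qed
    then show ?thesis by simp
  qed
  moreover have "H.total g"
    unfolding H.total_def
  proof (intro conjI allI ballI impI)
    show "g i \<in> carrier H" for i using GS by (simp add: g_def H_def l2_hilbert_def)
  next
    fix v assume v: "v \<in> carrier H" and orth: "\<forall>i. hinner H v (g i) = 0"
    obtain f where f: "v = \<iota> f" "f \<in> l2 S" using v by (auto simp: H_def l2_hilbert_def)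
    have "f n = 0" for n
    proof (induction n rule: less_induct)
      case (less n)
      show ?case
      proof (cases "n \<in> S")
        case True
        then obtain i :: 'i where i: "n = to_nat i" using SR by (auto simp: R_def)
        have "(\<Sum>k<Suc n. f k * cnj (G n k)) = 0" using orth inner[of f i] f(1) i by simp
        then have "f n * cnj (G n n) = 0" using less by simp
        then show ?thesis using True by (simp add: S_def)
      qed (use f in \<open>auto simp: l2_def\<close>)
    qed
    then have "f = (\<lambda>_. 0)" by blast
    then show "v = \<zero>\<^bsub>H\<^esub>" using f(1) by (simp add: H_def l2_hilbert_def)
  qed
  ultimately show thesis using that H.hilbert_space_axioms by blast
qed

section \<open>Orthogonal projections\<close>

lemma cinner_add_left: "cinner (u + v) w = cinner u w + cinner v w"
  by (simp add: cinner_def distrib_right sum.distrib)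

lemma cinner_diff_left: "cinner (u - v) w = cinner u w - cinner v w"
  by (simp add: cinner_def left_diff_distrib sum_subtractf)

lemma cinner_diff_right: "cinner w (u - v) = cinner w u - cinner w v"
  by (simp add: cinner_def right_diff_distrib sum_subtractf)

lemma cinner_scale_left: "cinner (c *s u) w = c * cinner u w"
  by (simp add: cinner_def sum_distrib_left mult.assoc)

lemma cinner_scale_right: "cinner w (c *s u) = cnj c * cinner w u"
  by (simp add: cinner_def sum_distrib_left mult_ac)

lemma cinner_sum_left: "cinner (\<Sum>i\<in>A. f i) w = (\<Sum>i\<in>A. cinner (f i) w)"
  by (induction A rule: infinite_finite_induct) (auto simp: cinner_add_left, simp_all add: cinner_def)

lemma cinner_commute: "cinner u v = cnj (cinner v u)"
  by (simp add: cinner_def mult.commute)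

lemma cinner_self_eq_0: "cinner u u = 0 \<Longrightarrow> u = 0"
proof -
  assume "cinner u u = 0"
  then have "complex_of_real (\<Sum>i\<in>UNIV. (cmod (u $ i))\<^sup>2) = 0"
    by (simp add: cinner_def complex_norm_square del: of_real_power)
  then have "(\<Sum>i\<in>UNIV. (cmod (u $ i))\<^sup>2) = 0" by (simp only: of_real_eq_0_iff)
  then show "u = 0" by (subst (asm) sum_nonneg_eq_0_iff) (auto simp: vec_eq_iff)
qed

lemma Re_cinner: "Re (cinner u v) = u \<bullet> v"
  by (simp add: cinner_def inner_vec_def inner_complex_def)

lemma cinner_axis_right: "cinner u (axis i 1) = u $ i"
  by (simp add: cinner_def axis_def if_distrib[of cnj] if_distrib[of "\<lambda>x. _ * x"] cong: if_cong)

lemma cinner_axis_left: "cinner (axis i 1) u = cnj (u $ i)"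
  by (subst cinner_commute) (simp add: cinner_axis_right)

lemma mult_axis: "(A *v axis j 1) $ i = (A $ i $ j :: complex)"
  by (simp add: matrix_vector_mult_def axis_def if_distrib[of "\<lambda>x. _ * x"] cong: if_cong)

text \<open>
  The real orthogonal decomposition along a complex subspace is the complex one, since the subspace
  is invariant under multiplication by the imaginary unit.
\<close>

lemma complex_projection_exists:
  fixes \<U> :: "(complex^'n) set"
  assumes \<U>: "vec.subspace \<U>"
  obtains P :: "complex^'n^'n" where
    "\<And>x. P *v x \<in> \<U>" "\<And>x w. w \<in> \<U> \<Longrightarrow> cinner (x - P *v x) w = 0"
proof -
  have scale: "r *\<^sub>R v = complex_of_real r *s v" for r and v :: "complex^'n"
    unfolding vec_eq_iff vector_scaleR_component by (simp add: scaleR_conv_of_real)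
  have "subspace \<U>"
    using \<U> unfolding subspace_def scale
    by (auto intro: vec.subspace_0 vec.subspace_add vec.subspace_scale)
  then have span: "span \<U> = \<U>" by (rule span_eq_iff[THEN iffD2])
  have "\<exists>y. y \<in> \<U> \<and> (\<forall>w\<in>\<U>. cinner (x - y) w = 0)" for x
  proof -
    obtain y z where yz: "y \<in> span \<U>" "\<And>w. w \<in> span \<U> \<Longrightarrow> orthogonal z w" "x = y + z"
      using orthogonal_subspace_decomp_exists[of \<U> x] by blast
    have "cinner z w = 0" if w: "w \<in> \<U>" for w
    proof -
      have "\<i> *s w \<in> \<U>" using w \<U> by (simp add: vec.subspace_scale)
      then have "Re (cinner z w) = 0" "Re (cinner z (\<i> *s w)) = 0"
        using yz(2) w span by (auto simp: Re_cinner orthogonal_def)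
      then show ?thesis by (simp add: cinner_scale_right complex_eq_iff)
    qed
    then show ?thesis using yz span by auto
  qed
  then obtain y where y: "\<And>x. y x \<in> \<U>" "\<And>x w. w \<in> \<U> \<Longrightarrow> cinner (x - y x) w = 0" by metis
  define P :: "complex^'n^'n" where "P = (\<chi> i j. y (axis j 1) $ i)"
  have Pv: "P *v x = (\<Sum>j\<in>UNIV. x $ j *s y (axis j 1))" for x
    by (simp add: P_def matrix_vector_mult_def vec_eq_iff mult.commute)
  have x: "x = (\<Sum>j\<in>UNIV. x $ j *s axis j 1)" for x :: "complex^'n"
    by (simp add: basis_expansion)
  have "P *v x \<in> \<U>" for x
    unfolding Pv using \<U> y(1) by (intro vec.subspace_sum vec.subspace_scale)
  moreover have "cinner (x - P *v x) w = 0" if w: "w \<in> \<U>" for x w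
  proof -
    have "x - P *v x = (\<Sum>j\<in>UNIV. x $ j *s (axis j 1 - y (axis j 1)))"
      by (subst x) (simp add: Pv sum_subtractf vec.scale_right_diff_distrib)
    then show ?thesis
      by (simp only: cinner_sum_left cinner_scale_left y(2)[OF w] mult_zero_right sum.neutral_const)
  qed
  ultimately show thesis using that by blast
qed

lemma cinner_hermitian:
  assumes "ctranspose P = P"
  shows "cinner (P *v x) y = cinner x (P *v y)"
proof -
  have P: "cnj (P $ i $ j) = P $ j $ i" for i j
    using assms by (auto simp: ctranspose_def map_matrix_def transpose_def vec_eq_iff)
  have "cinner (P *v x) y = (\<Sum>i\<in>UNIV. \<Sum>j\<in>UNIV. P $ i $ j * x $ j * cnj (y $ i))"
    by (simp add: cinner_def matrix_vector_mult_def sum_distrib_right)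
  also have "\<dots> = (\<Sum>j\<in>UNIV. \<Sum>i\<in>UNIV. P $ i $ j * x $ j * cnj (y $ i))"
    by (rule sum.swap)
  also have "\<dots> = cinner x (P *v y)"
    by (simp add: cinner_def matrix_vector_mult_def sum_distrib_left P mult_ac)
  finally show ?thesis .
qed

lemma orth_proj_the:
  fixes \<U> :: "(complex^'n) set"
  assumes \<U>: "vec.subspace \<U>"
  shows "orth_proj \<U> ** orth_proj \<U> = orth_proj \<U> \<and> ctranspose (orth_proj \<U>) = orth_proj \<U> \<and>
    range ((*v) (orth_proj \<U>)) = \<U>"
proof -
  obtain P where P: "\<And>x. P *v x \<in> \<U>" "\<And>x w. w \<in> \<U> \<Longrightarrow> cinner (x - P *v x) w = 0"
    using complex_projection_exists[OF \<U>] by blast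
  have unique: "y = P *v x" if y: "y \<in> \<U>" "\<And>w. w \<in> \<U> \<Longrightarrow> cinner (x - y) w = 0" for x y
  proof -
    have "y - P *v x \<in> \<U>" using y P \<U> by (simp add: vec.subspace_diff)
    then have "cinner (y - P *v x) (y - P *v x) = 0"
      using P(2)[of "y - P *v x" x] y(2)[of "y - P *v x"] by (simp add: cinner_diff_left)
    then show ?thesis using cinner_self_eq_0 by fastforce
  qed
  have id: "P *v u = u" if "u \<in> \<U>" for u
    using unique[of u u] that by (simp add: cinner_def)
  show ?thesis
    unfolding orth_proj_def
  proof (rule theI)
    have "P ** P = P"
      using id P(1) by (simp add: matrix_eq flip: matrix_vector_mul_assoc)
    moreover have "ctranspose P = P"
    proof -
      have sym: "cinner (P *v x) y = cinner x (P *v y)" for x y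
      proof -
        have "cinner x (P *v y) = cinner (P *v x) (P *v y)"
          using P(2)[OF P(1), of x y] by (simp add: cinner_diff_left)
        moreover have "cinner (P *v x) y = cinner (P *v x) (P *v y)"
          using P(2)[OF P(1), of y x] cinner_commute[of "P *v x" "y - P *v y"]
          by (simp add: cinner_diff_right)
        ultimately show ?thesis by simp
      qed
      have entry: "(P *v axis j 1) $ i = P $ i $ j" for i j
        by (rule mult_axis)
      have "cnj (P $ j $ i) = P $ i $ j" for i j
        using sym[of "axis j 1" "axis i 1"] by (simp add: cinner_axis_right cinner_axis_left entry)
      then show ?thesis
        by (simp add: ctranspose_def map_matrix_def transpose_def vec_eq_iff)
    qed
    moreover have "range ((*v) P) = \<U>"
    proof (intro equalityI subsetI)
      fix u assume "u \<in> \<U>"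
      then have "u = P *v u" by (simp add: id)
      then show "u \<in> range ((*v) P)" by (rule image_eqI) simp
    qed (use P(1) in auto)
    ultimately show "P ** P = P \<and> ctranspose P = P \<and> range ((*v) P) = \<U>" by blast
  next
    fix P' :: "complex^'n^'n" assume P': "P' ** P' = P' \<and> ctranspose P' = P' \<and> range ((*v) P') = \<U>"
    have "P' *v x = P *v x" for x
    proof (rule unique)
      show "P' *v x \<in> \<U>" using P' by blast
    next
      fix w assume "w \<in> \<U>"
      then obtain u where u: "w = P' *v u" using P' by blast
      have "cinner (x - P' *v x) w = cinner (P' *v (x - P' *v x)) u"
        using P' by (simp add: u cinner_hermitian)
      also have "P' *v (x - P' *v x) = 0"
        using P' by (simp add: matrix_vector_mult_diff_distrib matrix_vector_mul_assoc)
      finally show "cinner (x - P' *v x) w = 0" by (simp add: cinner_def)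
    qed
    then show "P' = P" by (simp add: matrix_eq)
  qed
qed

definition perp :: "(complex^'n) set \<Rightarrow> (complex^'n) set" where
  "perp \<U> = {\<eta>. \<forall>\<zeta>\<in>\<U>. cinner \<eta> \<zeta> = 0}"

context
  fixes \<U> :: "(complex^'n) set"
  assumes \<U>: "vec.subspace \<U>"
begin

lemma orth_proj_idem: "orth_proj \<U> ** orth_proj \<U> = orth_proj \<U>"
  and orth_proj_hermitian: "ctranspose (orth_proj \<U>) = orth_proj \<U>"
  and orth_proj_in: "orth_proj \<U> *v x \<in> \<U>"
  using orth_proj_the[OF \<U>] by blast+

lemma orth_proj_fix: "\<zeta> \<in> \<U> \<Longrightarrow> orth_proj \<U> *v \<zeta> = \<zeta>"
proof -
  assume "\<zeta> \<in> \<U>"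
  then obtain x where "\<zeta> = orth_proj \<U> *v x" using orth_proj_the[OF \<U>] by blast
  then show ?thesis by (simp add: matrix_vector_mul_assoc orth_proj_idem)
qed

lemma cnj_orth_proj: "cnj (orth_proj \<U> $ i $ j) = orth_proj \<U> $ j $ i"
  using orth_proj_hermitian by (auto simp: ctranspose_def map_matrix_def transpose_def vec_eq_iff)

lemma orth_proj_perp: "\<eta> \<in> perp \<U> \<Longrightarrow> orth_proj \<U> *v \<eta> = 0"
proof -
  assume "\<eta> \<in> perp \<U>"
  then have "cinner (orth_proj \<U> *v \<eta>) (orth_proj \<U> *v \<eta>) = 0"
    using orth_proj_in by (simp add: cinner_hermitian[OF orth_proj_hermitian] perp_def orth_proj_fix)
  then show ?thesis by (rule cinner_self_eq_0)
qed

lemma perp_orth_proj: "(mat 1 - orth_proj \<U>) *v x \<in> perp \<U>"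
  unfolding perp_def
proof (intro CollectI ballI)
  fix \<zeta> assume "\<zeta> \<in> \<U>"
  then have "cinner (orth_proj \<U> *v x) \<zeta> = cinner x \<zeta>"
    by (simp add: cinner_hermitian[OF orth_proj_hermitian] orth_proj_fix)
  then show "cinner ((mat 1 - orth_proj \<U>) *v x) \<zeta> = 0"
    by (simp add: matrix_vector_mult_diff_rdistrib cinner_diff_left)
qed

lemma column_orth_proj: "(\<chi> i. orth_proj \<U> $ i $ j) \<in> \<U>"
proof -
  have "(\<chi> i. orth_proj \<U> $ i $ j) = orth_proj \<U> *v axis j 1"
    by (simp add: vec_eq_iff mult_axis)
  then show ?thesis using orth_proj_in by simp
qed

lemma column_orth_proj_compl: "(\<chi> i. (mat 1 - orth_proj \<U>) $ i $ j) \<in> perp \<U>"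
proof -
  have "(\<chi> i. (mat 1 - orth_proj \<U>) $ i $ j) = (mat 1 - orth_proj \<U>) *v axis j 1"
    by (simp add: vec_eq_iff mult_axis)
  then show ?thesis using perp_orth_proj by simp
qed

lemma expand_subspace: "\<zeta> \<in> \<U> \<Longrightarrow> cnj (\<zeta> $ i) = (\<Sum>j\<in>UNIV. cnj (\<zeta> $ j) * orth_proj \<U> $ j $ i)"
proof -
  assume "\<zeta> \<in> \<U>"
  then have "(orth_proj \<U> *v \<zeta>) $ i = \<zeta> $ i"
    by (simp add: orth_proj_fix)
  then have "\<zeta> $ i = (\<Sum>j\<in>UNIV. orth_proj \<U> $ i $ j * \<zeta> $ j)"
    by (simp add: matrix_vector_mult_def)
  from arg_cong[OF this, of cnj] show ?thesis by (simp add: cnj_orth_proj mult.commute)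
qed

lemma expand_perp: "\<eta> \<in> perp \<U> \<Longrightarrow> \<eta> $ i = (\<Sum>j\<in>UNIV. (mat 1 - orth_proj \<U>) $ i $ j * \<eta> $ j)"
proof -
  assume "\<eta> \<in> perp \<U>"
  then have "\<eta> = (mat 1 - orth_proj \<U>) *v \<eta>"
    using orth_proj_perp by (simp add: matrix_vector_mult_diff_rdistrib)
  then have "\<eta> $ i = ((mat 1 - orth_proj \<U>) *v \<eta>) $ i" by simp
  then show ?thesis by (simp add: matrix_vector_mult_def)
qed

end

text \<open>
  The columns of the two projections span the subspace and the complement.
\<close>

lemma annihilated_iff:
  fixes \<U> :: "(complex^'n) set" and \<V> :: "(complex^'m) set"
  assumes \<U>: "vec.subspace \<U>" and \<V>: "vec.subspace \<V>"
  shows "(\<forall>\<zeta>\<in>\<U>. \<forall>\<eta>\<in>perp \<V>. (\<Sum>p\<in>UNIV. \<Sum>c\<in>UNIV. cnj (\<zeta> $ p) * \<eta> $ c * F p c) = 0) \<longleftrightarrow>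
    (\<forall>i j. (\<Sum>p\<in>UNIV. \<Sum>c\<in>UNIV. orth_proj \<U> $ i $ p * (mat 1 - orth_proj \<V>) $ c $ j * F p c) = 0)"
    (is "?L \<longleftrightarrow> ?R")
proof
  assume L: ?L
  show ?R
  proof (intro allI)
    fix i j
    show "(\<Sum>p\<in>UNIV. \<Sum>c\<in>UNIV. orth_proj \<U> $ i $ p * (mat 1 - orth_proj \<V>) $ c $ j * F p c) = 0"
      using L[rule_format, OF column_orth_proj[OF \<U>, of i] column_orth_proj_compl[OF \<V>, of j]]
      by (simp add: cnj_orth_proj[OF \<U>])
  qed
next
  assume R: ?R
  show ?L
  proof (intro ballI)
    fix \<zeta> \<eta> assume \<zeta>: "\<zeta> \<in> \<U>" and \<eta>: "\<eta> \<in> perp \<V>"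
    let ?P = "orth_proj \<U>" and ?Q = "mat 1 - orth_proj \<V>"
    have "(\<Sum>p\<in>UNIV. \<Sum>c\<in>UNIV. cnj (\<zeta> $ p) * \<eta> $ c * F p c)
      = (\<Sum>p\<in>UNIV. \<Sum>c\<in>UNIV. (\<Sum>i\<in>UNIV. cnj (\<zeta> $ i) * ?P $ i $ p) * (\<Sum>j\<in>UNIV. ?Q $ c $ j * \<eta> $ j) * F p c)"
      unfolding expand_subspace[OF \<U> \<zeta>, symmetric] expand_perp[OF \<V> \<eta>, symmetric] ..
    also have "\<dots> = (\<Sum>p\<in>UNIV. \<Sum>c\<in>UNIV. \<Sum>i\<in>UNIV. \<Sum>j\<in>UNIV.
        cnj (\<zeta> $ i) * \<eta> $ j * (?P $ i $ p * ?Q $ c $ j * F p c))"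
      unfolding sum_product sum_distrib_right by (intro sum.cong refl) (simp only: sum_distrib_left mult_ac)
    also have "\<dots> = (\<Sum>i\<in>UNIV. \<Sum>j\<in>UNIV. \<Sum>p\<in>UNIV. \<Sum>c\<in>UNIV.
        cnj (\<zeta> $ i) * \<eta> $ j * (?P $ i $ p * ?Q $ c $ j * F p c))"
      by (rule sum_swap_pairs)
    also have "\<dots> = 0" using R by (simp flip: sum_distrib_left)
    finally show "(\<Sum>p\<in>UNIV. \<Sum>c\<in>UNIV. cnj (\<zeta> $ p) * \<eta> $ c * F p c) = 0" .
  qed
qed

section \<open>Traces on the algebra generated by the products of entries\<close>

text \<open>
  The letter \<open>(p, q)\<close> stands for \<open>E\<^sub>p\<^sub>q = U\<^sub>p\<^sup>* U\<^sub>q\<close>, and \<open>star\<close> is the adjoint of a word. The last four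
  assumptions are, in this order, that \<open>U\<^sup>* U\<close>, \<open>(U\<^sup>t)\<^sup>* U\<^sup>t\<close>, \<open>U U\<^sup>*\<close> and \<open>U\<^sup>t (U\<^sup>t)\<^sup>*\<close> are the identity, where
  the first two products occur in a single letter and the last two between neighbouring letters. By
  cyclicity it suffices to have them at the beginning of a word.
\<close>

type_synonym 'x letter = "('x \<times> 'x) \<times> ('x \<times> 'x)"

definition star :: "'x letter list \<Rightarrow> 'x letter list" where
  "star w = rev (map prod.swap w)"

lemma star_simps [simp]:
  "star [] = []" "star (e # w) = star w @ [prod.swap e]" "star (v @ w) = star w @ star v"
  "star (star w) = w"
  by (simp_all add: star_def rev_map)

locale biunitary_trace =
  fixes \<phi> :: "('x::finite) letter list \<Rightarrow> complex"
  assumes positive: "pos_kernel (\<lambda>w v. \<phi> (star v @ w))"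
    and cyclic: "\<phi> (v @ w) = \<phi> (w @ v)"
    and unit: "\<phi> [] = 1"
    and sum_output: "(\<Sum>a\<in>UNIV. \<phi> (((x, a), (x', a)) # w)) = (if x = x' then \<phi> w else 0)"
    and sum_input: "(\<Sum>x\<in>UNIV. \<phi> (((x, a), (x, a')) # w)) = (if a = a' then \<phi> w else 0)"
    and contract_input: "(\<Sum>x\<in>UNIV. \<phi> ((p, (x, a)) # ((x, a'), q) # w))
      = (if a = a' then \<phi> ((p, q) # w) else 0)"
    and contract_output: "(\<Sum>a\<in>UNIV. \<phi> ((p, (x, a)) # ((x', a), q) # w))
      = (if x = x' then \<phi> ((p, q) # w) else 0)"
begin

lemma sum_output_mid:
  "(\<Sum>a\<in>UNIV. \<phi> (u @ ((x, a), (x', a)) # w)) = (if x = x' then \<phi> (u @ w) else 0)"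
  using sum_output[of x x' "w @ u"] by (simp add: cyclic[of u])

lemma sum_input_mid:
  "(\<Sum>x\<in>UNIV. \<phi> (u @ ((x, a), (x, a')) # w)) = (if a = a' then \<phi> (u @ w) else 0)"
  using sum_input[of a a' "w @ u"] by (simp add: cyclic[of u])

lemma contract_input_mid:
  "(\<Sum>x\<in>UNIV. \<phi> (u @ (p, (x, a)) # ((x, a'), q) # w)) = (if a = a' then \<phi> (u @ (p, q) # w) else 0)"
  using contract_input[of p a a' q "w @ u"] by (simp add: cyclic[of u])

lemma contract_output_mid:
  "(\<Sum>a\<in>UNIV. \<phi> (u @ (p, (x, a)) # ((x', a), q) # w)) = (if x = x' then \<phi> (u @ (p, q) # w) else 0)"
  using contract_output[of p x x' q "w @ u"] by (simp add: cyclic[of u])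

end

text \<open>
  With \<open>p = (x, y)\<close> and \<open>c = (a, b)\<close> the two letters multiply to $U_r^* (U_{a,x} U_{b,y}^*) U_s$. The
  relation is thus the vanishing of $(P \otimes I) U^t_{1,3} U^*_{2,3} (Q^\perp \otimes I)$, tested
  on vectors and multiplied by one entry on either side.
\<close>

definition intertwines :: "(('x::finite) letter list \<Rightarrow> complex) \<Rightarrow> (complex^('x \<times> 'x)) set \<Rightarrow>
    (complex^('x \<times> 'x)) set \<Rightarrow> bool" where
  "intertwines \<phi> \<U> \<V> \<longleftrightarrow> (\<forall>\<zeta>\<in>\<U>. \<forall>\<eta>\<in>perp \<V>. \<forall>r s w.
     (\<Sum>p\<in>UNIV. \<Sum>c\<in>UNIV. cnj (\<zeta> $ p) * \<eta> $ c *
        \<phi> ((r, (fst p, fst c)) # ((snd p, snd c), s) # w)) = 0)"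

text \<open>
  The effect on words of passing from \<open>U\<close> to its transpose.
\<close>

definition transposed :: "('x letter list \<Rightarrow> complex) \<Rightarrow> 'x letter list \<Rightarrow> complex" where
  "transposed \<phi> w = \<phi> (map (map_prod prod.swap prod.swap) w)"

text \<open>The same relation for operators, where \<open>U\<^sub>p U\<^sub>q\<^sup>*\<close> makes sense without further factors.\<close>

definition op_intertwines :: "'h hilbert \<Rightarrow> (('x::finite), 'h) opmat \<Rightarrow> (complex^('x \<times> 'x)) set \<Rightarrow>
    (complex^('x \<times> 'x)) set \<Rightarrow> bool" where
  "op_intertwines H U \<U> \<V> \<longleftrightarrow> (\<forall>\<zeta>\<in>\<U>. \<forall>\<eta>\<in>perp \<V>. \<forall>v\<in>carrier H. \<forall>w\<in>carrier H.
     (\<Sum>p\<in>UNIV. \<Sum>c\<in>UNIV. cnj (\<zeta> $ p) * \<eta> $ c *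
        hinner H (U (fst c) (fst p) (op_adj H (U (snd c) (snd p)) v)) w) = 0)"

section \<open>The Hilbert space of a trace\<close>

text \<open>
  The vector \<open>g (z, w)\<close> is $w\xi \otimes e_z$ in the tensor product of the Hilbert space of \<open>\<phi>\<close> with $C^X$.
\<close>

locale trace_space = biunitary_trace \<phi> + hilbert_space H
  for \<phi> :: "('x::finite) letter list \<Rightarrow> complex" and H :: "'h hilbert" (structure) +
  fixes g :: "'x \<times> 'x letter list \<Rightarrow> 'h"
  assumes g_total: "total g"
    and gram: "hinner H (g (z, w)) (g (z', v)) = (if z = z' then \<phi> (star v @ w) else 0)"

lemma trace_space_exists:
  fixes \<phi> :: "('x::finite) letter list \<Rightarrow> complex"
  assumes \<phi>: "biunitary_trace \<phi>" and big: "(UNIV :: real set) \<lesssim> (UNIV :: 'h set)"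
  obtains H :: "'h hilbert" and g where "trace_space \<phi> H g"
proof -
  interpret biunitary_trace \<phi> by (rule \<phi>)
  define K where "K = (\<lambda>(z :: 'x, w) (z', v). if z = z' then \<phi> (star v @ w) else 0)"
  have "pos_kernel K"
    unfolding pos_kernel_def
  proof (intro allI impI)
    fix A :: "('x \<times> 'x letter list) set" and c :: "'x \<times> 'x letter list \<Rightarrow> complex"
    assume A: "finite A"
    define W where "W = snd ` A"
    define d where "d i = (if i \<in> A then c i else 0)" for i
    have W: "finite W" "A \<subseteq> UNIV \<times> W" using A by (force simp: W_def)+
    have "(\<Sum>i\<in>A. \<Sum>j\<in>A. c i * cnj (c j) * K i j)
        = (\<Sum>i\<in>UNIV \<times> W. \<Sum>j\<in>UNIV \<times> W. d i * cnj (d j) * K i j)"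
      using W by (intro sum.mono_neutral_cong_left ballI sum.neutral) (auto simp: d_def)
    also have "\<dots> = (\<Sum>z\<in>UNIV. \<Sum>w\<in>W. \<Sum>z'\<in>UNIV. \<Sum>v\<in>W. d (z, w) * cnj (d (z', v)) * K (z, w) (z', v))"
    proof -
      have "(\<Sum>i\<in>UNIV \<times> W. F i) = (\<Sum>z\<in>UNIV. \<Sum>w\<in>W. F (z, w))"
        for F :: "'x \<times> 'x letter list \<Rightarrow> complex"
        by (simp add: sum.cartesian_product)
      then show ?thesis by (simp only:)
    qed
    also have "\<dots> = (\<Sum>z\<in>UNIV. \<Sum>w\<in>W. \<Sum>z'\<in>UNIV. if z' = z then (\<Sum>v\<in>W. d (z, w) * cnj (d (z, v)) * \<phi> (star v @ w)) else 0)"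
      by (intro sum.cong refl) (auto simp: K_def)
    also have "\<dots> = (\<Sum>z\<in>UNIV. \<Sum>w\<in>W. \<Sum>v\<in>W. d (z, w) * cnj (d (z, v)) * \<phi> (star v @ w))"
      by simp
    also have "\<dots> \<in> \<real>\<^sub>\<ge>\<^sub>0"
      by (intro sum_nonneg_Reals pos_kernelD[OF positive W(1)])
    finally show "(\<Sum>i\<in>A. \<Sum>j\<in>A. c i * cnj (c j) * K i j) \<in> \<real>\<^sub>\<ge>\<^sub>0" .
  qed
  then obtain H :: "'h hilbert" and g where H: "hilbert_space H" "hilbert_space.total H g"
    "\<And>i j. hinner H (g i) (g j) = K i j"
    using Kolmogorov[OF _ big] by blast
  have "trace_space \<phi> H g"
    by (intro trace_space.intro trace_space_axioms.intro \<phi> H(1,2)) (simp add: H(3) K_def)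
  then show thesis by (rule that)
qed

context trace_space
begin

lemma g_in [simp, intro]: "g i \<in> carrier H"
  using g_total by (rule total_in)

lemma op_gram_eqI:
  assumes "S \<in> ops" "T \<in> ops"
    and "\<And>z w z' v. hinner H (S (g (z, w))) (g (z', v)) = hinner H (T (g (z, w))) (g (z', v))"
  shows "S = T"
proof (rule total_op_ext[OF g_total assms(1,2)])
  fix i
  show "S (g i) = T (g i)"
    by (rule total_ext[OF g_total]) (use assms in \<open>auto simp: split_paired_all, (cases i, auto)?\<close>)
qed

text \<open>
  For fixed \<open>z\<close> and \<open>x\<close> the operators \<open>E\<^sub>p\<^sub>q\<close> with \<open>p = (b, z)\<close> and \<open>q = (x, a)\<close> form a column over the
  pairs \<open>(a, b)\<close>: summing \<open>E\<^sub>q\<^sub>p E\<^sub>p\<^sub>q\<close> over \<open>b\<close> contracts it to \<open>E\<^sub>q\<^sub>q\<close>, and the sum of these over \<open>a\<close> is the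
  identity.
\<close>

lemma left_op_exists:
  "\<exists>T\<in>ops. (\<forall>z w. T (g (z, w)) = g (z, (p, q) # w)) \<and>
     (\<forall>z w. op_adj H T (g (z, w)) = g (z, (q, p) # w))"
proof -
  obtain b z0 x a where pq: "p = (b, z0)" "q = (x, a)" by (cases p, cases q) auto
  define h where "h = (\<lambda>(a, b) (z, w). g (z, ((b, z0), (x, a)) # w))"
  define h' where "h' = (\<lambda>(a, b) (z, w). g (z, ((x, a), (b, z0)) # w))"
  have 1: "h k i \<in> carrier H" for k i by (simp add: h_def split_beta)
  have 2: "h' k i \<in> carrier H" for k i by (simp add: h'_def split_beta)
  have 3: "(\<Sum>k\<in>UNIV. hinner H (h k i) (h k j)) = hinner H (g i) (g j)" for i j
    by (cases i; cases j)
       (simp add: h_def sum_UNIV_prod gram contract_input_mid sum_output_mid)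
  have 4: "hinner H (h k i) (g j) = hinner H (g i) (h' k j)" for k i j
    by (cases i; cases j; cases k) (simp add: h_def h'_def gram)
  obtain T where T: "\<And>k. T k \<in> ops" "\<And>k i. T k (g i) = h k i" "\<And>k i. op_adj H (T k) (g i) = h' k i"
    by (rule column_operators[OF g_total 1 2 3 4]) (rule that; assumption)
  show ?thesis
    by (rule bexI[of _ "T (a, b)"]) (auto simp: T h_def h'_def pq)
qed

definition left_op :: "'x \<times> 'x \<Rightarrow> 'x \<times> 'x \<Rightarrow> 'h \<Rightarrow> 'h" where
  "left_op p q = (SOME T. T \<in> ops \<and> (\<forall>z w. T (g (z, w)) = g (z, (p, q) # w)) \<and>
     (\<forall>z w. op_adj H T (g (z, w)) = g (z, (q, p) # w)))"

lemma left_op [simp]: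
  "left_op p q \<in> ops" "left_op p q (g (z, w)) = g (z, (p, q) # w)"
  "op_adj H (left_op p q) (g (z, w)) = g (z, (q, p) # w)"
  using someI_ex[OF left_op_exists[of p q, unfolded Bex_def]] by (auto simp: left_op_def)

text \<open>
  The same computation at the other end of the word. Cyclicity moves the new letters together.
\<close>

lemma right_op_exists:
  "\<exists>T\<in>ops. (\<forall>z w. T (g (z, w)) = g (z, w @ [(p, q)])) \<and>
     (\<forall>z w. op_adj H T (g (z, w)) = g (z, w @ [(q, p)]))"
proof -
  obtain b z0 x a where pq: "p = (x, a)" "q = (b, z0)" by (cases p, cases q) auto
  define h where "h = (\<lambda>(a, b) (z, w). g (z, w @ [((x, a), (b, z0))]))"
  define h' where "h' = (\<lambda>(a, b) (z, w). g (z, w @ [((b, z0), (x, a))]))"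
  have 1: "h k i \<in> carrier H" for k i by (simp add: h_def split_beta)
  have 2: "h' k i \<in> carrier H" for k i by (simp add: h'_def split_beta)
  have rot: "\<phi> (e # u @ v @ [e']) = \<phi> ((u @ v) @ [e', e])" for e e' u v
    using cyclic[of "[e]" "u @ v @ [e']"] by simp
  have 3: "(\<Sum>k\<in>UNIV. hinner H (h k i) (h k j)) = hinner H (g i) (g j)" for i j
  proof -
    obtain z w z' v where ij: "i = (z, w)" "j = (z', v)" by (cases i; cases j) auto
    show ?thesis
      using contract_input_mid[where u = "star v @ w" and w = "[]"]
        sum_output_mid[where u = "star v @ w" and w = "[]"]
      by (simp add: h_def sum_UNIV_prod gram rot ij)
  qed
  have 4: "hinner H (h k i) (g j) = hinner H (g i) (h' k j)" for k i j
  proof -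
    obtain z w z' v a b where ij: "i = (z, w)" "j = (z', v)" "k = (a, b)"
      by (cases i; cases j; cases k) auto
    show ?thesis
      using cyclic[of "star v @ w" "[((x, a), (b, z0))]"]
      by (simp add: h_def h'_def gram ij)
  qed
  obtain T where T: "\<And>k. T k \<in> ops" "\<And>k i. T k (g i) = h k i" "\<And>k i. op_adj H (T k) (g i) = h' k i"
    by (rule column_operators[OF g_total 1 2 3 4]) (rule that; assumption)
  show ?thesis
    by (rule bexI[of _ "T (a, b)"]) (auto simp: T h_def h'_def pq)
qed

definition right_op :: "'x \<times> 'x \<Rightarrow> 'x \<times> 'x \<Rightarrow> 'h \<Rightarrow> 'h" where
  "right_op p q = (SOME T. T \<in> ops \<and> (\<forall>z w. T (g (z, w)) = g (z, w @ [(p, q)])) \<and>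
     (\<forall>z w. op_adj H T (g (z, w)) = g (z, w @ [(q, p)])))"

lemma right_op [simp]:
  "right_op p q \<in> ops" "right_op p q (g (z, w)) = g (z, w @ [(p, q)])"
  "op_adj H (right_op p q) (g (z, w)) = g (z, w @ [(q, p)])"
  using someI_ex[OF right_op_exists[of p q, unfolded Bex_def]] by (auto simp: right_op_def)

lemma unit_op_exists:
  "\<exists>T\<in>ops. (\<forall>z w. T (g (z, w)) = (if z = k then g (l, w) else \<zero>)) \<and>
     (\<forall>z w. op_adj H T (g (z, w)) = (if z = l then g (k, w) else \<zero>))"
proof -
  define h where "h = (\<lambda>k (z :: 'x, w :: 'x letter list). if z = k then g (l, w) else \<zero>)"
  define h' where "h' = (\<lambda>k (z :: 'x, w :: 'x letter list). if z = l then g (k, w) else \<zero>)"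
  have 1: "h k i \<in> carrier H" for k i by (simp add: h_def split_beta)
  have 2: "h' k i \<in> carrier H" for k i by (simp add: h'_def split_beta)
  have 3: "(\<Sum>k\<in>UNIV. hinner H (h k i) (h k j)) = hinner H (g i) (g j)" for i j
  proof -
    obtain z w z' v where ij: "i = (z, w)" "j = (z', v)" by (cases i; cases j) auto
    have "hinner H (h k i) (h k j) = (if k = z then (if z = z' then \<phi> (star v @ w) else 0) else 0)" for k
      by (auto simp: h_def ij gram)
    then show ?thesis by (simp add: ij gram)
  qed
  have 4: "hinner H (h k i) (g j) = hinner H (g i) (h' k j)" for k i j
    by (cases i; cases j) (auto simp: h_def h'_def gram)
  obtain T where T: "\<And>k. T k \<in> ops" "\<And>k i. T k (g i) = h k i" "\<And>k i. op_adj H (T k) (g i) = h' k i"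
    by (rule column_operators[OF g_total 1 2 3 4]) (rule that; assumption)
  show ?thesis
    by (rule bexI[of _ "T k"]) (auto simp: T h_def h'_def)
qed

definition unit_op :: "'x \<Rightarrow> 'x \<Rightarrow> 'h \<Rightarrow> 'h" where
  "unit_op l k = (SOME T. T \<in> ops \<and> (\<forall>z w. T (g (z, w)) = (if z = k then g (l, w) else \<zero>)) \<and>
     (\<forall>z w. op_adj H T (g (z, w)) = (if z = l then g (k, w) else \<zero>)))"

lemma unit_op [simp]:
  "unit_op l k \<in> ops" "unit_op l k (g (z, w)) = (if z = k then g (l, w) else \<zero>)"
  "op_adj H (unit_op l k) (g (z, w)) = (if z = l then g (k, w) else \<zero>)"
  using someI_ex[OF unit_op_exists[of k l, unfolded Bex_def]] by (auto simp: unit_op_def)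

text \<open>
  The matrix over $C^X$ of the operator for $U_{a,x}$ has the entry \<open>U\<^sub>q\<^sup>* U\<^sub>p\<close> with \<open>q = (b, z)\<close> and
  \<open>p = (x, a)\<close> in row \<open>b\<close> and column \<open>z\<close>. It is the product of the adjoint of \<open>U\<close>, regarded as a map
  on $L \otimes C^X$, with the copies of $U_{a,x}$ from $K \otimes C^X$ into $L \otimes C^X$.
\<close>

lemma big_unitary_exists:
  "\<exists>T\<in>ops. (\<forall>z w. T (g (z, w)) = (\<Oplus>b\<in>UNIV. g (b, ((b, z), (x, a)) # w))) \<and>
     (\<forall>b w. op_adj H T (g (b, w)) = (\<Oplus>z\<in>UNIV. g (z, ((x, a), (b, z)) # w)))"
proof -
  define h where "h = (\<lambda>a (z, w). \<Oplus>b\<in>UNIV. g (b, ((b, z), (x, a)) # w))"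
  define h' where "h' = (\<lambda>a (b, w). \<Oplus>z\<in>UNIV. g (z, ((x, a), (b, z)) # w))"
  have 1: "h k i \<in> carrier H" for k i by (auto simp: h_def split_beta intro: finsum_in)
  have 2: "h' k i \<in> carrier H" for k i by (auto simp: h'_def split_beta intro: finsum_in)
  have 3: "(\<Sum>k\<in>UNIV. hinner H (h k i) (h k j)) = hinner H (g i) (g j)" for i j
    by (cases i; cases j)
       (simp add: h_def hinner_finsum_left hinner_finsum_right finsum_in gram contract_input_mid sum_output_mid)
  have 4: "hinner H (h k i) (g j) = hinner H (g i) (h' k j)" for k i j
    by (cases i; cases j)
       (simp add: h_def h'_def hinner_finsum_left hinner_finsum_right gram)
  obtain T where T: "\<And>k. T k \<in> ops" "\<And>k i. T k (g i) = h k i" "\<And>k i. op_adj H (T k) (g i) = h' k i"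
    by (rule column_operators[OF g_total 1 2 3 4]) (rule that; assumption)
  show ?thesis
    by (rule bexI[of _ "T a"]) (auto simp: T h_def h'_def)
qed

definition big_unitary :: "('x, 'h) opmat" where
  "big_unitary a x = (SOME T. T \<in> ops \<and> (\<forall>z w. T (g (z, w)) = (\<Oplus>b\<in>UNIV. g (b, ((b, z), (x, a)) # w))) \<and>
     (\<forall>b w. op_adj H T (g (b, w)) = (\<Oplus>z\<in>UNIV. g (z, ((x, a), (b, z)) # w))))"

lemma big_unitary:
  "big_unitary a x \<in> ops"
  "big_unitary a x (g (z, w)) = (\<Oplus>b\<in>UNIV. g (b, ((b, z), (x, a)) # w))"
  "op_adj H (big_unitary a x) (g (b, w)) = (\<Oplus>z\<in>UNIV. g (z, ((x, a), (b, z)) # w))"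
  using someI_ex[OF big_unitary_exists[of x a, unfolded Bex_def]] by (auto simp: big_unitary_def)

lemmas [simp] = big_unitary(1)

lemma big_unitary_gram:
  "hinner H (big_unitary a x (g (z, w))) (big_unitary b y (g (z', v)))
    = (if z = z' then \<phi> (star v @ ((y, b), (x, a)) # w) else 0)"
  by (simp add: big_unitary hinner_finsum_left hinner_finsum_right finsum_in gram contract_input_mid)

lemma big_unitary_adj_gram:
  "hinner H (op_adj H (big_unitary a x) (g (b0, w))) (op_adj H (big_unitary b y) (g (b1, v)))
    = (\<Sum>z\<in>UNIV. \<phi> (star v @ ((b1, z), (y, b)) # ((x, a), (b0, z)) # w))"
  by (simp add: big_unitary hinner_finsum_left hinner_finsum_right finsum_in gram)

lemma om_mult_eqI:
  assumes A: "\<And>i j. A i j \<in> ops" and B: "\<And>i j. B i j \<in> ops"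
    and eq: "\<And>i j z w z' v. (\<Sum>m\<in>UNIV. hinner H (A i m (B m j (g (z, w)))) (g (z', v)))
      = (if i = j \<and> z = z' then \<phi> (star v @ w) else 0)"
  shows "A \<star> B = om_one H"
proof (rule ext, rule ext)
  fix i j
  show "(A \<star> B) i j = om_one H i j"
    unfolding om_mult_def om_one_def
    by (rule op_gram_eqI)
       (use A B eq[of i j] in \<open>auto simp: op_finsum_closed hinner_op_finsum gram\<close>)
qed

lemma sum_trace_input:
  "(\<Sum>x\<in>UNIV. \<Sum>z\<in>UNIV. \<phi> (u @ ((b', z), (x, a)) # ((x, a'), (b, z)) # w))
    = (if a = a' \<and> b = b' then \<phi> (u @ w) else 0)"
  by (subst sum.swap) (auto simp: contract_input_mid sum_output_mid sum_if_const)

lemma sum_trace_output: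
  "(\<Sum>a\<in>UNIV. \<Sum>z\<in>UNIV. \<phi> (u @ ((b', z), (x, a)) # ((x', a), (b, z)) # w))
    = (if x = x' \<and> b = b' then \<phi> (u @ w) else 0)"
  by (subst sum.swap) (auto simp: contract_output_mid sum_output_mid sum_if_const)

lemma bi_unitary_big_unitary: "bi_unitary H big_unitary"
proof -
  have "om_adj H big_unitary \<star> big_unitary = om_one H"
    by (rule om_mult_eqI) (simp_all add: om_adj_def hinner_op_adj_left big_unitary_gram sum_output_mid sum_if_const)
  moreover have "om_adj H (om_transpose big_unitary) \<star> om_transpose big_unitary = om_one H"
    by (rule om_mult_eqI)
       (simp_all add: om_adj_def om_transpose_def hinner_op_adj_left big_unitary_gram sum_input_mid sum_if_const)
  moreover have "big_unitary \<star> om_adj H big_unitary = om_one H"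
    by (rule om_mult_eqI)
       (simp_all add: om_adj_def hinner_op_adj_right[symmetric] big_unitary_adj_gram sum_trace_input)
  moreover have "om_transpose big_unitary \<star> om_adj H (om_transpose big_unitary) = om_one H"
    by (rule om_mult_eqI)
       (simp_all add: om_adj_def om_transpose_def hinner_op_adj_right[symmetric] big_unitary_adj_gram sum_trace_output)
  ultimately show ?thesis
    by (simp add: bi_unitary_def om_unitary_def opmats_def om_transpose_def)
qed

lemma big_unitary_product: "op_adj H (big_unitary a x) \<otimes>\<^bsub>\<B> H\<^esub> big_unitary b y = left_op (x, a) (y, b)"
  by (rule op_gram_eqI) (simp_all add: hinner_op_adj_left big_unitary_gram gram)

text \<open>
  The algebra is defined as a commutant, so that its elements are known to commute with the right
  multiplications and the matrix units. It contains all left multiplications.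
\<close>

definition symmetries :: "('h \<Rightarrow> 'h) set" where
  "symmetries = {right_op p q | p q. True} \<union> {unit_op k l | k l. True}"

definition trace_algebra :: "('h \<Rightarrow> 'h) set" where
  "trace_algebra = commutant H symmetries"

lemma symmetries_ops: "symmetries \<subseteq> ops"
  by (auto simp: symmetries_def)

lemma op_adj_right_op: "op_adj H (right_op p q) = right_op q p"
  by (rule total_op_ext[OF g_total]) (auto simp: split_paired_all)

lemma op_adj_unit_op: "op_adj H (unit_op k l) = unit_op l k"
  by (rule total_op_ext[OF g_total]) (auto simp: split_paired_all)

lemma von_neumann_trace_algebra: "von_neumann_algebra H trace_algebra"
  unfolding trace_algebra_def
proof (rule commutant_von_neumann[OF symmetries_ops])
  fix S assume "S \<in> symmetries"
  then consider (right) p q where "S = right_op p q" | (unit) k l where "S = unit_op k l"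
    unfolding symmetries_def by blast
  then show "op_adj H S \<in> symmetries"
  proof cases
    case right
    then show ?thesis unfolding symmetries_def right op_adj_right_op by blast
  next
    case unit
    then show ?thesis unfolding symmetries_def unit op_adj_unit_op by blast
  qed
qed

lemma trace_algebra_iff:
  "T \<in> trace_algebra \<longleftrightarrow> T \<in> ops \<and> (\<forall>p q. T \<otimes>\<^bsub>\<B> H\<^esub> right_op p q = right_op p q \<otimes>\<^bsub>\<B> H\<^esub> T) \<and>
     (\<forall>k l. T \<otimes>\<^bsub>\<B> H\<^esub> unit_op k l = unit_op k l \<otimes>\<^bsub>\<B> H\<^esub> T)"
  unfolding trace_algebra_def commutant_def symmetries_def by blast

lemma left_op_in_trace_algebra: "left_op p q \<in> trace_algebra"
  unfolding trace_algebra_iff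
  by (intro conjI allI total_op_ext[OF g_total]) (auto simp: split_paired_all)

lemma aligned_big_unitary: "aligned H trace_algebra big_unitary"
  by (simp add: aligned_def big_unitary_product left_op_in_trace_algebra)

definition \<Omega> :: 'h where "\<Omega> = g (undefined, [])"

lemma \<Omega>_in [simp]: "\<Omega> \<in> carrier H"
  by (simp add: \<Omega>_def)

text \<open>
  An element of the algebra commutes with right multiplications, and a word applied to \<open>\<Omega>\<close> is the same
  word multiplied from the right. Thus the word can be moved over to \<open>\<Omega>\<close>. Commuting with the matrix units
  keeps \<open>T \<Omega>\<close> in the summand of \<open>\<Omega>\<close>.
\<close>

lemma trace_algebra_coefficient:
  assumes T: "T \<in> trace_algebra"
  shows "hinner H (T \<Omega>) (g (z, w)) = (if z = undefined then hinner H (g (undefined, star w)) (op_adj H T \<Omega>) else 0)"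
proof -
  have Top: "T \<in> ops" and Tr: "\<And>p q v. v \<in> carrier H \<Longrightarrow> T (right_op p q v) = right_op p q (T v)"
    and Tu: "\<And>k l v. v \<in> carrier H \<Longrightarrow> T (unit_op k l v) = unit_op k l (T v)"
    using T unfolding trace_algebra_iff by (metis op_mult_apply)+
  have move: "hinner H (T (g (undefined, u))) (g (undefined, w)) = hinner H (T (g (undefined, u @ star w))) (g (undefined, []))" for u
  proof (induction w arbitrary: u rule: rev_induct)
    case (snoc e w)
    obtain p q where e: "e = (p, q)" by (cases e) auto
    have "hinner H (T (g (undefined, u))) (g (undefined, w @ [e]))
        = hinner H (T (g (undefined, u))) (op_adj H (right_op q p) (g (undefined, w)))"
      by (simp add: e)
    also have "\<dots> = hinner H (T (right_op q p (g (undefined, u)))) (g (undefined, w))"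
      using Top by (simp add: hinner_op_adj_right Tr del: right_op(2,3))
    also have "\<dots> = hinner H (T (g (undefined, (u @ [prod.swap e]) @ star w))) (g (undefined, []))"
      using snoc[of "u @ [prod.swap e]"] by (simp add: e)
    finally show ?case by simp
  qed simp
  show ?thesis
  proof (cases "z = undefined")
    case True
    then show ?thesis
      using move[of "[]"] Top by (simp add: \<Omega>_def hinner_op_adj_right)
  next
    case False
    have "hinner H (T \<Omega>) (g (z, w)) = hinner H (T \<Omega>) (op_adj H (unit_op z z) (g (z, w)))" by simp
    also have "\<dots> = hinner H (T (unit_op z z \<Omega>)) (g (z, w))"
      using Top by (simp add: hinner_op_adj_right Tu del: unit_op(2,3))
    also have "\<dots> = 0" using False Top by (simp add: \<Omega>_def)
    finally show ?thesis using False by simp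
  qed
qed

text \<open>
  The map $\sum c_w w \mapsto \sum \overline{c_w} w^*$ on combinations of words preserves the norm
  because the trace is cyclic. Paired with \<open>T \<Omega>\<close> it gives the pairing with \<open>T\<^sup>* \<Omega>\<close>, so testing
  \<open>T \<Omega>\<close> against a dense set of vectors bounds its norm by that of \<open>T\<^sup>* \<Omega>\<close>.
\<close>

lemma trace_algebra_norm_le:
  assumes T: "T \<in> trace_algebra"
  shows "hnorm H (T \<Omega>) \<le> hnorm H (op_adj H T \<Omega>)"
proof -
  have Top: "T \<in> ops" using T by (simp add: trace_algebra_iff)
  let ?t = "T \<Omega>" and ?t' = "op_adj H T \<Omega>"
  have t: "?t \<in> carrier H" "?t' \<in> carrier H" using Top by auto
  \<comment> \<open>the conjugation on words, cut down to the summand that contains \<open>T \<Omega>\<close>\<close>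
  define gs where "gs = (\<lambda>(z, w). if z = undefined then g (z, star w) else \<zero>)"
  have gs: "gs i \<in> carrier H" for i by (simp add: gs_def split_beta)
  have le: "hnorm H (comb gs A (\<lambda>i. cnj (c i))) \<le> hnorm H (comb g A c)" if A: "finite A" for A c
  proof -
    define A0 where "A0 = {i \<in> A. fst i = undefined}"
    define A1 where "A1 = A - A0"
    have fin: "finite A0" "finite A1" using A by (auto simp: A0_def A1_def)
    have split: "(\<Sum>i\<in>A. F i) = (\<Sum>i\<in>A0. F i) + (\<Sum>i\<in>A1. F i)" for F :: "_ \<Rightarrow> complex"
      using sum.subset_diff[of A0 A F] A by (simp add: A0_def A1_def add.commute)
    have cross: "hinner H (g i) (g j) = 0" "hinner H (g j) (g i) = 0" if "i \<in> A0" "j \<in> A1" for i j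
      using that by (auto simp: A0_def A1_def gram split_paired_all, (cases i; cases j; auto simp: gram)+)
    have gs_gram: "hinner H (gs i) (gs j) = hinner H (g j) (g i)" if "i \<in> A0" "j \<in> A0" for i j
    proof (cases i; cases j)
      fix z w z' v assume "i = (z, w)" "j = (z', v)"
      then show ?thesis using that cyclic[of v "star w"] by (auto simp: A0_def gs_def gram)
    qed
    have gs_0: "gs i = \<zero>" if "i \<in> A1" for i
      using that by (auto simp: A0_def A1_def gs_def split: prod.splits)
    have "hinner H (comb g A c) (comb g A c) = hinner H (comb g A0 c) (comb g A0 c) + hinner H (comb g A1 c) (comb g A1 c)"
      using A fin by (simp add: hinner_comb_left hinner_comb_right split cross)
    moreover have "hinner H (comb gs A (\<lambda>i. cnj (c i))) (comb gs A (\<lambda>i. cnj (c i)))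
      = hinner H (comb g A0 c) (comb g A0 c)"
    proof -
      have "hinner H (comb gs A (\<lambda>i. cnj (c i))) (comb gs A (\<lambda>i. cnj (c i)))
        = (\<Sum>i\<in>A0. \<Sum>j\<in>A0. c i * (cnj (c j) * hinner H (g i) (g j)))"
        using A gs by (simp add: hinner_comb_left hinner_comb_right split gs_0 gs_gram sum_distrib_left mult_ac cong: sum.cong)
      also have "\<dots> = (\<Sum>j\<in>A0. \<Sum>i\<in>A0. c i * (cnj (c j) * hinner H (g i) (g j)))"
        by (rule sum.swap)
      also have "\<dots> = hinner H (comb g A0 c) (comb g A0 c)"
        using fin by (simp add: hinner_comb_left hinner_comb_right sum_distrib_left mult_ac)
      finally show ?thesis .
    qed
    moreover have "0 \<le> Re (hinner H (comb g A1 c) (comb g A1 c))"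
      using hinner_nonneg[of "comb g A1 c"] by (simp add: complex_nonneg_Reals_iff)
    ultimately show ?thesis by (simp add: hnorm_def)
  qed
  obtain As cs where As: "\<And>n::nat. finite (As n)"
    "(\<lambda>n. hnorm H (comb g (As n) (cs n) \<ominus> ?t)) \<longlonglongrightarrow> 0"
    by (rule total_dense[OF g_total t(1)]) (rule that; assumption)
  have "(hnorm H ?t)\<^sup>2 \<le> hnorm H ?t' * hnorm H ?t"
  proof (rule riesz_norm_bound[OF t(1) _ As(2)])
    fix n
    have "hinner H ?t (g i) = hinner H (gs i) ?t'" for i
      using trace_algebra_coefficient[OF T, of "fst i" "snd i"] t by (auto simp: gs_def split: prod.splits)
    then have "hinner H ?t (comb g (As n) (cs n)) = hinner H (comb gs (As n) (\<lambda>i. cnj (cs n i))) ?t'"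
      using As(1)[of n] gs t by (simp add: hinner_comb_left hinner_comb_right)
    then have "cmod (hinner H (comb g (As n) (cs n)) ?t) = cmod (hinner H (comb gs (As n) (\<lambda>i. cnj (cs n i))) ?t')"
      using hinner_commute[of "comb g (As n) (cs n)" ?t] t by simp
    also have "\<dots> \<le> hnorm H (comb gs (As n) (\<lambda>i. cnj (cs n i))) * hnorm H ?t'"
      using gs t by (intro Cauchy_Schwarz) auto
    also have "\<dots> \<le> hnorm H ?t' * hnorm H (comb g (As n) (cs n))"
      using mult_right_mono[OF le[OF As(1)] hnorm_nonneg[OF t(2)]] by (simp add: mult.commute)
    finally show "cmod (hinner H (comb g (As n) (cs n)) ?t) \<le> hnorm H ?t' * hnorm H (comb g (As n) (cs n))" .
  qed auto
  then have sq: "hnorm H ?t * hnorm H ?t \<le> hnorm H ?t' * hnorm H ?t"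
    by (simp add: power2_eq_square)
  show ?thesis
  proof (cases "hnorm H ?t = 0")
    case True
    then show ?thesis using hnorm_nonneg[OF t(2)] by simp
  next
    case False
    then have "0 < hnorm H ?t" using hnorm_nonneg[OF t(1)] by linarith
    then show ?thesis using sq by (rule mult_right_le_imp_le[rotated])
  qed
qed

lemma op_adj_in_trace_algebra: "T \<in> trace_algebra \<Longrightarrow> op_adj H T \<in> trace_algebra"
  using von_neumann_trace_algebra by (simp add: von_neumann_algebra_def)

lemma combine_in_trace_algebra:
  assumes "S \<in> trace_algebra" "T \<in> trace_algebra"
  shows "S \<oplus>\<^bsub>\<B> H\<^esub> (c \<odot>\<^bsub>\<B> H\<^esub> T) \<in> trace_algebra"
  using assms by (auto simp: trace_algebra_iff op_commute_iff op_add op_smult)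

text \<open>Polarising $\|T\Omega\| = \|T^*\Omega\|$ makes the vector state of \<open>\<Omega>\<close> tracial.\<close>

lemma trace_algebra_tracial:
  assumes S: "S \<in> trace_algebra" and T: "T \<in> trace_algebra"
  shows "hinner H (T \<Omega>) (S \<Omega>) = hinner H (op_adj H S \<Omega>) (op_adj H T \<Omega>)"
proof -
  have ops: "S \<in> ops" "T \<in> ops" using S T by (auto simp: trace_algebra_iff)
  have norm: "Re (hinner H (R \<Omega>) (R \<Omega>)) = Re (hinner H (op_adj H R \<Omega>) (op_adj H R \<Omega>))"
    if R: "R \<in> trace_algebra" for R
  proof -
    have "R \<in> ops" using R by (simp add: trace_algebra_iff)
    then have "hnorm H (R \<Omega>) = hnorm H (op_adj H R \<Omega>)"
      using trace_algebra_norm_le[OF R] trace_algebra_norm_le[OF op_adj_in_trace_algebra[OF R]] by simp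
    then show ?thesis by (simp add: hnorm_def)
  qed
  have pol: "Re (cnj c * hinner H (T \<Omega>) (S \<Omega>)) = Re (cnj c * hinner H (op_adj H S \<Omega>) (op_adj H T \<Omega>))" for c
  proof -
    define R where "R = T \<oplus>\<^bsub>\<B> H\<^esub> (c \<odot>\<^bsub>\<B> H\<^esub> S)"
    have R: "R \<in> trace_algebra" unfolding R_def by (rule combine_in_trace_algebra[OF T S])
    have adj: "op_adj H R = op_adj H T \<oplus>\<^bsub>\<B> H\<^esub> (cnj c \<odot>\<^bsub>\<B> H\<^esub> op_adj H S)"
      unfolding R_def using ops
      by (intro op_adj_eqI) (auto simp: hinner_linear hinner_op_adj_right)
    have "Re (hinner H (R \<Omega>) (R \<Omega>)) = Re (hinner H (T \<Omega>) (T \<Omega>)) + 2 * Re (cnj c * hinner H (T \<Omega>) (S \<Omega>))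
        + (cmod c)\<^sup>2 * Re (hinner H (S \<Omega>) (S \<Omega>))"
      using ops hinner_commute[of "S \<Omega>" "T \<Omega>"] hinner_self[of "S \<Omega>"]
      by (simp add: R_def hinner_linear cmod_power2) (simp add: algebra_simps power2_eq_square)
    moreover have "Re (hinner H (op_adj H R \<Omega>) (op_adj H R \<Omega>)) = Re (hinner H (op_adj H T \<Omega>) (op_adj H T \<Omega>))
        + 2 * Re (cnj c * hinner H (op_adj H S \<Omega>) (op_adj H T \<Omega>))
        + (cmod c)\<^sup>2 * Re (hinner H (op_adj H S \<Omega>) (op_adj H S \<Omega>))"
      using ops hinner_commute[of "op_adj H T \<Omega>" "op_adj H S \<Omega>"] hinner_self[of "op_adj H S \<Omega>"]
      by (simp add: adj hinner_linear cmod_power2) (simp add: algebra_simps power2_eq_square)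
    ultimately show ?thesis using norm[OF R] norm[OF S] norm[OF T] by simp
  qed
  show ?thesis using pol[of 1] pol[of \<i>] by (simp add: complex_eq_iff)
qed

lemma tracial_trace_algebra: "tracial_von_neumann_algebra H trace_algebra"
  unfolding tracial_von_neumann_algebra_def
proof (intro conjI exI[of _ "\<lambda>T. hinner H (T \<Omega>) \<Omega>"] von_neumann_trace_algebra)
  have ops: "T \<in> ops" if "T \<in> trace_algebra" for T using that by (simp add: trace_algebra_iff)
  show "tracial_state H trace_algebra (\<lambda>T. hinner H (T \<Omega>) \<Omega>)"
    unfolding tracial_state_def
  proof (intro conjI ballI allI)
    fix S T assume S: "S \<in> trace_algebra" and T: "T \<in> trace_algebra"
    show "hinner H ((S \<oplus>\<^bsub>\<B> H\<^esub> T) \<Omega>) \<Omega> = hinner H (S \<Omega>) \<Omega> + hinner H (T \<Omega>) \<Omega>"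
      using ops S T by (simp add: hinner_add)
    show "hinner H ((S \<otimes>\<^bsub>\<B> H\<^esub> T) \<Omega>) \<Omega> = hinner H ((T \<otimes>\<^bsub>\<B> H\<^esub> S) \<Omega>) \<Omega>"
      using trace_algebra_tracial[OF op_adj_in_trace_algebra[OF S] T] ops S T
      by (simp add: hinner_op_adj_right)
  next
    fix c T assume T: "T \<in> trace_algebra"
    show "hinner H ((c \<odot>\<^bsub>\<B> H\<^esub> T) \<Omega>) \<Omega> = c * hinner H (T \<Omega>) \<Omega>"
      using ops[OF T] by (simp add: hinner_smult)
  next
    fix T assume T: "T \<in> trace_algebra"
    show "hinner H ((op_adj H T \<otimes>\<^bsub>\<B> H\<^esub> T) \<Omega>) \<Omega> \<in> \<real>\<^sub>\<ge>\<^sub>0"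
      using ops[OF T] by (simp add: hinner_op_adj_left hinner_nonneg)
  next
    show "hinner H (\<one>\<^bsub>\<B> H\<^esub> \<Omega>) \<Omega> = 1"
      by (simp add: \<Omega>_def gram unit)
  qed
qed

text \<open>
  A linear relation between the products \<open>U\<^sub>p U\<^sub>q\<^sup>*\<close> holds for the big unitary as soon as it holds for
  the trace after multiplication by one more entry on either side.
\<close>

lemma big_unitary_relation:
  assumes rel: "\<And>r s w. (\<Sum>p\<in>UNIV. \<Sum>c\<in>UNIV. F p c *
      \<phi> ((r, (fst p, fst c)) # ((snd p, snd c), s) # w)) = 0"
    and vw: "v \<in> carrier H" "w \<in> carrier H"
  shows "(\<Sum>p\<in>UNIV. \<Sum>c\<in>UNIV. F p c *
      hinner H (big_unitary (fst c) (fst p) (op_adj H (big_unitary (snd c) (snd p)) v)) w) = 0"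
proof -
  define X where "X = (\<lambda>(p :: 'x \<times> 'x, c :: 'x \<times> 'x). F p c \<odot>\<^bsub>\<B> H\<^esub>
    (big_unitary (fst c) (fst p) \<otimes>\<^bsub>\<B> H\<^esub> op_adj H (big_unitary (snd c) (snd p))))"
  have X: "X i \<in> ops" for i by (auto simp: X_def split_beta)
  have "finsum (\<B> H) X UNIV = \<zero>\<^bsub>\<B> H\<^esub>"
  proof (rule op_gram_eqI)
    fix b0 u b1 u'
    have coeff: "hinner H (X (p, c) (g (b0, u))) (g (b1, u')) = (\<Sum>z\<in>UNIV. F p c *
          \<phi> (((b1, z), (fst p, fst c)) # ((snd p, snd c), (b0, z)) # u @ star u'))" for p c
    proof -
      have "hinner H (X (p, c) (g (b0, u))) (g (b1, u')) = F p c *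
          hinner H (op_adj H (big_unitary (snd c) (snd p)) (g (b0, u)))
            (op_adj H (big_unitary (fst c) (fst p)) (g (b1, u')))"
        by (simp add: X_def hinner_smult hinner_op_adj_right)
      then show ?thesis
        by (simp add: big_unitary_adj_gram cyclic[of "star u'"] sum_distrib_left)
    qed
    have "hinner H (finsum (\<B> H) X UNIV (g (b0, u))) (g (b1, u'))
        = (\<Sum>p\<in>UNIV. \<Sum>c\<in>UNIV. \<Sum>z\<in>UNIV. F p c *
          \<phi> (((b1, z), (fst p, fst c)) # ((snd p, snd c), (b0, z)) # u @ star u'))"
      using X by (simp add: hinner_op_finsum sum_UNIV_prod[of "\<lambda>k. hinner H (X k _) _"] coeff)
    also have "\<dots> = (\<Sum>z\<in>UNIV. \<Sum>p\<in>UNIV. \<Sum>c\<in>UNIV. F p c *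
          \<phi> (((b1, z), (fst p, fst c)) # ((snd p, snd c), (b0, z)) # u @ star u'))"
      by (subst sum.swap, rule sum.cong[OF refl], subst sum.swap[of _ UNIV UNIV], rule refl)
    also have "\<dots> = 0"
      using rel by simp
    finally show "hinner H (finsum (\<B> H) X UNIV (g (b0, u))) (g (b1, u'))
        = hinner H (\<zero>\<^bsub>\<B> H\<^esub> (g (b0, u))) (g (b1, u'))" by simp
  qed (auto simp: X op_finsum_closed)
  then have "hinner H (finsum (\<B> H) X UNIV v) w = 0" using vw by simp
  then show "(\<Sum>p\<in>UNIV. \<Sum>c\<in>UNIV. F p c *
      hinner H (big_unitary (fst c) (fst p) (op_adj H (big_unitary (snd c) (snd p)) v)) w) = 0"
  proof -
    have "hinner H (X (p, c) v) w = F p c *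
        hinner H (big_unitary (fst c) (fst p) (op_adj H (big_unitary (snd c) (snd p)) v)) w" for p c
      using vw by (simp add: X_def hinner_smult)
    then show ?thesis
      using \<open>hinner H (finsum (\<B> H) X UNIV v) w = 0\<close> X vw
      by (simp add: hinner_op_finsum sum_UNIV_prod[of "\<lambda>k. hinner H (X k v) w"])
  qed
qed

lemma op_intertwines_big_unitary:
  assumes "intertwines \<phi> \<U> \<V>"
  shows "op_intertwines H big_unitary \<U> \<V>"
  unfolding op_intertwines_def
  by (intro ballI big_unitary_relation) (use assms in \<open>auto simp: intertwines_def\<close>)

lemma op_intertwines_transposed_big_unitary:
  assumes "intertwines (transposed \<phi>) \<V> \<U>"
  shows "op_intertwines H (om_transpose big_unitary) \<V> \<U>"
  unfolding op_intertwines_def om_transpose_def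
proof (intro ballI)
  fix \<zeta> \<eta> v w assume \<zeta>: "\<zeta> \<in> \<V>" and \<eta>: "\<eta> \<in> perp \<U>" and vw: "v \<in> carrier H" "w \<in> carrier H"
  have "(\<Sum>p\<in>UNIV. \<Sum>c\<in>UNIV. (cnj (\<zeta> $ c) * \<eta> $ p) *
      hinner H (big_unitary (fst c) (fst p) (op_adj H (big_unitary (snd c) (snd p)) v)) w) = 0"
  proof (rule big_unitary_relation[OF _ vw])
    fix r s :: "'x \<times> 'x" and u
    have "(\<Sum>p\<in>UNIV. \<Sum>c\<in>UNIV. cnj (\<zeta> $ p) * \<eta> $ c * transposed \<phi> ((prod.swap r, (fst p, fst c)) #
        ((snd p, snd c), prod.swap s) # map (map_prod prod.swap prod.swap) u)) = 0"
      using assms \<zeta> \<eta> unfolding intertwines_def by blast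
    then have "(\<Sum>p\<in>UNIV. \<Sum>c\<in>UNIV. cnj (\<zeta> $ p) * \<eta> $ c *
        \<phi> ((r, (fst c, fst p)) # ((snd c, snd p), s) # u)) = 0"
      by (simp add: transposed_def comp_def map_prod_def split_beta)
    then show "(\<Sum>p\<in>UNIV. \<Sum>c\<in>UNIV. (cnj (\<zeta> $ c) * \<eta> $ p) *
        \<phi> ((r, (fst p, fst c)) # ((snd p, snd c), s) # u)) = 0"
      by (subst sum.swap)
  qed
  then show "(\<Sum>p\<in>UNIV. \<Sum>c\<in>UNIV. cnj (\<zeta> $ p) * \<eta> $ c *
      hinner H (big_unitary (fst p) (fst c) (op_adj H (big_unitary (snd p) (snd c)) v)) w) = 0"
    by (subst sum.swap)
qed

end

section \<open>Channels given by an array of coefficients\<close>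

lemma pos_kernel_factor:
  fixes K :: "'i::finite \<Rightarrow> 'i \<Rightarrow> complex"
  assumes "pos_kernel K"
  shows "\<exists>(G :: 'i \<Rightarrow> nat \<Rightarrow> complex) N. \<forall>i j. K i j = (\<Sum>n<N. G i n * cnj (G j n))"
proof -
  obtain G where G: "\<And>u v N. u < N \<Longrightarrow> kernel_on_nat K u v = (\<Sum>n<N. G u n * cnj (G v n))"
    by (rule Cholesky[OF pos_kernel_on_nat[OF assms]]) (rule that; assumption)
  obtain N where N: "\<And>i :: 'i. to_nat i < N"
    using finite_nat_set_iff_bounded[of "range (to_nat :: 'i \<Rightarrow> nat)"] by auto
  have "K i j = (\<Sum>n<N. G (to_nat i) n * cnj (G (to_nat j) n))" for i j
    using G[OF N, of i "to_nat j"] by simp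
  then show ?thesis by (intro exI allI)
qed

text \<open>
  The number \<open>\<kappa> p c p' c'\<close> is the entry at \<open>(c, c')\<close> of the image of the matrix unit at \<open>(p, p')\<close>.
\<close>

type_synonym 'x array = "'x \<times> 'x \<Rightarrow> 'x \<times> 'x \<Rightarrow> 'x \<times> 'x \<Rightarrow> 'x \<times> 'x \<Rightarrow> complex"

definition chan :: "('x::finite) array \<Rightarrow> 'x channel" where
  "chan \<kappa> \<omega> = (\<chi> c c'. \<Sum>p\<in>UNIV. \<Sum>p'\<in>UNIV. \<omega> $ p $ p' * \<kappa> p c p' c')"

lemma cinner_matrix: "cinner (A *v a) b = (\<Sum>i\<in>UNIV. \<Sum>j\<in>UNIV. A $ i $ j * a $ j * cnj (b $ i))"
  by (simp add: cinner_def matrix_vector_mult_def sum_distrib_right)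

lemma cinner_chan:
  "cinner (chan \<kappa> \<omega> *v a) b = (\<Sum>p\<in>UNIV. \<Sum>p'\<in>UNIV. \<omega> $ p $ p' *
     (\<Sum>c\<in>UNIV. \<Sum>c'\<in>UNIV. \<kappa> p c p' c' * a $ c' * cnj (b $ c)))"
proof -
  have "cinner (chan \<kappa> \<omega> *v a) b = (\<Sum>c\<in>UNIV. \<Sum>c'\<in>UNIV. \<Sum>p\<in>UNIV. \<Sum>p'\<in>UNIV.
      \<omega> $ p $ p' * (\<kappa> p c p' c' * a $ c' * cnj (b $ c)))"
    by (simp add: cinner_matrix chan_def sum_distrib_right mult.assoc)
  also have "\<dots> = (\<Sum>p\<in>UNIV. \<Sum>p'\<in>UNIV. \<Sum>c\<in>UNIV. \<Sum>c'\<in>UNIV.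
      \<omega> $ p $ p' * (\<kappa> p c p' c' * a $ c' * cnj (b $ c)))"
    by (rule sum_swap_pairs)
  finally show ?thesis by (simp add: sum_distrib_left)
qed

text \<open>Factorising the array exhibits a Kraus decomposition.\<close>

lemma completely_positive_chan:
  fixes \<kappa> :: "('x::finite) array"
  assumes "pos_kernel (\<lambda>(p', c') (p, c). \<kappa> p c p' c')"
  shows "completely_positive (chan \<kappa>)"
proof -
  define K where "K = (\<lambda>(p', c') (p, c). \<kappa> p c p' c')"
  obtain G and N :: nat where G: "\<forall>i j. K i j = (\<Sum>n<N. G i n * cnj (G j n))"
    using pos_kernel_factor[OF assms[folded K_def]] by (elim exE)
  have \<kappa>: "\<kappa> p c p' c' = (\<Sum>n<N. G (p', c') n * cnj (G (p, c) n))" for p c p' c'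
    using G[rule_format, of "(p', c')" "(p, c)"] by (simp add: K_def)
  define u where "u n a = (\<chi> p. \<Sum>c\<in>UNIV. G (p, c) n * a $ c)" for n and a :: "complex^('x \<times> 'x)"
  have kraus: "cinner (chan \<kappa> \<omega> *v a) b = (\<Sum>n<N. cinner (\<omega> *v u n a) (u n b))" for \<omega> a b
  proof -
    have "(\<Sum>c\<in>UNIV. \<Sum>c'\<in>UNIV. \<kappa> p c p' c' * a $ c' * cnj (b $ c))
        = (\<Sum>n<N. u n a $ p' * cnj (u n b $ p))" for p p'
    proof -
      have "(\<Sum>c\<in>UNIV. \<Sum>c'\<in>UNIV. \<kappa> p c p' c' * a $ c' * cnj (b $ c))
        = (\<Sum>c\<in>UNIV. \<Sum>c'\<in>UNIV. \<Sum>n<N. (G (p', c') n * a $ c') * (cnj (G (p, c) n) * cnj (b $ c)))"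
        by (simp add: \<kappa> sum_distrib_left sum_distrib_right mult_ac)
      also have "\<dots> = (\<Sum>n<N. \<Sum>c\<in>UNIV. \<Sum>c'\<in>UNIV. (G (p', c') n * a $ c') * (cnj (G (p, c) n) * cnj (b $ c)))"
        by (rule sum_rotate[symmetric])
      also have "\<dots> = (\<Sum>n<N. \<Sum>c'\<in>UNIV. \<Sum>c\<in>UNIV. (G (p', c') n * a $ c') * (cnj (G (p, c) n) * cnj (b $ c)))"
        by (rule sum.cong[OF refl], rule sum.swap)
      finally show ?thesis by (simp add: u_def sum_product)
    qed
    then have "cinner (chan \<kappa> \<omega> *v a) b
        = (\<Sum>p\<in>UNIV. \<Sum>p'\<in>UNIV. \<Sum>n<N. \<omega> $ p $ p' * u n a $ p' * cnj (u n b $ p))"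
      by (simp add: cinner_chan sum_distrib_left mult.assoc)
    also have "\<dots> = (\<Sum>n<N. \<Sum>p\<in>UNIV. \<Sum>p'\<in>UNIV. \<omega> $ p $ p' * u n a $ p' * cnj (u n b $ p))"
      by (rule sum_rotate[symmetric])
    finally show ?thesis by (simp add: cinner_matrix)
  qed
  show ?thesis
    unfolding completely_positive_def block_psd_def
  proof (intro allI impI)
    fix n and \<omega> :: "nat \<Rightarrow> nat \<Rightarrow> complex^('x \<times> 'x)^('x \<times> 'x)" and v
    assume psd: "\<forall>v. (\<Sum>i<n. \<Sum>j<n. cinner (\<omega> i j *v v j) (v i)) \<in> \<real>\<^sub>\<ge>\<^sub>0"
    have "(\<Sum>i<n. \<Sum>j<n. cinner (chan \<kappa> (\<omega> i j) *v v j) (v i))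
        = (\<Sum>k<N. \<Sum>i<n. \<Sum>j<n. cinner (\<omega> i j *v u k (v j)) (u k (v i)))"
      unfolding kraus
      by (rule sum_rotate[symmetric])
    also have "\<dots> \<in> \<real>\<^sub>\<ge>\<^sub>0"
    proof (rule sum_nonneg_Reals)
      fix k assume "k \<in> {..<N}"
      show "(\<Sum>i<n. \<Sum>j<n. cinner (\<omega> i j *v u k (v j)) (u k (v i))) \<in> \<real>\<^sub>\<ge>\<^sub>0"
        using psd[rule_format, of "\<lambda>i. u k (v i)"] .
    qed
    finally show "(\<Sum>i<n. \<Sum>j<n. cinner (chan \<kappa> (\<omega> i j) *v v j) (v i)) \<in> \<real>\<^sub>\<ge>\<^sub>0" .
  qed
qed

lemma QNS_chan:
  fixes \<kappa> :: "('x::finite) array"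
  assumes pos: "pos_kernel (\<lambda>(p', c') (p, c). \<kappa> p c p' c')"
    and total: "\<And>p p'. (\<Sum>c\<in>UNIV. \<kappa> p c p' c) = (if p = p' then 1 else 0)"
    and marginal1: "\<And>x y x' y' b b'. (\<Sum>a\<in>UNIV. \<kappa> (x, y) (a, b) (x', y') (a, b'))
      = (if x = x' then m1 y b y' b' else 0)"
    and marginal2: "\<And>x y x' y' a a'. (\<Sum>b\<in>UNIV. \<kappa> (x, y) (a, b) (x', y') (a', b))
      = (if y = y' then m2 x a x' a' else 0)"
  shows "QNS_correlation (chan \<kappa>)"
  unfolding QNS_correlation_def quantum_channel_def
proof (intro conjI allI impI completely_positive_chan pos)
  show "chan \<kappa> (A + B) = chan \<kappa> A + chan \<kappa> B" for A B
    by (simp add: chan_def vec_eq_iff distrib_right sum.distrib)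
  show "chan \<kappa> (mscale c A) = mscale c (chan \<kappa> A)" for c A
    by (simp add: chan_def vec_eq_iff mscale_def map_matrix_def sum_distrib_left mult.assoc)
  show "trace (chan \<kappa> A) = trace A" for A
  proof -
    have "trace (chan \<kappa> A) = (\<Sum>p\<in>UNIV. \<Sum>p'\<in>UNIV. A $ p $ p' * (\<Sum>c\<in>UNIV. \<kappa> p c p' c))"
      unfolding trace_def chan_def
      by (simp add: sum_distrib_left) (rule sum_rotate)
    then show ?thesis
      by (simp add: total trace_def if_distrib[of "\<lambda>x. _ * x"] cong: if_cong)
  qed
next
  fix \<rho>1 \<rho>2 :: "complex^'x^'x" assume tr: "trace \<rho>1 = 0"
  have "ptrace1 (chan \<kappa> (kron \<rho>1 \<rho>2)) $ b $ b' = 0" for b b'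
  proof -
    have "ptrace1 (chan \<kappa> (kron \<rho>1 \<rho>2)) $ b $ b' = (\<Sum>p\<in>UNIV. \<Sum>p'\<in>UNIV. kron \<rho>1 \<rho>2 $ p $ p' *
        (\<Sum>a\<in>UNIV. \<kappa> p (a, b) p' (a, b')))"
      unfolding ptrace1_def chan_def
      by (simp add: sum_distrib_left) (rule sum_rotate)
    also have "\<dots> = (\<Sum>x\<in>UNIV. \<Sum>y\<in>UNIV. \<Sum>x'\<in>UNIV. \<Sum>y'\<in>UNIV. if x = x' then \<rho>1 $ x $ x * (\<rho>2 $ y $ y' * m1 y b y' b') else 0)"
      unfolding sum_UNIV_prod kron_def marginal1 by (intro sum.cong refl) auto
    also have "\<dots> = (\<Sum>x\<in>UNIV. \<rho>1 $ x $ x * (\<Sum>y\<in>UNIV. \<Sum>y'\<in>UNIV. \<rho>2 $ y $ y' * m1 y b y' b'))"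
      by (simp add: sum_if_const sum_distrib_left)
    also have "\<dots> = 0" using tr by (simp add: trace_def flip: sum_distrib_right)
    finally show ?thesis .
  qed
  then show "ptrace1 (chan \<kappa> (kron \<rho>1 \<rho>2)) = 0" by (simp add: vec_eq_iff)
next
  fix \<rho>1 \<rho>2 :: "complex^'x^'x" assume tr: "trace \<rho>2 = 0"
  have "ptrace2 (chan \<kappa> (kron \<rho>1 \<rho>2)) $ a $ a' = 0" for a a'
  proof -
    have "ptrace2 (chan \<kappa> (kron \<rho>1 \<rho>2)) $ a $ a' = (\<Sum>p\<in>UNIV. \<Sum>p'\<in>UNIV. kron \<rho>1 \<rho>2 $ p $ p' *
        (\<Sum>b\<in>UNIV. \<kappa> p (a, b) p' (a', b)))"
      unfolding ptrace2_def chan_def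
      by (simp add: sum_distrib_left) (rule sum_rotate)
    also have "\<dots> = (\<Sum>x\<in>UNIV. \<Sum>y\<in>UNIV. \<Sum>x'\<in>UNIV. \<Sum>y'\<in>UNIV. if y = y' then \<rho>2 $ y $ y * (\<rho>1 $ x $ x' * m2 x a x' a') else 0)"
      unfolding sum_UNIV_prod kron_def marginal2 by (intro sum.cong refl) auto
    also have "\<dots> = (\<Sum>y\<in>UNIV. \<rho>2 $ y $ y * (\<Sum>x\<in>UNIV. \<Sum>x'\<in>UNIV. \<rho>1 $ x $ x' * m2 x a x' a'))"
      by (subst sum.swap) (simp add: sum_distrib_left)
    also have "\<dots> = 0" using tr by (simp add: trace_def flip: sum_distrib_right)
    finally show ?thesis .
  qed
  then show "ptrace2 (chan \<kappa> (kron \<rho>1 \<rho>2)) = 0" by (simp add: vec_eq_iff)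
qed

lemma trace_mult_transpose: "trace (A ** transpose B) = (\<Sum>i\<in>UNIV. \<Sum>j\<in>UNIV. A $ i $ j * B $ i $ j)"
  by (simp add: trace_def matrix_matrix_mult_def transpose_def)

lemma trace_mult_transpose_munit:
  fixes A :: "complex^'n^'n"
  shows "trace (A ** transpose (munit i j)) = A $ i $ j"
proof -
  have "trace (A ** transpose (munit i j)) = (\<Sum>k\<in>UNIV. \<Sum>l\<in>UNIV. if l = j then if k = i then A $ k $ l else 0 else 0)"
    unfolding trace_mult_transpose munit_def by (intro sum.cong refl) auto
  then show ?thesis by simp
qed

text \<open>
  Testing against matrix units shows that the dual is unique. It has the same array with inputs and
  outputs exchanged.
\<close>

lemma dual_chan: "dual_map (chan \<kappa>) = chan (\<lambda>p c p' c'. \<kappa> c p c' p')"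
  unfolding dual_map_def
proof (rule the_equality, intro allI)
  let ?\<Phi> = "chan (\<lambda>p c p' c'. \<kappa> c p c' p')"
  show pair: "trace (?\<Phi> \<omega> ** transpose \<rho>) = trace (\<omega> ** transpose (chan \<kappa> \<rho>))" for \<omega> \<rho>
  proof -
    have "trace (?\<Phi> \<omega> ** transpose \<rho>)
        = (\<Sum>p\<in>UNIV. \<Sum>p'\<in>UNIV. \<Sum>c\<in>UNIV. \<Sum>c'\<in>UNIV. \<omega> $ c $ c' * (\<rho> $ p $ p' * \<kappa> p c p' c'))"
      by (simp add: trace_mult_transpose chan_def sum_distrib_right sum_distrib_left mult_ac)
    also have "\<dots> = (\<Sum>c\<in>UNIV. \<Sum>c'\<in>UNIV. \<Sum>p\<in>UNIV. \<Sum>p'\<in>UNIV. \<omega> $ c $ c' * (\<rho> $ p $ p' * \<kappa> p c p' c'))"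
      by (rule sum_swap_pairs)
    also have "\<dots> = trace (\<omega> ** transpose (chan \<kappa> \<rho>))"
      by (simp add: trace_mult_transpose chan_def sum_distrib_left)
    finally show ?thesis .
  qed
  fix \<Phi> assume \<Phi>: "\<forall>\<omega> \<rho>. trace (\<Phi> \<omega> ** transpose \<rho>) = trace (\<omega> ** transpose (chan \<kappa> \<rho>))"
  have "\<Phi> \<omega> $ i $ j = ?\<Phi> \<omega> $ i $ j" for \<omega> i j
    using \<Phi>[rule_format, of \<omega> "munit i j"] pair[of \<omega> "munit i j"]
    by (simp add: trace_mult_transpose_munit)
  then show "\<Phi> = ?\<Phi>" by (simp add: fun_eq_iff vec_eq_iff)
qed

lemma chan_munit: "chan \<kappa> (munit p p') $ c $ c' = \<kappa> p c p' c'"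
proof -
  have "chan \<kappa> (munit p p') $ c $ c' = (\<Sum>k\<in>UNIV. \<Sum>l\<in>UNIV. (if k = p \<and> l = p' then 1 else 0) * \<kappa> k c l c')"
    by (simp add: chan_def munit_def)
  also have "\<dots> = (\<Sum>k\<in>UNIV. \<Sum>l\<in>UNIV. if l = p' then if k = p then \<kappa> k c l c' else 0 else 0)"
    by (intro sum.cong refl) auto
  finally have "chan \<kappa> (munit p p') $ c $ c' = \<dots>" .
  then show ?thesis by simp
qed

lemma kron_munit: "kron (munit x x') (munit y y') = munit (x, y) (x', y')"
  by (auto simp: kron_def munit_def vec_eq_iff)

lemma matrix_sum_munit:
  fixes f :: "'x::finite \<Rightarrow> 'x \<Rightarrow> 'x \<Rightarrow> 'x \<Rightarrow> complex"
  shows "(\<Sum>a\<in>UNIV. \<Sum>a'\<in>UNIV. \<Sum>b\<in>UNIV. \<Sum>b'\<in>UNIV. mscale (f a a' b b') (kron (munit a a') (munit b b')))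
    = (\<chi> c c'. f (fst c) (fst c') (snd c) (snd c'))"
proof -
  have "(\<Sum>a\<in>UNIV. \<Sum>a'\<in>UNIV. \<Sum>b\<in>UNIV. \<Sum>b'\<in>UNIV. mscale (f a a' b b') (kron (munit a a') (munit b b'))) $ c $ c'
    = (\<Sum>a\<in>UNIV. \<Sum>a'\<in>UNIV. \<Sum>b\<in>UNIV. \<Sum>b'\<in>UNIV. if b' = snd c' then if b = snd c then
        if a' = fst c' then if a = fst c then f a a' b b' else 0 else 0 else 0 else 0)" for c c'
    unfolding sum_component kron_munit
    by (intro sum.cong refl) (auto simp: mscale_def map_matrix_def munit_def)
  then show ?thesis by (simp add: vec_eq_iff sum_if_const)
qed

lemma J_mat_entry: "J_mat $ p $ q = (if fst p = snd p \<and> fst q = snd q then 1 / of_nat CARD('x) else 0)"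
  for p q :: "'x::finite \<times> 'x"
proof -
  have "(\<Sum>x\<in>UNIV. \<Sum>y\<in>UNIV. kron (munit x y) (munit x y)) $ p $ q
    = (\<Sum>x\<in>UNIV. \<Sum>y\<in>UNIV. if y = fst q then if x = fst p then if fst p = snd p \<and> fst q = snd q then 1 else 0 else 0 else (0 :: complex))"
    unfolding sum_component kron_munit
    by (intro sum.cong refl) (auto simp: munit_def, (cases p; cases q; auto)+)
  then show ?thesis by (simp add: J_mat_def mscale_def map_matrix_def)
qed

lemma chan_J_mat:
  fixes \<kappa> :: "('x::finite) array"
  shows "chan \<kappa> J_mat $ c $ c' = 1 / of_nat CARD('x) * (\<Sum>x\<in>UNIV. \<Sum>y\<in>UNIV. \<kappa> (x, x) c (y, y) c')"
proof -
  let ?n = "1 / of_nat CARD('x) :: complex"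
  have "chan \<kappa> J_mat $ c $ c' = (\<Sum>x\<in>UNIV. \<Sum>y\<in>UNIV. \<Sum>x'\<in>UNIV. \<Sum>y'\<in>UNIV.
      if y' = x' then if x = y then ?n * \<kappa> (x, x) c (x', x') c' else 0 else 0)"
    unfolding chan_def sum_UNIV_prod vec_lambda_beta J_mat_entry by (intro sum.cong refl) auto
  then show ?thesis by (simp add: sum_if_const sum_distrib_left)
qed

lemma ctranspose_entry: "ctranspose A $ i $ j = cnj (A $ j $ i)"
  by (simp add: ctranspose_def map_matrix_def transpose_def)

lemma ctranspose_ctranspose: "ctranspose (ctranspose A) = A"
  by (simp add: vec_eq_iff ctranspose_entry)

lemma ctranspose_mult: "ctranspose (A ** B) = ctranspose B ** ctranspose A"
  by (simp add: vec_eq_iff ctranspose_entry matrix_matrix_mult_def mult.commute)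

lemma matrix_diff_ldistrib: "A ** (B - C) = A ** B - A ** (C :: complex^'n^'n)"
  by (simp add: matrix_matrix_mult_def vec_eq_iff right_diff_distrib sum_subtractf)

section \<open>The channel of a trace\<close>

lemma pos_kernel_inj:
  fixes h :: "'i \<Rightarrow> 'j"
  assumes K: "pos_kernel K" and h: "inj h"
  shows "pos_kernel (\<lambda>i j. K (h i) (h j))"
  unfolding pos_kernel_def
proof (intro allI impI)
  fix A :: "'i set" and c assume A: "finite A"
  have "(\<Sum>i\<in>h ` A. \<Sum>j\<in>h ` A. c (inv_into UNIV h i) * cnj (c (inv_into UNIV h j)) * K i j)
      = (\<Sum>i\<in>A. \<Sum>j\<in>A. c i * cnj (c j) * K (h i) (h j))"
    using h by (simp add: sum.reindex inj_on_subset)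
  then show "(\<Sum>i\<in>A. \<Sum>j\<in>A. c i * cnj (c j) * K (h i) (h j)) \<in> \<real>\<^sub>\<ge>\<^sub>0"
    using pos_kernelD[OF K, of "h ` A" "\<lambda>i. c (inv_into UNIV h i)"] A by simp
qed

context biunitary_trace
begin

text \<open>
  Transposing exchanges the two summation rules, and the two contraction rules.
\<close>

lemma biunitary_trace_transposed: "biunitary_trace (transposed \<phi>)"
proof
  let ?f = "map (map_prod prod.swap prod.swap) :: 'x letter list \<Rightarrow> _"
  have star: "?f (star w) = star (?f w)" for w
    by (simp add: star_def rev_map comp_def map_prod_def split_beta)
  have "inj ?f" by (intro inj_mapI prod.inj_map inj_swap)
  from pos_kernel_inj[OF positive this]
  show "pos_kernel (\<lambda>w v. transposed \<phi> (star v @ w))"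
    by (simp add: transposed_def star)
  fix p q :: "'x \<times> 'x" and x a x' a' v w
  show "transposed \<phi> (v @ w) = transposed \<phi> (w @ v)"
    using cyclic by (simp add: transposed_def)
  show "transposed \<phi> [] = 1" by (simp add: transposed_def unit)
  show "(\<Sum>a\<in>UNIV. transposed \<phi> (((x, a), (x', a)) # w)) = (if x = x' then transposed \<phi> w else 0)"
    by (simp add: transposed_def sum_input)
  show "(\<Sum>x\<in>UNIV. transposed \<phi> (((x, a), (x, a')) # w)) = (if a = a' then transposed \<phi> w else 0)"
    by (simp add: transposed_def sum_output)
  show "(\<Sum>x\<in>UNIV. transposed \<phi> ((p, (x, a)) # ((x, a'), q) # w))
      = (if a = a' then transposed \<phi> ((p, q) # w) else 0)"
    by (simp add: transposed_def contract_output)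
  show "(\<Sum>a\<in>UNIV. transposed \<phi> ((p, (x, a)) # ((x', a), q) # w))
      = (if x = x' then transposed \<phi> ((p, q) # w) else 0)"
    by (simp add: transposed_def contract_input)
qed

definition coeff :: "'x array" where
  "coeff p c p' c' = \<phi> [((fst p, fst c), (fst p', fst c')), ((snd p', snd c'), (snd p, snd c))]"

text \<open>
  With \<open>E\<^sub>p\<^sub>q = U\<^sub>p\<^sup>* U\<^sub>q\<close> the coefficients are, up to the factor $n^2$, inner products of the
  vectors \<open>E\<^sub>r\<^sub>p E\<^sub>q\<^sub>s \<xi>\<close> summed over \<open>r\<close> and \<open>s\<close>, because
  $\sum_r E_{pr}E_{rq} = n E_{pq}$.
\<close>

lemma coeff_gram:
  "of_nat (CARD('x) * CARD('x)) * coeff p c p' c'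
    = (\<Sum>r\<in>UNIV. \<Sum>s\<in>UNIV. \<phi> (star [(r, (fst p, fst c)), ((snd p, snd c), s)] @
        [(r, (fst p', fst c')), ((snd p', snd c'), s)]))"
proof -
  let ?u = "(fst p, fst c)" and ?v = "(snd p, snd c)" and ?u' = "(fst p', fst c')" and ?v' = "(snd p', snd c')"
  have r: "(\<Sum>r\<in>UNIV. \<phi> ((s, ?v) # (?u, r) # (r, ?u') # [(?v', s)]))
      = of_nat (CARD('x)) * \<phi> ((s, ?v) # (?u, ?u') # [(?v', s)])" for s
    using contract_input_mid[of "[(s, ?v)]" ?u _ _ ?u' "[(?v', s)]"]
    by (simp add: sum_UNIV_prod sum.swap[of _ "UNIV :: 'x set" "UNIV :: 'x set"])
  have s: "(\<Sum>s\<in>UNIV. \<phi> ((s, ?v) # (?u, ?u') # [(?v', s)])) = of_nat (CARD('x)) * coeff p c p' c'"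
  proof -
    have "\<phi> ((s, ?v) # (?u, ?u') # [(?v', s)]) = \<phi> ([(?u, ?u')] @ (?v', s) # (s, ?v) # [])" for s
      using cyclic[of "[(s, ?v)]" "[(?u, ?u'), (?v', s)]"] by simp
    then show ?thesis
      using contract_input_mid[of "[(?u, ?u')]" ?v' _ _ ?v "[]"]
      by (simp add: sum_UNIV_prod sum.swap[of _ "UNIV :: 'x set" "UNIV :: 'x set"] coeff_def)
  qed
  have "(\<Sum>r\<in>UNIV. \<Sum>s\<in>UNIV. \<phi> (star [(r, ?u), (?v, s)] @ [(r, ?u'), (?v', s)]))
      = (\<Sum>s\<in>UNIV. \<Sum>r\<in>UNIV. \<phi> ((s, ?v) # (?u, r) # (r, ?u') # [(?v', s)]))"
    by (subst sum.swap) simp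
  then show ?thesis by (simp add: r s flip: sum_distrib_left)
qed

lemma coeff_positive: "pos_kernel (\<lambda>(p', c') (p, c). coeff p c p' c')"
  unfolding pos_kernel_def
proof (intro allI impI)
  fix A :: "(('x \<times> 'x) \<times> ('x \<times> 'x)) set" and t
  assume A: "finite A"
  define n where "n = real (CARD('x) * CARD('x))"
  have n: "n > 0" by (simp add: n_def)
  define e where "e = (\<lambda>r s (p :: 'x \<times> 'x, c :: 'x \<times> 'x). [(r, (fst p, fst c)), ((snd p, snd c), s)])"
    for r s :: "'x \<times> 'x"
  have inj: "inj (e r s)" for r s by (auto simp: inj_on_def e_def prod_eq_iff)
  have K: "of_real n * (case i of (p', c') \<Rightarrow> \<lambda>(p, c). coeff p c p' c') j
      = (\<Sum>r\<in>UNIV. \<Sum>s\<in>UNIV. \<phi> (star (e r s j) @ e r s i))" for i j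
    unfolding n_def by (cases i; cases j) (simp only: prod.case e_def coeff_gram of_real_of_nat_eq)
  define S where "S = (\<Sum>i\<in>A. \<Sum>j\<in>A. t i * cnj (t j) * (case i of (p', c') \<Rightarrow> \<lambda>(p, c). coeff p c p' c') j)"
  have "of_real n * S = (\<Sum>i\<in>A. \<Sum>j\<in>A. \<Sum>r\<in>UNIV. \<Sum>s\<in>UNIV. t i * cnj (t j) * \<phi> (star (e r s j) @ e r s i))"
    unfolding S_def sum_distrib_left mult.left_commute[of "of_real n"] K by (simp add: sum_distrib_left)
  also have "\<dots> = (\<Sum>r\<in>UNIV. \<Sum>s\<in>UNIV. \<Sum>i\<in>A. \<Sum>j\<in>A. t i * cnj (t j) * \<phi> (star (e r s j) @ e r s i))"
    by (rule sum_swap_pairs)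
  also have "\<dots> \<in> \<real>\<^sub>\<ge>\<^sub>0"
    by (intro sum_nonneg_Reals pos_kernelD[OF pos_kernel_inj[OF positive inj] A])
  finally have nS: "of_real n * S \<in> \<real>\<^sub>\<ge>\<^sub>0" .
  have "S = of_real (1 / n) * (of_real n * S)" using n by simp
  also have "\<dots> \<in> \<real>\<^sub>\<ge>\<^sub>0" by (rule nonneg_Reals_mult_I[OF _ nS]) (use n in simp)
  finally show "S \<in> \<real>\<^sub>\<ge>\<^sub>0" .
qed

lemma coeff_marginal1:
  "(\<Sum>a\<in>UNIV. coeff (x, y) (a, b) (x', y') (a, b'))
    = (if x = x' then \<phi> [((y', b'), (y, b))] else 0)"
  using sum_output[of x x' "[((y', b'), (y, b))]"] by (simp add: coeff_def)

lemma coeff_marginal2: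
  "(\<Sum>b\<in>UNIV. coeff (x, y) (a, b) (x', y') (a', b))
    = (if y = y' then \<phi> [((x, a), (x', a'))] else 0)"
  using sum_output_mid[of "[((x, a), (x', a'))]" y' y "[]"] by (auto simp: coeff_def)

lemma coeff_total: "(\<Sum>c\<in>UNIV. coeff p c p' c) = (if p = p' then 1 else 0)"
proof -
  obtain x y x' y' where p: "p = (x, y)" "p' = (x', y')" by (cases p; cases p') auto
  have "(\<Sum>c\<in>UNIV. coeff p c p' c) = (\<Sum>a\<in>UNIV. \<Sum>b\<in>UNIV. coeff (x, y) (a, b) (x', y') (a, b))"
    by (simp add: sum_UNIV_prod p)
  also have "\<dots> = (if y = y' then \<Sum>a\<in>UNIV. \<phi> [((x, a), (x', a))] else 0)"
    unfolding coeff_marginal2 by simp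
  also have "\<dots> = (if p = p' then 1 else 0)"
    using sum_output[of x x' "[]"] by (auto simp: p unit)
  finally show ?thesis .
qed

lemma QNS_chan_coeff: "QNS_correlation (chan coeff)"
  by (rule QNS_chan[OF coeff_positive coeff_total coeff_marginal1 coeff_marginal2])

end

lemma coeff_transposed: "biunitary_trace.coeff (transposed \<phi>) c p c' p' = biunitary_trace.coeff \<phi> p c p' c'"
  if "biunitary_trace \<phi>"
  using that by (simp add: biunitary_trace.coeff_def biunitary_trace.biunitary_trace_transposed transposed_def)

context biunitary_trace
begin

lemma dual_chan_coeff: "dual_map (chan coeff) = chan (biunitary_trace.coeff (transposed \<phi>))"
proof -
  have "biunitary_trace.coeff (transposed \<phi>) = (\<lambda>p c p' c'. coeff c p c' p')"
    by (intro ext coeff_transposed[OF biunitary_trace_axioms])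
  then show ?thesis by (simp add: dual_chan)
qed

lemma chan_coeff_unital: "chan coeff (mat 1) = mat 1"
proof -
  interpret T: biunitary_trace "transposed \<phi>" by (rule biunitary_trace_transposed)
  have "chan coeff (mat 1) $ c $ c' = (\<Sum>p\<in>UNIV. coeff p c p c')" for c c'
    by (simp add: chan_def mat_def if_distrib[of "\<lambda>x. x * _"] cong: if_cong)
  also have "\<dots> c c' = (if c = c' then 1 else 0)" for c c'
    using T.coeff_total[of c c'] by (simp add: coeff_transposed[OF biunitary_trace_axioms])
  finally show ?thesis by (simp add: vec_eq_iff mat_def)
qed

lemma QNS_bicorrelation_chan_coeff: "QNS_bicorrelation (chan coeff)"
  unfolding QNS_bicorrelation_def dual_chan_coeff
  by (intro conjI QNS_chan_coeff chan_coeff_unital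
      biunitary_trace.QNS_chan_coeff biunitary_trace_transposed)

lemma concurrent_chan_coeff: "concurrent (chan coeff)"
proof -
  have "chan coeff J_mat $ (a, b) $ (a', b') = J_mat $ (a, b) $ (a', b')" for a b a' b'
  proof -
    have "(\<Sum>y\<in>UNIV. coeff (x, x) (a, b) (y, y) (a', b')) = (if a' = b' then \<phi> [((x, a), (x, b))] else 0)" for x
      using contract_input[of "(x, a)" a' b' "(x, b)" "[]"] by (simp add: coeff_def)
    then show ?thesis
      using sum_input[of a b "[]"] by (auto simp: chan_J_mat J_mat_entry unit sum_if_const)
  qed
  then show ?thesis by (simp add: concurrent_def vec_eq_iff split_paired_all)
qed

text \<open>
  The vectors whose Gram matrix is the array satisfy the intertwining relation one by one.
\<close>

lemma coeff_annihilated: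
  assumes inter: "intertwines \<phi> \<U> \<V>" and \<zeta>: "\<zeta> \<in> \<U>" and \<eta>: "\<eta> \<in> perp \<V>"
  shows "(\<Sum>p'\<in>UNIV. \<Sum>c'\<in>UNIV. cnj (\<zeta> $ p') * \<eta> $ c' * coeff p c p' c') = 0"
proof -
  let ?u = "(fst p, fst c)" and ?v = "(snd p, snd c)"
  have zero: "(\<Sum>p'\<in>UNIV. \<Sum>c'\<in>UNIV. cnj (\<zeta> $ p') * \<eta> $ c' *
      \<phi> (star [(r, ?u), (?v, s)] @ [(r, (fst p', fst c')), ((snd p', snd c'), s)])) = 0" for r s
    using inter[unfolded intertwines_def, rule_format, OF \<zeta> \<eta>, of r s "star [(r, ?u), (?v, s)]"]
    unfolding cyclic[of "star [(r, ?u), (?v, s)]"] by simp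
  have "of_nat (CARD('x) * CARD('x)) * (\<Sum>p'\<in>UNIV. \<Sum>c'\<in>UNIV. cnj (\<zeta> $ p') * \<eta> $ c' * coeff p c p' c')
      = (\<Sum>p'\<in>UNIV. \<Sum>c'\<in>UNIV. \<Sum>r\<in>UNIV. \<Sum>s\<in>UNIV. cnj (\<zeta> $ p') * \<eta> $ c' *
      \<phi> (star [(r, ?u), (?v, s)] @ [(r, (fst p', fst c')), ((snd p', snd c'), s)]))"
    unfolding sum_distrib_left mult.left_commute[of "of_nat _"] coeff_gram ..
  also have "\<dots> = (\<Sum>r\<in>UNIV. \<Sum>s\<in>UNIV. \<Sum>p'\<in>UNIV. \<Sum>c'\<in>UNIV. cnj (\<zeta> $ p') * \<eta> $ c' *
      \<phi> (star [(r, ?u), (?v, s)] @ [(r, (fst p', fst c')), ((snd p', snd c'), s)]))"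
    by (rule sum_swap_pairs)
  also have "\<dots> = 0" by (simp only: zero sum.neutral_const)
  finally show ?thesis by simp
qed

lemma coeff_hermitian: "coeff p' c' p c = cnj (coeff p c p' c')"
  using pos_kernel_hermitian[OF coeff_positive, of "(p, c)" "(p', c')"] by simp

text \<open>
  The rows of \<open>\<omega>\<close> are combinations of conjugates of elements of \<open>\<U>\<close>, and these are sent to rows that
  are orthogonal to the complement of \<open>\<V>\<close>. The statement for columns follows by
  taking adjoints.
\<close>

lemma chan_coeff_absorbs:
  assumes \<U>: "vec.subspace \<U>" and \<V>: "vec.subspace \<V>" and inter: "intertwines \<phi> \<U> \<V>"
    and \<omega>: "\<omega> ** orth_proj \<U> = \<omega>"
  shows "chan coeff \<omega> ** orth_proj \<V> = chan coeff \<omega>"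
proof -
  define \<zeta> where "\<zeta> q = (\<chi> i. orth_proj \<U> $ i $ q)" for q
  define \<eta> where "\<eta> d = (\<chi> i. (mat 1 - orth_proj \<V>) $ i $ d)" for d
  have \<zeta>: "\<zeta> q \<in> \<U>" and \<eta>: "\<eta> d \<in> perp \<V>" for q d
    unfolding \<zeta>_def \<eta>_def by (rule column_orth_proj[OF \<U>], rule column_orth_proj_compl[OF \<V>])
  have row: "\<omega> $ p $ p' = (\<Sum>q\<in>UNIV. \<omega> $ p $ q * cnj (\<zeta> q $ p'))" for p p'
    using arg_cong[OF \<omega>, of "\<lambda>A. A $ p $ p'"]
    by (simp add: matrix_matrix_mult_def \<zeta>_def cnj_orth_proj[OF \<U>])
  have "(\<Sum>c'\<in>UNIV. chan coeff \<omega> $ c $ c' * \<eta> d $ c') = 0" for c d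
  proof -
    have "(\<Sum>c'\<in>UNIV. chan coeff \<omega> $ c $ c' * \<eta> d $ c') = (\<Sum>c'\<in>UNIV. \<Sum>p\<in>UNIV. \<Sum>p'\<in>UNIV.
        (\<Sum>q\<in>UNIV. \<omega> $ p $ q * cnj (\<zeta> q $ p')) * coeff p c p' c' * \<eta> d $ c')"
      by (simp only: chan_def vec_lambda_beta row[symmetric] sum_distrib_right)
    also have "\<dots> = (\<Sum>c'\<in>UNIV. \<Sum>p\<in>UNIV. \<Sum>p'\<in>UNIV. \<Sum>q\<in>UNIV.
        \<omega> $ p $ q * (cnj (\<zeta> q $ p') * \<eta> d $ c' * coeff p c p' c'))"
      by (simp add: sum_distrib_left sum_distrib_right mult_ac)
    also have "\<dots> = (\<Sum>p\<in>UNIV. \<Sum>p'\<in>UNIV. \<Sum>c'\<in>UNIV. \<Sum>q\<in>UNIV.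
        \<omega> $ p $ q * (cnj (\<zeta> q $ p') * \<eta> d $ c' * coeff p c p' c'))"
      by (rule sum_rotate)
    also have "\<dots> = (\<Sum>p\<in>UNIV. \<Sum>q\<in>UNIV. \<Sum>p'\<in>UNIV. \<Sum>c'\<in>UNIV.
        \<omega> $ p $ q * (cnj (\<zeta> q $ p') * \<eta> d $ c' * coeff p c p' c'))"
      by (rule sum.cong[OF refl], rule sum_rotate[symmetric])
    also have "\<dots> = 0"
      by (simp add: coeff_annihilated[OF inter \<zeta> \<eta>] flip: sum_distrib_left)
    finally show ?thesis .
  qed
  then have "chan coeff \<omega> ** (mat 1 - orth_proj \<V>) = 0"
    by (simp add: matrix_matrix_mult_def vec_eq_iff \<eta>_def)
  then show ?thesis by (simp add: matrix_diff_ldistrib)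
qed

lemma chan_coeff_ctranspose: "chan coeff (ctranspose \<omega>) = ctranspose (chan coeff \<omega>)"
proof -
  have "ctranspose (chan coeff \<omega>) $ c $ c' = chan coeff (ctranspose \<omega>) $ c $ c'" for c c'
  proof -
    have "ctranspose (chan coeff \<omega>) $ c $ c' = (\<Sum>p\<in>UNIV. \<Sum>p'\<in>UNIV. cnj (\<omega> $ p $ p') * coeff p' c p c')"
      by (simp add: ctranspose_entry chan_def flip: coeff_hermitian)
    also have "\<dots> = chan coeff (ctranspose \<omega>) $ c $ c'"
      by (subst sum.swap) (simp add: chan_def ctranspose_entry)
    finally show ?thesis .
  qed
  then show ?thesis by (simp add: vec_eq_iff)
qed

lemma perfect_strategy_chan_coeff:
  assumes \<U>: "vec.subspace \<U>" and \<V>: "vec.subspace \<V>" and inter: "intertwines \<phi> \<U> \<V>"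
  shows "perfect_strategy (chan coeff) \<U> \<V>"
  unfolding perfect_strategy_def
proof (intro allI impI)
  fix \<omega> :: "complex^('x \<times> 'x)^('x \<times> 'x)"
  let ?P = "orth_proj \<U>" and ?Q = "orth_proj \<V>" and ?X = "chan coeff \<omega>"
  assume \<omega>: "\<omega> = ?P ** \<omega> ** ?P"
  have \<omega>r: "\<omega> ** ?P = \<omega>"
    by (subst (1 2) \<omega>) (simp add: orth_proj_idem[OF \<U>] flip: matrix_mul_assoc)
  have \<omega>l: "?P ** \<omega> = \<omega>"
    by (subst (1 2) \<omega>) (simp add: matrix_mul_assoc orth_proj_idem[OF \<U>])
  have "ctranspose \<omega> ** ?P = ctranspose \<omega>"
    using arg_cong[OF \<omega>l, of ctranspose] by (simp add: ctranspose_mult orth_proj_hermitian[OF \<U>])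
  then have "ctranspose ?X ** ?Q = ctranspose ?X"
    using chan_coeff_absorbs[OF \<U> \<V> inter] chan_coeff_ctranspose by metis
  from arg_cong[OF this, of ctranspose] have "?Q ** ?X = ?X"
    by (simp add: ctranspose_mult ctranspose_ctranspose orth_proj_hermitian[OF \<V>])
  then show "?X = ?Q ** ?X ** ?Q"
    using chan_coeff_absorbs[OF \<U> \<V> inter \<omega>r] by simp
qed

end

text \<open>
  Up to the factor \<open>n\<close> the operator matrix is the square of a self-adjoint one.
\<close>

lemma om_positive_reproducing:
  fixes H :: "'h hilbert" and T :: "('i::finite, 'h) opmat"
  assumes H: "hilbert_space H"
    and T: "\<And>p q. T p q \<in> carrier (\<B> H)" and adj: "\<And>p q. op_adj H (T p q) = T q p"
    and mult: "\<And>p q v w. v \<in> carrier H \<Longrightarrow> w \<in> carrier H \<Longrightarrow>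
      (\<Sum>r\<in>UNIV. hinner H (T p r (T r q v)) w) = of_nat n * hinner H (T p q v) w" and n: "n > 0"
  shows "om_positive H T"
proof -
  interpret hilbert_space H by (rule H)
  show ?thesis
    unfolding om_positive_def
  proof (intro conjI allI impI)
    show "T \<in> opmats H" using T by (simp add: opmats_def)
    fix v :: "'i \<Rightarrow> 'h" assume v: "\<forall>i. v i \<in> carrier H"
    define S where "S = (\<Sum>p\<in>UNIV. \<Sum>q\<in>UNIV. hinner H (T p q (v q)) (v p))"
    define u where "u r = finsum H (\<lambda>q. T r q (v q)) UNIV" for r
    have u: "u r \<in> carrier H" for r unfolding u_def using T v by (intro finsum_in) auto
    have inner: "hinner H (u r) (u r) = (\<Sum>p\<in>UNIV. \<Sum>q\<in>UNIV. hinner H (T p r (T r q (v q))) (v p))" for r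
    proof -
      have "hinner H (u r) (u r) = (\<Sum>p\<in>UNIV. \<Sum>q\<in>UNIV. hinner H (T r q (v q)) (T r p (v p)))"
        unfolding u_def using T v finsum_in
        by (simp add: hinner_finsum_left hinner_finsum_right)
      then show ?thesis using T v by (simp add: adj hinner_op_adj_left[symmetric])
    qed
    have "of_nat n * S = (\<Sum>p\<in>UNIV. \<Sum>q\<in>UNIV. \<Sum>r\<in>UNIV. hinner H (T p r (T r q (v q))) (v p))"
      using v by (simp add: S_def mult sum_distrib_left)
    also have "\<dots> = (\<Sum>r\<in>UNIV. hinner H (u r) (u r))"
      unfolding inner by (subst (2) sum.swap, rule sum.cong[OF refl], rule sum.swap)
    also have "\<dots> \<in> \<real>\<^sub>\<ge>\<^sub>0" using u by (intro sum_nonneg_Reals hinner_nonneg)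
    finally have nS: "of_nat n * S \<in> \<real>\<^sub>\<ge>\<^sub>0" .
    have "S = of_real (1 / real n) * (of_nat n * S)" using n by simp
    also have "\<dots> \<in> \<real>\<^sub>\<ge>\<^sub>0" by (rule nonneg_Reals_mult_I[OF _ nS]) (use n in simp)
    finally show "(\<Sum>p\<in>UNIV. \<Sum>q\<in>UNIV. hinner H (T p q (v q)) (v p)) \<in> \<real>\<^sub>\<ge>\<^sub>0"
      unfolding S_def .
  qed
qed

context trace_space
begin

lemma reproducing_index: "(\<Sum>r\<in>UNIV. \<phi> (u @ (p, r) # (r, q) # w)) = of_nat CARD('x) * \<phi> (u @ (p, q) # w)"
proof -
  have "(\<Sum>r\<in>UNIV. \<phi> (u @ (p, r) # (r, q) # w)) = (\<Sum>a\<in>UNIV. \<Sum>x\<in>UNIV. \<phi> (u @ (p, (x, a)) # ((x, a), q) # w))"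
    unfolding sum_UNIV_prod by (rule sum.swap)
  then show ?thesis by (simp add: contract_input_mid)
qed

lemma hinner_op_sum_ext:
  assumes S: "\<And>r :: 'i::finite. S r \<in> ops" and T: "T \<in> ops"
    and eq: "\<And>z w z' v. (\<Sum>r\<in>UNIV. hinner H (S r (g (z, w))) (g (z', v))) = hinner H (T (g (z, w))) (g (z', v))"
  shows "finsum (\<B> H) S UNIV = T"
  by (rule op_gram_eqI) (use S T eq in \<open>simp_all add: op_finsum_closed hinner_op_finsum\<close>)

lemma op_adj_left_op: "op_adj H (left_op p q) = left_op q p"
  by (rule total_op_ext[OF g_total]) (auto simp: split_paired_all)

lemma reproducing_family:
  assumes T: "\<And>p q. T p q \<in> ops"
    and eq: "\<And>p q z w z' v. (\<Sum>r\<in>UNIV. hinner H (T p r (T r q (g (z, w)))) (g (z', v)))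
      = of_nat n * hinner H (T p q (g (z, w))) (g (z', v))"
    and vw: "v \<in> carrier H" "w \<in> carrier H"
  shows "(\<Sum>r\<in>(UNIV :: ('i::finite) set). hinner H (T p r (T r q v)) w) = of_nat n * hinner H (T p q v) w"
proof -
  have "finsum (\<B> H) (\<lambda>r :: 'i. T p r \<otimes>\<^bsub>\<B> H\<^esub> T r q) UNIV = of_nat n \<odot>\<^bsub>\<B> H\<^esub> T p q"
    by (rule hinner_op_sum_ext) (use T eq in \<open>simp_all add: hinner_smult\<close>)
  then have "hinner H (finsum (\<B> H) (\<lambda>r :: 'i. T p r \<otimes>\<^bsub>\<B> H\<^esub> T r q) UNIV v) w = of_nat n * hinner H (T p q v) w"
    using vw T by (simp add: hinner_smult)
  then show ?thesis using vw T by (simp add: hinner_op_finsum)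
qed

lemma bistochastic_left: "bistochastic H (\<lambda>x x' a a'. left_op (x, a) (x', a'))"
  unfolding bistochastic_def prod.collapse
proof (intro conjI allI)
  show "om_positive H left_op"
  proof (rule om_positive_reproducing[where n = "CARD('x)"])
    fix p q and v w assume vw: "v \<in> carrier H" "w \<in> carrier H"
    show "(\<Sum>r\<in>UNIV. hinner H (left_op p r (left_op r q v)) w) = of_nat CARD('x) * hinner H (left_op p q v) w"
    proof (rule reproducing_family[OF _ _ vw])
      fix p q z w z' v
      show "(\<Sum>r\<in>UNIV. hinner H (left_op p r (left_op r q (g (z, w)))) (g (z', v)))
          = of_nat CARD('x) * hinner H (left_op p q (g (z, w))) (g (z', v))"
        using reproducing_index[of "star v" p q w] by (simp add: gram sum_if_const)
    qed simp
  qed (simp_all add: hilbert_space_axioms op_adj_left_op)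
  show "(\<Oplus>\<^bsub>\<B> H\<^esub>a\<in>UNIV. left_op (x, a) (x', a)) = (if x = x' then \<one>\<^bsub>\<B> H\<^esub> else \<zero>\<^bsub>\<B> H\<^esub>)" for x x'
    by (rule hinner_op_sum_ext) (simp_all add: gram sum_if_const sum_output_mid)
  show "(\<Oplus>\<^bsub>\<B> H\<^esub>x\<in>UNIV. left_op (x, a) (x, a')) = (if a = a' then \<one>\<^bsub>\<B> H\<^esub> else \<zero>\<^bsub>\<B> H\<^esub>)" for a a'
    by (rule hinner_op_sum_ext) (simp_all add: gram sum_if_const sum_input_mid)
qed

lemma bistochastic_right: "bistochastic H (\<lambda>y y' b b'. right_op (y', b') (y, b))"
  unfolding bistochastic_def prod.collapse
proof (intro conjI allI)
  show "om_positive H (\<lambda>p q. right_op q p)"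
  proof (rule om_positive_reproducing[where n = "CARD('x)"])
    fix p q and v w assume vw: "v \<in> carrier H" "w \<in> carrier H"
    show "(\<Sum>r\<in>UNIV. hinner H (right_op r p (right_op q r v)) w) = of_nat CARD('x) * hinner H (right_op q p v) w"
    proof (rule reproducing_family[OF _ _ vw])
      fix p q z w z' v
      show "(\<Sum>r\<in>UNIV. hinner H (right_op r p (right_op q r (g (z, w)))) (g (z', v)))
          = of_nat CARD('x) * hinner H (right_op q p (g (z, w))) (g (z', v))"
        using reproducing_index[of "star v @ w" q p "[]"] by (simp add: gram sum_if_const)
    qed simp
  qed (simp_all add: hilbert_space_axioms op_adj_right_op)
  show "(\<Oplus>\<^bsub>\<B> H\<^esub>a\<in>UNIV. right_op (x', a) (x, a)) = (if x = x' then \<one>\<^bsub>\<B> H\<^esub> else \<zero>\<^bsub>\<B> H\<^esub>)" for x x'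
  proof (rule hinner_op_sum_ext)
    fix z w z' v
    show "(\<Sum>a\<in>UNIV. hinner H (right_op (x', a) (x, a) (g (z, w))) (g (z', v)))
        = hinner H ((if x = x' then \<one>\<^bsub>\<B> H\<^esub> else \<zero>\<^bsub>\<B> H\<^esub>) (g (z, w))) (g (z', v))"
      using sum_output_mid[of "star v @ w" x' x "[]"] by (auto simp: gram sum_if_const)
  qed simp_all
  show "(\<Oplus>\<^bsub>\<B> H\<^esub>x\<in>UNIV. right_op (x, a') (x, a)) = (if a = a' then \<one>\<^bsub>\<B> H\<^esub> else \<zero>\<^bsub>\<B> H\<^esub>)" for a a'
  proof (rule hinner_op_sum_ext)
    fix z w z' v
    show "(\<Sum>x\<in>UNIV. hinner H (right_op (x, a') (x, a) (g (z, w))) (g (z', v)))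
        = hinner H ((if a = a' then \<one>\<^bsub>\<B> H\<^esub> else \<zero>\<^bsub>\<B> H\<^esub>) (g (z, w))) (g (z', v))"
      using sum_input_mid[of "star v @ w" a' a "[]"] by (auto simp: gram sum_if_const)
  qed simp_all
qed

text \<open>
  Right multiplication reverses products, so the indices of the second family are exchanged.
\<close>

lemma quantum_commuting_chan_coeff: "quantum_commuting TYPE('h) (chan coeff)"
  unfolding quantum_commuting_def
proof (intro exI conjI allI)
  show "hilbert_space H" by (rule hilbert_space_axioms)
  show "\<Omega> \<in> carrier H" by simp
  show "hnorm H \<Omega> = 1" by (simp add: hnorm_def \<Omega>_def gram unit)
  show "bistochastic H (\<lambda>x x' a a'. left_op (x, a) (x', a'))" by (rule bistochastic_left)
  show "bistochastic H (\<lambda>y y' b b'. right_op (y', b') (y, b))" by (rule bistochastic_right)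
  fix x x' y y' :: 'x
  show "left_op (x, a) (x', a') \<otimes>\<^bsub>\<B> H\<^esub> right_op (y', b') (y, b)
      = right_op (y', b') (y, b) \<otimes>\<^bsub>\<B> H\<^esub> left_op (x, a) (x', a')" for a a' b b'
    by (rule total_op_ext[OF g_total]) (auto simp: split_paired_all)
  have "hinner H ((left_op (x, a) (x', a') \<otimes>\<^bsub>\<B> H\<^esub> right_op (y', b') (y, b)) \<Omega>) \<Omega>
      = coeff (x, y) (a, b) (x', y') (a', b')" for a a' b b'
    by (simp add: \<Omega>_def gram coeff_def)
  then show "chan coeff (kron (munit x x') (munit y y')) =
      (\<Sum>a\<in>UNIV. \<Sum>a'\<in>UNIV. \<Sum>b\<in>UNIV. \<Sum>b'\<in>UNIV.
        mscale (hinner H ((left_op (x, a) (x', a') \<otimes>\<^bsub>\<B> H\<^esub> right_op (y', b') (y, b)) \<Omega>) \<Omega>)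
          (kron (munit a a') (munit b b')))"
    by (simp add: kron_munit chan_munit matrix_sum_munit[unfolded kron_munit] vec_eq_iff)
qed

end

lemma qc_isomorphic_of_trace:
  fixes \<phi> :: "('x::finite) letter list \<Rightarrow> complex"
  assumes \<phi>: "biunitary_trace \<phi>" and big: "(UNIV :: real set) \<lesssim> (UNIV :: 'k set)"
    and \<U>: "vec.subspace \<U>" and \<V>: "vec.subspace \<V>"
    and inter: "intertwines \<phi> \<U> \<V>" "intertwines (transposed \<phi>) \<V> \<U>"
  shows "qc_isomorphic TYPE('k) \<U> \<V>"
proof -
  interpret biunitary_trace \<phi> by (rule \<phi>)
  interpret T: biunitary_trace "transposed \<phi>" by (rule biunitary_trace_transposed)
  obtain H :: "'k hilbert" and g where "trace_space \<phi> H g"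
    using trace_space_exists[OF \<phi> big] by blast
  then have "quantum_commuting TYPE('k) (chan coeff)"
    by (rule trace_space.quantum_commuting_chan_coeff)
  then have "chan coeff \<in> Q_qc_bic TYPE('k)"
    by (simp add: Q_qc_bic_def QNS_bicorrelation_chan_coeff concurrent_chan_coeff)
  moreover have "perfect_strategy (chan coeff) \<U> \<V>"
    by (rule perfect_strategy_chan_coeff[OF \<U> \<V> inter(1)])
  moreover have "perfect_strategy (dual_map (chan coeff)) \<V> \<U>"
    unfolding dual_chan_coeff by (rule T.perfect_strategy_chan_coeff[OF \<V> \<U> inter(2)])
  ultimately show ?thesis by (auto simp: qc_isomorphic_def)
qed

section \<open>Positive operator matrices\<close>

context hilbert_space
begin

text \<open>
  The sesquilinear form of an operator matrix. Positivity of the matrix is only assumed of its values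
  \<open>form T v v\<close>. That the entries are adjoint to each other, and that null vectors are in the kernel, is
  derived by polarisation.
\<close>

definition form :: "('i::finite, 'k) opmat \<Rightarrow> ('i \<Rightarrow> 'k) \<Rightarrow> ('i \<Rightarrow> 'k) \<Rightarrow> complex" where
  "form T u v = (\<Sum>p\<in>UNIV. \<Sum>q\<in>UNIV. hinner H (T p q (u q)) (v p))"

context
  fixes T :: "('i::finite, 'k) opmat"
  assumes T: "om_positive H T"
begin

lemma positive_ops [simp]: "T p q \<in> ops"
  using T by (simp add: om_positive_def opmats_def)

lemma form_nonneg: "(\<And>i. v i \<in> carrier H) \<Longrightarrow> form T v v \<in> \<real>\<^sub>\<ge>\<^sub>0"
  using T by (simp add: om_positive_def form_def)

lemma form_combine:
  assumes u: "\<And>i. u i \<in> carrier H" and v: "\<And>i. v i \<in> carrier H"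
  shows "form T (\<lambda>i. u i \<oplus> z \<odot> v i) (\<lambda>i. u i \<oplus> z \<odot> v i)
    = form T u u + cnj z * form T u v + z * form T v u + z * cnj z * form T v v"
  using u v by (simp add: form_def hinner_linear op_add op_smult sum.distrib sum_distrib_left algebra_simps)

lemma form_pair_nonneg:
  assumes u: "\<And>i. u i \<in> carrier H" and v: "\<And>i. v i \<in> carrier H"
  shows "form T u u + cnj z * form T u v + z * form T v u + z * cnj z * form T v v \<in> \<real>\<^sub>\<ge>\<^sub>0"
  using form_nonneg[of "\<lambda>i. u i \<oplus> z \<odot> v i"] u v by (simp add: form_combine)

lemma form_hermitian:
  assumes u: "\<And>i. u i \<in> carrier H" and v: "\<And>i. v i \<in> carrier H"
  shows "form T v u = cnj (form T u v)"
  by (rule nonneg_hermitian_form(1)[OF form_pair_nonneg[OF u v] form_nonneg[OF u] form_nonneg[OF v]])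

lemma form_single_left:
  assumes "k \<in> carrier H" "\<And>i. v i \<in> carrier H"
  shows "form T (\<lambda>i. if i = q then k else \<zero>) v = (\<Sum>p\<in>UNIV. hinner H (T p q k) (v p))"
proof -
  have "hinner H (T p q' (if q' = q then k else \<zero>)) (v p) = (if q' = q then hinner H (T p q k) (v p) else 0)" for p q'
    using assms by auto
  then show ?thesis by (simp add: form_def)
qed

lemma form_single_right:
  assumes "k \<in> carrier H" "\<And>i. u i \<in> carrier H"
  shows "form T u (\<lambda>i. if i = p then k else \<zero>) = (\<Sum>q\<in>UNIV. hinner H (T p q (u q)) k)"
proof -
  have "(\<Sum>q\<in>UNIV. hinner H (T p' q (u q)) (if p' = p then k else \<zero>))
      = (if p' = p then \<Sum>q\<in>UNIV. hinner H (T p q (u q)) k else 0)" for p'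
    using assms by auto
  then show ?thesis by (simp add: form_def)
qed

lemma form_null:
  assumes v: "\<And>i. v i \<in> carrier H" and null: "form T v v = 0" and w: "w \<in> carrier H"
  shows "(\<Sum>q\<in>UNIV. hinner H (T p q (v q)) w) = 0"
proof -
  define u where "u = (\<lambda>i. if i = p then w else \<zero>)"
  have u: "u i \<in> carrier H" for i using w by (simp add: u_def)
  have "form T u v = 0"
    by (rule nonneg_hermitian_form(2)[OF form_pair_nonneg[OF u v] form_nonneg[OF u] form_nonneg[OF v] null])
  then have "form T v u = 0" using form_hermitian[OF u v] by simp
  then show ?thesis using form_single_right[OF w v, where p = p] by (simp add: u_def)
qed

lemma positive_adj: "op_adj H (T p q) = T q p"
proof (rule op_adj_eqI)
  fix k l assume kl: "k \<in> carrier H" "l \<in> carrier H"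
  define u v where "u = (\<lambda>i. if i = q then k else \<zero>)" and "v = (\<lambda>i. if i = p then l else \<zero>)"
  have uv: "u i \<in> carrier H" "v i \<in> carrier H" for i using kl by (simp_all add: u_def v_def)
  have *: "(\<Sum>r\<in>UNIV. hinner H (T r s k') (if r = t then l' else \<zero>)) = hinner H (T t s k') l'"
    if "k' \<in> carrier H" "l' \<in> carrier H" for s t k' l'
  proof -
    have "hinner H (T r s k') (if r = t then l' else \<zero>) = (if r = t then hinner H (T t s k') l' else 0)" for r
      using that by auto
    then show ?thesis by simp
  qed
  have "hinner H (T p q k) l = form T u v" "hinner H (T q p l) k = form T v u"
    using form_single_left[OF kl(1), where v = v and q = q] form_single_left[OF kl(2), where v = u and q = p] uv kl
    by (simp_all add: u_def v_def *)
  then have "hinner H (T q p l) k = cnj (hinner H (T p q k) l)" using form_hermitian[OF uv] by simp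
  then show "hinner H (T p q k) l = hinner H k (T q p l)"
    using kl hinner_commute[of k "T q p l"] by simp
qed simp_all

end

text \<open>
  Write \<open>T p q = V p\<^sup>* V q\<close>. The marginal condition says that the \<open>V (x, a)\<close> form an isometry, indexed
  by \<open>x\<close> in the domain and by \<open>a\<close> in the range. Its adjoint is a contraction, so
  $\sum_b \|V_{(b,z)}^* V_q \xi\|^2 \le \|V_q \xi\|^2$. In case of equality the isometry applied to its
  adjoint fixes the vector with the only entry \<open>V q \<xi>\<close> at \<open>z\<close>. The vectors \<open>v z'\<close> below are the
  entries of the difference of the two, with \<open>V\<close> left out.
\<close>

lemma isometry_adjoint:
  fixes T :: "('x::finite \<times> 'x, 'k) opmat"
  assumes T: "om_positive H T"
    and marginal: "\<And>x x' v w. v \<in> carrier H \<Longrightarrow> w \<in> carrier H \<Longrightarrow>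
      (\<Sum>a\<in>UNIV. hinner H (T (x, a) (x', a) v) w) = (if x = x' then hinner H v w else 0)"
    and \<xi>: "\<xi> \<in> carrier H"
  shows isometry_adjoint_le: "(\<Sum>b\<in>UNIV. (hnorm H (T (b, z) q \<xi>))\<^sup>2) \<le> Re (hinner H (T q q \<xi>) \<xi>)"
    and isometry_adjoint_eq: "(\<Sum>b\<in>UNIV. (hnorm H (T (b, z) q \<xi>))\<^sup>2) = Re (hinner H (T q q \<xi>) \<xi>) \<Longrightarrow>
      w \<in> carrier H \<Longrightarrow> (\<Sum>b\<in>UNIV. hinner H (T p (b, z') (T (b, z) q \<xi>)) w)
        = (if z' = z then hinner H (T p q \<xi>) w else 0)"
proof -
  note [simp] = positive_ops[OF T]
  define k where "k b = T (b, z) q \<xi>" for b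
  have k: "k b \<in> carrier H" for b using \<xi> by (simp add: k_def)
  define v1 where "v1 z' r = (if z' = z \<and> r = q then \<xi> else \<zero>)" for z' :: 'x and r
  define v2 where "v2 z' r = (if snd r = z' then k (fst r) else \<zero>)" for z' :: 'x and r
  define v where "v z' r = v1 z' r \<oplus> (-1) \<odot> v2 z' r" for z' r
  have vc: "v1 z' r \<in> carrier H" "v2 z' r \<in> carrier H" "v z' r \<in> carrier H" for z' r
    using \<xi> k by (auto simp: v1_def v2_def v_def)
  define L where "L z' p w = (\<Sum>r\<in>UNIV. hinner H (T p r (v z' r)) w)" for z' p w
  have sum1: "(\<Sum>r\<in>UNIV. F r (v1 z' r)) = (if z' = z then F q \<xi> else 0)"
    if "\<And>r. F r \<zero> = 0" for F :: "_ \<Rightarrow> _ \<Rightarrow> complex" and z'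
  proof -
    have "F r (v1 z' r) = (if r = q then if z' = z then F q \<xi> else 0 else 0)" for r
      using that by (auto simp: v1_def)
    then show ?thesis by simp
  qed
  have sum2: "(\<Sum>r\<in>UNIV. F r (v2 z' r)) = (\<Sum>b\<in>UNIV. F (b, z') (k b))"
    if "\<And>r. F r \<zero> = 0" for F :: "_ \<Rightarrow> _ \<Rightarrow> complex" and z'
  proof -
    have "F (b, y) (v2 z' (b, y)) = (if y = z' then F (b, z') (k b) else 0)" for b y
      using that by (auto simp: v2_def)
    then show ?thesis by (simp add: sum_UNIV_prod)
  qed
  have L: "L z' p w = (if z' = z then hinner H (T p q \<xi>) w else 0) - (\<Sum>b\<in>UNIV. hinner H (T p (b, z') (k b)) w)"
    if w: "w \<in> carrier H" for z' p w
  proof -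
    have "L z' p w = (\<Sum>r\<in>UNIV. hinner H (T p r (v1 z' r)) w) - (\<Sum>r\<in>UNIV. hinner H (T p r (v2 z' r)) w)"
      using w vc by (simp add: L_def v_def op_add op_smult hinner_linear sum_subtractf)
    then show ?thesis
      using sum1[of "\<lambda>r u. hinner H (T p r u) w" z'] sum2[of "\<lambda>r u. hinner H (T p r u) w" z'] w by simp
  qed
  have form: "form T (v z') (v z') = (if z' = z then L z' q \<xi> else 0) - (\<Sum>b\<in>UNIV. L z' (b, z') (k b))" for z'
  proof -
    have "form T (v z') (v z') = (\<Sum>p\<in>UNIV. L z' p (v z' p))" by (simp add: form_def L_def)
    also have "\<dots> = (\<Sum>p\<in>UNIV. L z' p (v1 z' p)) - (\<Sum>p\<in>UNIV. L z' p (v2 z' p))"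
      using vc unfolding L_def
      by (subst v_def[of z' "p" for p], simp add: hinner_linear sum_subtractf)
    finally show ?thesis
      using sum1[of "L z'" z'] sum2[of "L z'" z'] vc by (simp add: L_def)
  qed
  have norm_k: "(\<Sum>b\<in>UNIV. hinner H (k b) (k b)) = of_real (\<Sum>b\<in>UNIV. (hnorm H (k b))\<^sup>2)"
    using k by (simp add: hinner_self)
  \<comment> \<open>the squared norm of the difference between a vector and its image under the isometry and its adjoint\<close>
  have "(\<Sum>z'\<in>UNIV. form T (v z') (v z')) = L z q \<xi> - (\<Sum>z'\<in>UNIV. \<Sum>b\<in>UNIV. L z' (b, z') (k b))"
    unfolding form by (simp add: sum_subtractf)
  also have "L z q \<xi> = hinner H (T q q \<xi>) \<xi> - (\<Sum>b\<in>UNIV. hinner H (k b) (k b))"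
  proof -
    have "hinner H (T q (b, z) (k b)) \<xi> = hinner H (k b) (k b)" for b
      using \<xi> k by (simp add: positive_adj[OF T, of "(b, z)" q, symmetric] hinner_op_adj_left) (simp add: k_def)
    then show ?thesis using \<xi> by (simp add: L)
  qed
  also have "(\<Sum>z'\<in>UNIV. \<Sum>b\<in>UNIV. L z' (b, z') (k b)) = 0"
  proof -
    have "(\<Sum>z'\<in>UNIV. \<Sum>b\<in>UNIV. L z' (b, z') (k b))
        = (\<Sum>z'\<in>UNIV. \<Sum>b\<in>UNIV. if z' = z then hinner H (k b) (k b) else 0)
          - (\<Sum>z'\<in>UNIV. \<Sum>b\<in>UNIV. \<Sum>b'\<in>UNIV. hinner H (T (b, z') (b', z') (k b')) (k b))"
      using k by (simp add: L sum_subtractf) (simp add: k_def cong: sum.cong if_cong)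
    also have "(\<Sum>z'\<in>UNIV. \<Sum>b\<in>UNIV. if z' = z then hinner H (k b) (k b) else 0) = (\<Sum>b\<in>UNIV. hinner H (k b) (k b))"
      by (simp add: sum_if_const)
    also have "(\<Sum>z'\<in>UNIV. \<Sum>b\<in>UNIV. \<Sum>b'\<in>UNIV. hinner H (T (b, z') (b', z') (k b')) (k b))
        = (\<Sum>b\<in>UNIV. \<Sum>b'\<in>UNIV. \<Sum>z'\<in>UNIV. hinner H (T (b, z') (b', z') (k b')) (k b))"
      by (subst sum.swap, rule sum.cong[OF refl], rule sum.swap)
    also have "\<dots> = (\<Sum>b\<in>UNIV. hinner H (k b) (k b))" using k by (simp add: marginal)
    finally show ?thesis by simp
  qed
  finally have total: "(\<Sum>z'\<in>UNIV. form T (v z') (v z'))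
      = hinner H (T q q \<xi>) \<xi> - of_real (\<Sum>b\<in>UNIV. (hnorm H (k b))\<^sup>2)"
    by (simp add: norm_k)
  have nonneg: "form T (v z') (v z') \<in> \<real>\<^sub>\<ge>\<^sub>0" for z' using form_nonneg[OF T vc(3)] .
  have "hinner H (T q q \<xi>) \<xi> - of_real (\<Sum>b\<in>UNIV. (hnorm H (k b))\<^sup>2) \<in> \<real>\<^sub>\<ge>\<^sub>0"
    unfolding total[symmetric] by (rule sum_nonneg_Reals[OF nonneg])
  then show "(\<Sum>b\<in>UNIV. (hnorm H (T (b, z) q \<xi>))\<^sup>2) \<le> Re (hinner H (T q q \<xi>) \<xi>)"
    by (simp add: complex_nonneg_Reals_iff k_def)
  assume eq: "(\<Sum>b\<in>UNIV. (hnorm H (T (b, z) q \<xi>))\<^sup>2) = Re (hinner H (T q q \<xi>) \<xi>)" and w: "w \<in> carrier H"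
  have "(\<Sum>z'\<in>UNIV. Re (form T (v z') (v z'))) = 0"
    using arg_cong[OF total, of Re] eq by (simp add: k_def)
  then have "Re (form T (v z') (v z')) = 0"
    using nonneg by (subst (asm) sum_nonneg_eq_0_iff) (auto simp: complex_nonneg_Reals_iff)
  then have "form T (v z') (v z') = 0"
    using nonneg[of z'] by (simp add: complex_nonneg_Reals_iff complex_eq_iff)
  from form_null[OF T vc(3) this w, of p] have "L z' p w = 0" by (simp add: L_def)
  then show "(\<Sum>b\<in>UNIV. hinner H (T p (b, z') (T (b, z) q \<xi>)) w)
        = (if z' = z then hinner H (T p q \<xi>) w else 0)"
    using L[OF w, of z' p] by (simp add: k_def)
qed

text \<open>
  Each of the $n$ values of \<open>z\<close> contributes at most the sum of the diagonal entries, which is $n$. If the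
  total is $n^2$, there is equality for every \<open>z\<close> and \<open>q\<close>.
\<close>

lemma isometry_saturated:
  fixes T :: "('x::finite \<times> 'x, 'k) opmat"
  assumes T: "om_positive H T"
    and marginal: "\<And>x x' v w. v \<in> carrier H \<Longrightarrow> w \<in> carrier H \<Longrightarrow>
      (\<Sum>a\<in>UNIV. hinner H (T (x, a) (x', a) v) w) = (if x = x' then hinner H v w else 0)"
    and \<xi>: "\<xi> \<in> carrier H" "hnorm H \<xi> = 1"
  shows isometry_total_le: "(\<Sum>p\<in>UNIV. \<Sum>q\<in>UNIV. (hnorm H (T p q \<xi>))\<^sup>2) \<le> (real CARD('x))\<^sup>2"
    and isometry_total_eq: "(\<Sum>p\<in>UNIV. \<Sum>q\<in>UNIV. (hnorm H (T p q \<xi>))\<^sup>2) = (real CARD('x))\<^sup>2 \<Longrightarrow>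
      w \<in> carrier H \<Longrightarrow> (\<Sum>b\<in>UNIV. hinner H (T p (b, z') (T (b, z) q \<xi>)) w)
        = (if z' = z then hinner H (T p q \<xi>) w else 0)"
proof -
  have "(\<Sum>q\<in>UNIV. hinner H (T q q \<xi>) \<xi>) = of_nat CARD('x)"
    using \<xi> marginal[OF \<xi>(1) \<xi>(1)] by (simp add: sum_UNIV_prod hinner_self)
  from arg_cong[OF this, of Re] have diag: "(\<Sum>q\<in>UNIV. Re (hinner H (T q q \<xi>) \<xi>)) = real CARD('x)" by simp
  define f where "f = (\<lambda>(q, z). \<Sum>b\<in>UNIV. (hnorm H (T (b, z) q \<xi>))\<^sup>2)"
  define h where "h = (\<lambda>(q, z :: 'x). Re (hinner H (T q q \<xi>) \<xi>))"
  have le: "f i \<le> h i" for i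
    using isometry_adjoint_le[OF T marginal \<xi>(1)] by (simp add: f_def h_def split_beta)
  have f: "(\<Sum>p\<in>UNIV. \<Sum>q\<in>UNIV. (hnorm H (T p q \<xi>))\<^sup>2) = sum f UNIV"
  proof -
    have "(\<Sum>p\<in>UNIV. \<Sum>q\<in>UNIV. (hnorm H (T p q \<xi>))\<^sup>2) = (\<Sum>q\<in>UNIV. \<Sum>p\<in>UNIV. (hnorm H (T p q \<xi>))\<^sup>2)"
      by (rule sum.swap)
    also have "\<dots> = (\<Sum>q\<in>UNIV. \<Sum>z\<in>UNIV. \<Sum>b\<in>UNIV. (hnorm H (T (b, z) q \<xi>))\<^sup>2)"
      unfolding sum_UNIV_prod[of "\<lambda>p. (hnorm H (T p q \<xi>))\<^sup>2" for q] by (rule sum.cong[OF refl], rule sum.swap)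
    finally show ?thesis by (simp add: f_def sum_UNIV_prod[of "\<lambda>i. case i of (q, z) \<Rightarrow> _ q z"])
  qed
  have h: "sum h UNIV = (real CARD('x))\<^sup>2"
  proof -
    have "sum h UNIV = (\<Sum>q\<in>UNIV. real CARD('x) * Re (hinner H (T q q \<xi>) \<xi>))"
      unfolding h_def by (subst sum_UNIV_prod) simp
    then show ?thesis by (simp add: diag power2_eq_square flip: sum_distrib_left)
  qed
  show "(\<Sum>p\<in>UNIV. \<Sum>q\<in>UNIV. (hnorm H (T p q \<xi>))\<^sup>2) \<le> (real CARD('x))\<^sup>2"
    unfolding f h[symmetric] by (rule sum_mono[OF le])
  assume eq: "(\<Sum>p\<in>UNIV. \<Sum>q\<in>UNIV. (hnorm H (T p q \<xi>))\<^sup>2) = (real CARD('x))\<^sup>2" and w: "w \<in> carrier H"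
  have "f (q, z) = h (q, z)"
    by (rule sum_mono_inv[of f UNIV h]) (use eq f h le in auto)
  then show "(\<Sum>b\<in>UNIV. hinner H (T p (b, z') (T (b, z) q \<xi>)) w)
        = (if z' = z then hinner H (T p q \<xi>) w else 0)"
    by (intro isometry_adjoint_eq[OF T marginal \<xi>(1)] w) (simp_all add: f_def h_def)
qed

lemma pos_kernel_gram:
  fixes f :: "'i \<Rightarrow> 'k"
  assumes "\<And>i. f i \<in> carrier H"
  shows "pos_kernel (\<lambda>i j. hinner H (f i) (f j))"
  unfolding pos_kernel_def
proof (intro allI impI)
  fix A :: "'i set" and c assume A: "finite A"
  have "(\<Sum>i\<in>A. \<Sum>j\<in>A. c i * cnj (c j) * hinner H (f i) (f j)) = hinner H (comb f A c) (comb f A c)"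
    using A assms by (simp add: hinner_comb_left hinner_comb_right sum_distrib_left mult_ac)
      (rule sum.swap)
  then show "(\<Sum>i\<in>A. \<Sum>j\<in>A. c i * cnj (c j) * hinner H (f i) (f j)) \<in> \<real>\<^sub>\<ge>\<^sub>0"
    using assms by (simp add: hinner_nonneg)
qed

end

section \<open>The trace of a concurrent pair\<close>

text \<open>
  The entries are indexed by pairs \<open>p = (x, a)\<close>, \<open>q = (x', a')\<close>, as the rows and columns of a matrix. The
  last assumption is the only trace of the channel that is left: the sum of the entries of its concurrence
  condition over equal outputs.
\<close>

locale concurrent_pair = hilbert_space H for H :: "'k hilbert" (structure) +
  fixes \<xi> :: 'k and E F :: "(('x::finite) \<times> 'x, 'k) opmat"
  assumes \<xi>_in [simp]: "\<xi> \<in> carrier H" and \<xi>_norm: "hnorm H \<xi> = 1"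
    and E_positive: "om_positive H E" and F_positive: "om_positive H F"
    and E_output: "\<And>x x' v w. v \<in> carrier H \<Longrightarrow> w \<in> carrier H \<Longrightarrow>
      (\<Sum>a\<in>UNIV. hinner H (E (x, a) (x', a) v) w) = (if x = x' then hinner H v w else 0)"
    and E_input: "\<And>a a' v w. v \<in> carrier H \<Longrightarrow> w \<in> carrier H \<Longrightarrow>
      (\<Sum>x\<in>UNIV. hinner H (E (x, a) (x, a') v) w) = (if a = a' then hinner H v w else 0)"
    and F_output: "\<And>x x' v w. v \<in> carrier H \<Longrightarrow> w \<in> carrier H \<Longrightarrow>
      (\<Sum>a\<in>UNIV. hinner H (F (x, a) (x', a) v) w) = (if x = x' then hinner H v w else 0)"
    and commute: "\<And>p q r s v. v \<in> carrier H \<Longrightarrow> E p q (F r s v) = F r s (E p q v)"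
    and concurrence: "(\<Sum>p\<in>UNIV. \<Sum>q\<in>UNIV. hinner H (E p q (F p q \<xi>)) \<xi>) = (of_nat CARD('x))\<^sup>2"
begin

lemma EF_ops [simp]: "E p q \<in> ops" "F p q \<in> ops"
  using positive_ops[OF E_positive] positive_ops[OF F_positive] by auto

lemma EF_adj: "op_adj H (E p q) = E q p" "op_adj H (F p q) = F q p"
  using positive_adj[OF E_positive] positive_adj[OF F_positive] by auto

lemma hinner_E: "v \<in> carrier H \<Longrightarrow> w \<in> carrier H \<Longrightarrow> hinner H (E p q v) w = hinner H v (E q p w)"
  using hinner_op_adj_right[of "E p q" v w] by (simp add: EF_adj)

lemma hinner_F: "v \<in> carrier H \<Longrightarrow> w \<in> carrier H \<Longrightarrow> hinner H (F p q v) w = hinner H v (F q p w)"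
  using hinner_op_adj_right[of "F p q" v w] by (simp add: EF_adj)

text \<open>
  Both families are contractive in the sense of the previous section, so the value $n^2$ of the
  concurrence is extremal in the Cauchy-Schwarz inequality.
\<close>

lemma exchange: "E p q \<xi> = F q p \<xi>"
  and E_saturated: "(\<Sum>p\<in>UNIV. \<Sum>q\<in>UNIV. (hnorm H (E p q \<xi>))\<^sup>2) = (real CARD('x))\<^sup>2"
proof -
  let ?n = "real CARD('x)"
  let ?e = "\<Sum>p\<in>UNIV. \<Sum>q\<in>UNIV. (hnorm H (E p q \<xi>))\<^sup>2"
  let ?f = "\<Sum>p\<in>UNIV. \<Sum>q\<in>UNIV. (hnorm H (F p q \<xi>))\<^sup>2"
  let ?d = "\<Sum>p\<in>UNIV. \<Sum>q\<in>UNIV. (hnorm H (E p q \<xi> \<ominus> F q p \<xi>))\<^sup>2"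
  have e: "?e \<le> ?n\<^sup>2" by (rule isometry_total_le[OF E_positive E_output \<xi>_in \<xi>_norm])
  have f: "?f \<le> ?n\<^sup>2" by (rule isometry_total_le[OF F_positive F_output \<xi>_in \<xi>_norm])
  have "(hnorm H (E p q \<xi> \<ominus> F q p \<xi>))\<^sup>2
      = (hnorm H (E p q \<xi>))\<^sup>2 + (hnorm H (F q p \<xi>))\<^sup>2 - 2 * Re (hinner H (E p q (F p q \<xi>)) \<xi>)" for p q
  proof -
    have "hinner H (E p q (F p q \<xi>)) \<xi> = hinner H (E p q \<xi>) (F q p \<xi>)"
      by (simp add: commute hinner_F)
    then show ?thesis
      using arg_cong[OF hinner_self[of "E p q \<xi> \<ominus> F q p \<xi>"], of Re]
        arg_cong[OF hinner_self[of "E p q \<xi>"], of Re] arg_cong[OF hinner_self[of "F q p \<xi>"], of Re]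
        Re_hinner_commute[of "E p q \<xi>" "F q p \<xi>"]
      by (simp add: hinner_linear)
  qed
  then have "?d = ?e + (\<Sum>p\<in>UNIV. \<Sum>q\<in>UNIV. (hnorm H (F q p \<xi>))\<^sup>2)
      - 2 * Re (\<Sum>p\<in>UNIV. \<Sum>q\<in>UNIV. hinner H (E p q (F p q \<xi>)) \<xi>)"
    by (simp add: sum.distrib sum_subtractf sum_distrib_left)
  also have "(\<Sum>p\<in>UNIV. \<Sum>q\<in>UNIV. (hnorm H (F q p \<xi>))\<^sup>2) = ?f" by (rule sum.swap)
  also have "Re (\<Sum>p\<in>UNIV. \<Sum>q\<in>UNIV. hinner H (E p q (F p q \<xi>)) \<xi>) = ?n\<^sup>2"
    unfolding concurrence by (simp flip: of_nat_power)
  finally have d: "?d = ?e + ?f - 2 * ?n\<^sup>2" .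
  moreover have d0: "0 \<le> ?d" by (intro sum_nonneg) auto
  ultimately show "?e = ?n\<^sup>2" using e f by linarith
  have "?d = 0" using d d0 e f by linarith
  then have "(hnorm H (E p q \<xi> \<ominus> F q p \<xi>))\<^sup>2 = 0"
    by (cases p; cases q) (simp add: sum_nonneg_eq_0_iff sum_nonneg)
  then have "E p q \<xi> \<ominus> F q p \<xi> = \<zero>" using hnorm_eq_0[of "E p q \<xi> \<ominus> F q p \<xi>"] by simp
  then show "E p q \<xi> = F q p \<xi>"
    using M.minus_equality[of "E p q \<xi>" "\<ominus> F q p \<xi>"] by (simp add: a_minus_def)
qed

lemma E_contract_input:
  "w \<in> carrier H \<Longrightarrow> (\<Sum>x\<in>UNIV. hinner H (E p (x, a) (E (x, a') q \<xi>)) w)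
    = (if a = a' then hinner H (E p q \<xi>) w else 0)"
  by (rule isometry_total_eq[OF E_positive E_output \<xi>_in \<xi>_norm E_saturated])

text \<open>Exchanging the roles of inputs and outputs gives the companion relation.\<close>

lemma E_contract_output:
  assumes w: "w \<in> carrier H"
  shows "(\<Sum>a\<in>UNIV. hinner H (E p (x, a) (E (x', a) q \<xi>)) w)
    = (if x = x' then hinner H (E p q \<xi>) w else 0)"
proof -
  let ?T = "\<lambda>p q. E (prod.swap p) (prod.swap q)"
  have swap_sum: "(\<Sum>p\<in>UNIV. f (prod.swap p)) = (\<Sum>p\<in>UNIV. f p)" for f :: "'x \<times> 'x \<Rightarrow> _"
    by (rule sum.reindex_bij_witness[of _ prod.swap prod.swap]) auto
  have "om_positive H ?T"
    unfolding om_positive_def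
  proof (intro conjI allI impI)
    show "?T \<in> opmats H" by (simp add: opmats_def)
    fix v :: "'x \<times> 'x \<Rightarrow> 'k" assume v: "\<forall>i. v i \<in> carrier H"
    have "(\<Sum>i\<in>UNIV. \<Sum>j\<in>UNIV. hinner H (?T i j (v j)) (v i)) = form E (\<lambda>i. v (prod.swap i)) (\<lambda>i. v (prod.swap i))"
      unfolding form_def
      by (subst swap_sum[symmetric], rule sum.cong[OF refl], subst swap_sum[symmetric]) simp
    then show "(\<Sum>i\<in>UNIV. \<Sum>j\<in>UNIV. hinner H (?T i j (v j)) (v i)) \<in> \<real>\<^sub>\<ge>\<^sub>0"
      using form_nonneg[OF E_positive, of "\<lambda>i. v (prod.swap i)"] v by simp
  qed
  moreover have "(\<Sum>a\<in>UNIV. hinner H (?T (x, a) (x', a) v) w) = (if x = x' then hinner H v w else 0)"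
    if "v \<in> carrier H" "w \<in> carrier H" for x x' v w
    using E_input[OF that] by simp
  moreover have "(\<Sum>p\<in>UNIV. \<Sum>q\<in>UNIV. (hnorm H (?T p q \<xi>))\<^sup>2) = (real CARD('x))\<^sup>2"
    unfolding E_saturated[symmetric]
    by (subst swap_sum[symmetric], rule sum.cong[OF refl], subst swap_sum[symmetric]) simp
  ultimately have "(\<Sum>b\<in>UNIV. hinner H (?T (prod.swap p) (b, x) (?T (b, x') (prod.swap q) \<xi>)) w)
      = (if x = x' then hinner H (?T (prod.swap p) (prod.swap q) \<xi>) w else 0)"
    by (intro isometry_total_eq[of ?T, OF _ _ \<xi>_in \<xi>_norm _ w])
  then show ?thesis by simp
qed

definition act :: "'x letter list \<Rightarrow> 'k \<Rightarrow> 'k" where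
  "act w v = foldr (\<lambda>e. E (fst e) (snd e)) w v"

lemma act_simps [simp]:
  "act [] v = v" "act (e # w) v = E (fst e) (snd e) (act w v)" "act (u @ w) v = act u (act w v)"
  by (simp_all add: act_def)

lemma act_in [simp]: "v \<in> carrier H \<Longrightarrow> act w v \<in> carrier H"
  by (induction w) auto

lemma hinner_act: "v \<in> carrier H \<Longrightarrow> u \<in> carrier H \<Longrightarrow> hinner H (act w v) u = hinner H v (act (star w) u)"
  by (induction w arbitrary: u) (auto simp: hinner_E)

lemma act_F: "v \<in> carrier H \<Longrightarrow> act w (F p q v) = F p q (act w v)"
  by (induction w) (auto simp: commute)

definition state :: "'x letter list \<Rightarrow> complex" where
  "state w = hinner H (act w \<xi>) \<xi>"

text \<open>
  The letter is moved from \<open>E\<close> on the left to \<open>F\<close> at \<open>\<xi>\<close>, and past the commuting word back to \<open>E\<close>.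
\<close>

lemma state_rotate: "state (e # w) = state (w @ [e])"
proof -
  obtain p q where e: "e = (p, q)" by (cases e)
  have "state (e # w) = hinner H (act w \<xi>) (E q p \<xi>)"
    by (simp add: state_def e hinner_E)
  also have "\<dots> = hinner H (F q p (act w \<xi>)) \<xi>" by (simp add: exchange hinner_F)
  also have "\<dots> = state (w @ [e])" by (simp add: state_def e exchange flip: act_F)
  finally show ?thesis .
qed

lemma state_cyclic: "state (v @ w) = state (w @ v)"
proof (induction v arbitrary: w)
  case (Cons e v)
  have "state ((e # v) @ w) = state (v @ (w @ [e]))" using state_rotate[of e "v @ w"] by simp
  also have "\<dots> = state ((w @ [e]) @ v)" by (rule Cons)
  finally show ?case by simp
qed simp

lemma biunitary_trace_state: "biunitary_trace state"
proof
  have "state (star v @ w) = hinner H (act w \<xi>) (act v \<xi>)" for v w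
    by (simp add: state_def hinner_act)
  then show "pos_kernel (\<lambda>w v. state (star v @ w))"
    by (simp add: pos_kernel_gram)
  show "state (v @ w) = state (w @ v)" for v w by (rule state_cyclic)
  show "state [] = 1" by (simp add: state_def hinner_self \<xi>_norm)
  fix w
  show "(\<Sum>a\<in>UNIV. state (((x, a), (x', a)) # w)) = (if x = x' then state w else 0)" for x x'
    by (simp add: state_def E_output)
  show "(\<Sum>x\<in>UNIV. state (((x, a), (x, a')) # w)) = (if a = a' then state w else 0)" for a a'
    by (simp add: state_def E_input)
  \<comment> \<open>by cyclicity the word starting with \<open>u\<close> can be evaluated with \<open>u\<close> next to \<open>\<xi>\<close>\<close>
  have last: "state (u @ w) = hinner H (act u \<xi>) (act (star w) \<xi>)" for u
    unfolding state_cyclic[of u w] by (simp add: state_def hinner_act)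
  show "(\<Sum>x\<in>UNIV. state ((p, (x, a)) # ((x, a'), q) # w)) = (if a = a' then state ((p, q) # w) else 0)" for p q a a'
    using E_contract_input[of "act (star w) \<xi>" p a a' q] last[of "[(p, q)]"] last[of "[(p, (x, a)), ((x, a'), q)]" for x]
    by simp
  show "(\<Sum>a\<in>UNIV. state ((p, (x, a)) # ((x', a), q) # w)) = (if x = x' then state ((p, q) # w) else 0)" for p q x x'
    using E_contract_output[of "act (star w) \<xi>" p x x' q] last[of "[(p, q)]"] last[of "[(p, (x, a)), ((x', a), q)]" for a]
    by simp
qed

end

section \<open>From an isomorphism to a trace\<close>

lemma matrix_sum_entries: "A = (\<Sum>p\<in>UNIV. \<Sum>p'\<in>UNIV. mscale (A $ p $ p') (munit p p'))"
proof -
  have "(\<Sum>p\<in>UNIV. \<Sum>p'\<in>UNIV. mscale (A $ p $ p') (munit p p')) $ i $ j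
      = (\<Sum>p\<in>UNIV. \<Sum>p'\<in>UNIV. if p' = j then if p = i then A $ p $ p' else 0 else 0)" for i j
    unfolding sum_component by (intro sum.cong refl) (auto simp: mscale_def map_matrix_def munit_def)
  then show ?thesis by (simp add: vec_eq_iff)
qed

lemma linear_eq_chan:
  assumes add: "\<And>A B. \<Gamma> (A + B) = \<Gamma> A + \<Gamma> B" and scale: "\<And>c A. \<Gamma> (mscale c A) = mscale c (\<Gamma> A)"
    and unit: "\<And>p p' c c'. \<Gamma> (munit p p') $ c $ c' = \<kappa> p c p' c'"
  shows "\<Gamma> = chan \<kappa>"
proof
  fix \<omega>
  have zero: "\<Gamma> 0 = 0" using add[of 0 0] by simp
  have sum: "\<Gamma> (\<Sum>i\<in>A. f i) = (\<Sum>i\<in>A. \<Gamma> (f i))" if "finite A" for f and A :: "('a \<times> 'a) set"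
    using that by (induction A rule: finite_induct) (auto simp: add zero)
  have "\<Gamma> \<omega> = (\<Sum>p\<in>UNIV. \<Sum>p'\<in>UNIV. mscale (\<omega> $ p $ p') (\<Gamma> (munit p p')))"
    by (subst matrix_sum_entries) (simp add: sum scale)
  then show "\<Gamma> \<omega> = chan \<kappa> \<omega>"
    by (simp add: vec_eq_iff chan_def unit mscale_def map_matrix_def)
qed

text \<open>Perfectness is tested on the rank one matrices \<open>\<zeta>\<zeta>\<^sup>*\<close>.\<close>

lemma perfect_strategy_quadratic:
  fixes \<U> \<V> :: "(complex^('x::finite \<times> 'x)) set"
  assumes perfect: "perfect_strategy (chan \<kappa>) \<U> \<V>" and \<U>: "vec.subspace \<U>" and \<V>: "vec.subspace \<V>"
    and \<zeta>: "\<zeta> \<in> \<U>" and \<eta>: "\<eta> \<in> perp \<V>"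
  shows "(\<Sum>p\<in>UNIV. \<Sum>p'\<in>UNIV. \<zeta> $ p * cnj (\<zeta> $ p') *
    (\<Sum>c\<in>UNIV. \<Sum>c'\<in>UNIV. \<kappa> p c p' c' * \<eta> $ c' * cnj (\<eta> $ c))) = 0"
proof -
  let ?P = "orth_proj \<U>" and ?Q = "orth_proj \<V>"
  define \<omega> :: "complex^('x \<times> 'x)^('x \<times> 'x)" where "\<omega> = (\<chi> p p'. \<zeta> $ p * cnj (\<zeta> $ p'))"
  have \<omega>v: "\<omega> *v v = cinner v \<zeta> *s \<zeta>" for v
    by (simp add: \<omega>_def matrix_vector_mult_def cinner_def vec_eq_iff sum_distrib_left sum_distrib_right mult_ac)
  have "psd \<omega>"
    unfolding psd_def
  proof
    fix v
    have "cinner (\<omega> *v v) v = cinner v \<zeta> * cnj (cinner v \<zeta>)"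
      using cinner_commute[of \<zeta> v] by (simp add: \<omega>v cinner_scale_left)
    then show "cinner (\<omega> *v v) v \<in> \<real>\<^sub>\<ge>\<^sub>0"
      by (simp add: complex_norm_square[symmetric] del: of_real_power)
  qed
  moreover have "\<omega> = ?P ** \<omega> ** ?P"
  proof -
    have "(?P ** \<omega> ** ?P) *v v = \<omega> *v v" for v
    proof -
      have "(?P ** \<omega> ** ?P) *v v = ?P *v (\<omega> *v (?P *v v))" by (simp add: matrix_vector_mul_assoc matrix_mul_assoc)
      also have "\<dots> = cinner (?P *v v) \<zeta> *s (?P *v \<zeta>)" by (simp add: \<omega>v vector_scalar_commute)
      also have "\<dots> = \<omega> *v v"
        by (simp add: \<omega>v cinner_hermitian[OF orth_proj_hermitian[OF \<U>]] orth_proj_fix[OF \<U> \<zeta>])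
      finally show ?thesis .
    qed
    then show ?thesis by (simp add: matrix_eq)
  qed
  ultimately have "chan \<kappa> \<omega> = ?Q ** chan \<kappa> \<omega> ** ?Q"
    using perfect by (simp add: perfect_strategy_def)
  then have "chan \<kappa> \<omega> *v \<eta> = ?Q *v (chan \<kappa> \<omega> *v (?Q *v \<eta>))"
    by (metis matrix_vector_mul_assoc)
  then have "cinner (chan \<kappa> \<omega> *v \<eta>) \<eta> = 0"
    by (simp add: orth_proj_perp[OF \<V> \<eta>] cinner_def)
  then show ?thesis unfolding cinner_chan by (simp add: \<omega>_def)
qed

context biunitary_trace
begin

text \<open>
  A vector of norm zero in the Hilbert space of the trace is orthogonal to all words. The
  real numbers are a type large enough to carry that space.
\<close>

lemma null_combination:
  fixes e :: "'i \<Rightarrow> 'x letter list"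
  assumes A: "finite A" and null: "(\<Sum>i\<in>A. \<Sum>j\<in>A. t i * cnj (t j) * \<phi> (star (e j) @ e i)) = 0"
  shows "(\<Sum>i\<in>A. t i * \<phi> (v @ e i)) = 0"
proof -
  obtain H :: "real hilbert" and g where "trace_space \<phi> H g"
    using trace_space_exists[OF biunitary_trace_axioms lepoll_refl] by blast
  then interpret trace_space \<phi> H g .
  define y where "y = comb (\<lambda>i. g (undefined, e i)) A t"
  have y: "y \<in> carrier H" by (simp add: y_def)
  have "hinner H y y = (\<Sum>j\<in>A. \<Sum>i\<in>A. t i * cnj (t j) * \<phi> (star (e j) @ e i))"
    using A by (simp add: y_def hinner_comb_left hinner_comb_right gram sum_distrib_left mult_ac)
  also have "\<dots> = 0" using null by (subst sum.swap)
  finally have "y = \<zero>\<^bsub>H\<^esub>" using y by (intro hinner_definite)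
  then have "hinner H y (g (undefined, star v)) = 0" by simp
  then show ?thesis using A by (simp add: y_def hinner_comb_left gram)
qed

text \<open>
  By \<^const>\<open>coeff\<close> being a Gram matrix, the quadratic form splits into nonnegative parts, one for
  each pair of outer entries.
\<close>

lemma intertwines_of_quadratic:
  assumes quad: "\<And>\<zeta> \<eta>. \<zeta> \<in> \<U> \<Longrightarrow> \<eta> \<in> perp \<V> \<Longrightarrow> (\<Sum>p\<in>UNIV. \<Sum>p'\<in>UNIV. \<zeta> $ p * cnj (\<zeta> $ p') *
    (\<Sum>c\<in>UNIV. \<Sum>c'\<in>UNIV. coeff p c p' c' * \<eta> $ c' * cnj (\<eta> $ c))) = 0"
  shows "intertwines \<phi> \<U> \<V>"
  unfolding intertwines_def
proof (intro ballI allI)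
  fix \<zeta> \<eta> r s w assume \<zeta>: "\<zeta> \<in> \<U>" and \<eta>: "\<eta> \<in> perp \<V>"
  define t where "t = (\<lambda>(p :: 'x \<times> 'x, c :: 'x \<times> 'x). cnj (\<zeta> $ p) * \<eta> $ c)"
  define e where "e = (\<lambda>r s (p :: 'x \<times> 'x, c :: 'x \<times> 'x). [(r, (fst p, fst c)), ((snd p, snd c), s)])"
    for r s :: "'x \<times> 'x"
  define S where "S r s = (\<Sum>i\<in>UNIV. \<Sum>j\<in>UNIV. t i * cnj (t j) * \<phi> (star (e r s j) @ e r s i))" for r s
  have inj: "inj (e r s)" for r s by (auto simp: inj_on_def e_def prod_eq_iff)
  have S_nonneg: "S r s \<in> \<real>\<^sub>\<ge>\<^sub>0" for r s
    unfolding S_def by (rule pos_kernelD[OF pos_kernel_inj[OF positive inj]]) simp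
  \<comment> \<open>regrouped, the nonnegative parts \<open>S r s\<close> add up to a multiple of the given quadratic form\<close>
  have "(\<Sum>r\<in>UNIV. \<Sum>s\<in>UNIV. S r s)
      = (\<Sum>i\<in>UNIV. \<Sum>j\<in>UNIV. \<Sum>r\<in>UNIV. \<Sum>s\<in>UNIV. t i * cnj (t j) * \<phi> (star (e r s j) @ e r s i))"
    unfolding S_def by (rule sum_swap_pairs)
  also have "\<dots> = (\<Sum>i\<in>UNIV. \<Sum>j\<in>UNIV. of_nat (CARD('x) * CARD('x)) *
      (t i * cnj (t j) * coeff (fst j) (snd j) (fst i) (snd i)))"
    unfolding mult.left_commute[of "of_nat _"] coeff_gram by (simp add: e_def sum_distrib_left split_beta)
  also have "\<dots> = of_nat (CARD('x) * CARD('x)) *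
      (\<Sum>i\<in>UNIV. \<Sum>j\<in>UNIV. t i * cnj (t j) * coeff (fst j) (snd j) (fst i) (snd i))"
    by (simp only: sum_distrib_left)
  also have "(\<Sum>i\<in>UNIV. \<Sum>j\<in>UNIV. t i * cnj (t j) * coeff (fst j) (snd j) (fst i) (snd i))
      = (\<Sum>p'\<in>UNIV. \<Sum>c'\<in>UNIV. \<Sum>p\<in>UNIV. \<Sum>c\<in>UNIV. \<zeta> $ p * cnj (\<zeta> $ p') * (coeff p c p' c' * \<eta> $ c' * cnj (\<eta> $ c)))"
  proof -
    have "(\<Sum>i\<in>UNIV. f i) = (\<Sum>p\<in>UNIV. \<Sum>c\<in>UNIV. f (p, c))" for f :: "('x \<times> 'x) \<times> ('x \<times> 'x) \<Rightarrow> complex"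
      by (rule sum_UNIV_prod)
    then show ?thesis by (simp add: t_def mult_ac)
  qed
  also have "\<dots> = (\<Sum>p'\<in>UNIV. \<Sum>p\<in>UNIV. \<Sum>c\<in>UNIV. \<Sum>c'\<in>UNIV. \<zeta> $ p * cnj (\<zeta> $ p') * (coeff p c p' c' * \<eta> $ c' * cnj (\<eta> $ c)))"
    by (rule sum.cong[OF refl], rule sum_rotate)
  also have "\<dots> = (\<Sum>p\<in>UNIV. \<Sum>p'\<in>UNIV. \<Sum>c\<in>UNIV. \<Sum>c'\<in>UNIV. \<zeta> $ p * cnj (\<zeta> $ p') * (coeff p c p' c' * \<eta> $ c' * cnj (\<eta> $ c)))"
    by (rule sum.swap)
  also have "\<dots> = 0" using quad[OF \<zeta> \<eta>] by (simp add: sum_distrib_left)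
  finally have "(\<Sum>r\<in>UNIV. \<Sum>s\<in>UNIV. Re (S r s)) = 0"
    by (simp flip: Re_sum)
  moreover have S_Re: "0 \<le> Re (S r s)" for r s using S_nonneg[of r s] by (simp add: complex_nonneg_Reals_iff)
  ultimately have "\<forall>r\<in>UNIV. (\<Sum>s\<in>UNIV. Re (S r s)) = 0"
    by (subst (asm) sum_nonneg_eq_0_iff) (simp_all add: sum_nonneg)
  then have "(\<Sum>s\<in>UNIV. Re (S r s)) = 0" by blast
  then have "\<forall>s\<in>UNIV. Re (S r s) = 0"
    using S_Re by (subst (asm) sum_nonneg_eq_0_iff) simp_all
  then have "Re (S r s) = 0" by blast
  then have "S r s = 0" using S_nonneg[of r s] by (simp add: complex_nonneg_Reals_iff complex_eq_iff)
  then have "(\<Sum>i\<in>UNIV. t i * \<phi> (w @ e r s i)) = 0"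
    unfolding S_def by (intro null_combination) simp_all
  then show "(\<Sum>p\<in>UNIV. \<Sum>c\<in>UNIV. cnj (\<zeta> $ p) * \<eta> $ c *
      \<phi> ((r, (fst p, fst c)) # ((snd p, snd c), s) # w)) = 0"
    unfolding cyclic[of w] sum_UNIV_prod by (simp add: t_def e_def)
qed

end

text \<open>
  On matrix units the channel is given by the operators, so concurrence, perfectness and perfectness of
  the dual become statements about the coefficients of the vector state.
\<close>

lemma trace_of_qc_isomorphic:
  fixes \<U> \<V> :: "(complex^('x::finite \<times> 'x)) set"
  assumes iso: "qc_isomorphic TYPE('k) \<U> \<V>" and \<U>: "vec.subspace \<U>" and \<V>: "vec.subspace \<V>"
  obtains \<phi> :: "'x letter list \<Rightarrow> complex" where "biunitary_trace \<phi>"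
    "intertwines \<phi> \<U> \<V>" "intertwines (transposed \<phi>) \<V> \<U>"
proof -
  obtain \<Gamma> where \<Gamma>: "\<Gamma> \<in> Q_qc_bic TYPE('k)" "perfect_strategy \<Gamma> \<U> \<V>" "perfect_strategy (dual_map \<Gamma>) \<V> \<U>"
    using iso by (auto simp: qc_isomorphic_def)
  then have channel: "quantum_channel \<Gamma>" and conc: "concurrent \<Gamma>" and qc: "quantum_commuting TYPE('k) \<Gamma>"
    by (auto simp: Q_qc_bic_def QNS_bicorrelation_def QNS_correlation_def)
  obtain K :: "'k hilbert" and \<xi> E F where K: "hilbert_space K" "\<xi> \<in> carrier K" "hnorm K \<xi> = 1"
    "bistochastic K E" "bistochastic K F"
    "\<forall>x x' a a' y y' b b'. E x x' a a' \<otimes>\<^bsub>\<B> K\<^esub> F y y' b b' = F y y' b b' \<otimes>\<^bsub>\<B> K\<^esub> E x x' a a'"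
    "\<forall>x x' y y'. \<Gamma> (kron (munit x x') (munit y y')) =
       (\<Sum>a\<in>UNIV. \<Sum>a'\<in>UNIV. \<Sum>b\<in>UNIV. \<Sum>b'\<in>UNIV.
          mscale (hinner K ((E x x' a a' \<otimes>\<^bsub>\<B> K\<^esub> F y y' b b') \<xi>) \<xi>) (kron (munit a a') (munit b b')))"
    using qc unfolding quantum_commuting_def by (elim exE conjE)
  interpret K: hilbert_space K by (rule K(1))
  define E' where "E' p q = E (fst p) (fst q) (snd p) (snd q)" for p q
  define F' where "F' p q = F (fst p) (fst q) (snd p) (snd q)" for p q
  have pos: "om_positive K E'" "om_positive K F'"
    using K(4,5) by (auto simp: bistochastic_def E'_def[abs_def] F'_def[abs_def])
  note ops [simp] = K.positive_ops[OF pos(1)] K.positive_ops[OF pos(2)]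
  have sums: "(\<Sum>a\<in>UNIV. hinner K (T (x, a) (x', a) v) w) = (if x = x' then hinner K v w else 0)"
      "(\<Sum>x\<in>UNIV. hinner K (T (x, a) (x, a') v) w) = (if a = a' then hinner K v w else 0)"
    if B: "bistochastic K B" and T: "\<And>p q. T p q = B (fst p) (fst q) (snd p) (snd q)" "\<And>p q. T p q \<in> K.ops"
      and vw: "v \<in> carrier K" "w \<in> carrier K" for B T v w x x' a a'
  proof -
    have "finsum (\<B> K) (\<lambda>a. T (x, a) (x', a)) UNIV = (if x = x' then \<one>\<^bsub>\<B> K\<^esub> else \<zero>\<^bsub>\<B> K\<^esub>)"
      using B by (simp add: bistochastic_def T(1))
    from fun_cong[OF this, of v]
    have "hinner K (finsum (\<B> K) (\<lambda>a. T (x, a) (x', a)) UNIV v) w = (if x = x' then hinner K v w else 0)"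
      using vw by simp
    then show "(\<Sum>a\<in>UNIV. hinner K (T (x, a) (x', a) v) w) = (if x = x' then hinner K v w else 0)"
      using vw T(2) by (simp add: K.hinner_op_finsum)
    have "finsum (\<B> K) (\<lambda>x. T (x, a) (x, a')) UNIV = (if a = a' then \<one>\<^bsub>\<B> K\<^esub> else \<zero>\<^bsub>\<B> K\<^esub>)"
      using B by (simp add: bistochastic_def T(1))
    from fun_cong[OF this, of v]
    have "hinner K (finsum (\<B> K) (\<lambda>x. T (x, a) (x, a')) UNIV v) w = (if a = a' then hinner K v w else 0)"
      using vw by simp
    then show "(\<Sum>x\<in>UNIV. hinner K (T (x, a) (x, a') v) w) = (if a = a' then hinner K v w else 0)"
      using vw T(2) by (simp add: K.hinner_op_finsum)
  qed
  have com: "E' p q (F' r s v) = F' r s (E' p q v)" if "v \<in> carrier K" for p q r s v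
    using fun_cong[OF K(6)[rule_format], of "fst p" "fst q" "snd p" "snd q" "fst r" "fst s" "snd r" "snd s" v] that
    by (simp add: E'_def F'_def)
  define \<kappa> where "\<kappa> p c p' c' = hinner K (E' (fst p, fst c) (fst p', fst c') (F' (snd p, snd c) (snd p', snd c') \<xi>)) \<xi>"
    for p c p' c'
  have \<Gamma>_eq: "\<Gamma> = chan \<kappa>"
  proof (rule linear_eq_chan)
    fix p p' c c' :: "'x \<times> 'x"
    have "\<Gamma> (munit p p') = \<Gamma> (kron (munit (fst p) (fst p')) (munit (snd p) (snd p')))"
      by (simp add: kron_munit)
    also have "\<dots> $ c $ c' = \<kappa> p c p' c'"
      unfolding K(7)[rule_format] matrix_sum_munit using K(2) by (simp add: \<kappa>_def E'_def F'_def)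
    finally show "\<Gamma> (munit p p') $ c $ c' = \<kappa> p c p' c'" .
  qed (use channel in \<open>simp_all add: quantum_channel_def\<close>)
  have J: "(\<Sum>x\<in>UNIV. \<Sum>y\<in>UNIV. \<kappa> (x, x) (a, a) (y, y) (a', a')) = 1" for a a'
  proof -
    have "1 / of_nat CARD('x) = chan \<kappa> J_mat $ (a, a) $ (a', a')"
      using conc by (simp add: \<Gamma>_eq concurrent_def J_mat_entry)
    then show ?thesis by (simp add: chan_J_mat)
  qed
  have total: "(\<Sum>p\<in>UNIV. \<Sum>q\<in>UNIV. hinner K (E' p q (F' p q \<xi>)) \<xi>) = (of_nat CARD('x))\<^sup>2"
  proof -
    have "(\<Sum>p\<in>UNIV. \<Sum>q\<in>UNIV. hinner K (E' p q (F' p q \<xi>)) \<xi>)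
        = (\<Sum>x\<in>UNIV. \<Sum>a\<in>UNIV. \<Sum>y\<in>UNIV. \<Sum>a'\<in>UNIV. \<kappa> (x, x) (a, a) (y, y) (a', a'))"
      by (simp add: sum_UNIV_prod \<kappa>_def)
    also have "\<dots> = (\<Sum>x\<in>UNIV. \<Sum>a\<in>UNIV. \<Sum>a'\<in>UNIV. \<Sum>y\<in>UNIV. \<kappa> (x, x) (a, a) (y, y) (a', a'))"
      by (rule sum.cong[OF refl], rule sum.cong[OF refl], rule sum.swap)
    also have "\<dots> = (\<Sum>a\<in>UNIV. \<Sum>a'\<in>UNIV. \<Sum>x\<in>UNIV. \<Sum>y\<in>UNIV. \<kappa> (x, x) (a, a) (y, y) (a', a'))"
      by (rule sum_rotate)
    also have "\<dots> = (of_nat CARD('x))\<^sup>2" by (simp add: J power2_eq_square)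
    finally show ?thesis .
  qed
  interpret P: concurrent_pair K \<xi> E' F'
    by (intro concurrent_pair.intro concurrent_pair_axioms.intro K(1,2,3) pos com total)
       (simp_all add: sums[OF K(4) E'_def ops(1)] sums[OF K(5) F'_def ops(2)])
  interpret T: biunitary_trace P.state by (rule P.biunitary_trace_state)
  interpret T': biunitary_trace "transposed P.state" by (rule T.biunitary_trace_transposed)
  have coeff: "\<kappa> = T.coeff"
    by (intro ext) (simp add: \<kappa>_def T.coeff_def P.state_def P.exchange)
  show thesis
  proof (rule that[OF P.biunitary_trace_state])
    show "intertwines P.state \<U> \<V>"
      using \<Gamma>(2) unfolding \<Gamma>_eq coeff
      by (intro T.intertwines_of_quadratic perfect_strategy_quadratic[OF _ \<U> \<V>])
    show "intertwines (transposed P.state) \<V> \<U>"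
      using \<Gamma>(3) unfolding \<Gamma>_eq coeff T.dual_chan_coeff
      by (intro T'.intertwines_of_quadratic perfect_strategy_quadratic[OF _ \<V> \<U>])
  qed
qed

section \<open>From an aligned bi-unitary to a trace\<close>

context hilbert_space
begin

lemma om_unitary_sums:
  assumes A: "om_unitary H A" and vw: "v \<in> carrier H" "w \<in> carrier H"
  shows "(\<Sum>k\<in>UNIV. hinner H (A k j v) (A k i w)) = (if i = j then hinner H v w else 0)"
    and "(\<Sum>k\<in>UNIV. hinner H (A i k (op_adj H (A j k) v)) w) = (if i = j then hinner H v w else 0)"
proof -
  have ops [simp]: "A i j \<in> ops" for i j using A by (simp add: om_unitary_def opmats_def)
  have one: "hinner H (om_one H i j v) w = (if i = j then hinner H v w else 0)"
    using vw by (simp add: om_one_def)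
  have "om_adj H A \<star> A = om_one H" using A by (simp add: om_unitary_def)
  then have "hinner H ((om_adj H A \<star> A) i j v) w = (if i = j then hinner H v w else 0)"
    by (simp only: one)
  then show "(\<Sum>k\<in>UNIV. hinner H (A k j v) (A k i w)) = (if i = j then hinner H v w else 0)"
    using vw by (simp add: om_mult_def om_adj_def hinner_op_finsum hinner_op_adj_left)
  have "A \<star> om_adj H A = om_one H" using A by (simp add: om_unitary_def)
  then have "hinner H ((A \<star> om_adj H A) i j v) w = (if i = j then hinner H v w else 0)"
    by (simp only: one)
  then show "(\<Sum>k\<in>UNIV. hinner H (A i k (op_adj H (A j k) v)) w) = (if i = j then hinner H v w else 0)"
    using vw by (simp add: om_mult_def om_adj_def hinner_op_finsum)
qed

definition entry :: "('x, 'k) opmat \<Rightarrow> 'x \<times> 'x \<Rightarrow> 'k \<Rightarrow> 'k" where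
  "entry U p = U (snd p) (fst p)"

definition letter_op :: "('x, 'k) opmat \<Rightarrow> 'x letter \<Rightarrow> 'k \<Rightarrow> 'k" where
  "letter_op U e = op_adj H (entry U (fst e)) \<otimes>\<^bsub>\<B> H\<^esub> entry U (snd e)"

definition word_op :: "('x, 'k) opmat \<Rightarrow> 'x letter list \<Rightarrow> 'k \<Rightarrow> 'k" where
  "word_op U w = foldr (\<lambda>e X. letter_op U e \<otimes>\<^bsub>\<B> H\<^esub> X) w \<one>\<^bsub>\<B> H\<^esub>"

lemma word_op_simps [simp]:
  "word_op U [] = \<one>\<^bsub>\<B> H\<^esub>" "word_op U (e # w) = letter_op U e \<otimes>\<^bsub>\<B> H\<^esub> word_op U w"
  by (simp_all add: word_op_def)

lemma word_op_transpose:
  "word_op U (map (map_prod prod.swap prod.swap) w) = word_op (om_transpose U) w"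
  by (induction w) (auto simp: letter_op_def entry_def om_transpose_def)

end

locale tracial_algebra = hilbert_space H for H :: "'h hilbert" (structure) +
  fixes N :: "('h \<Rightarrow> 'h) set" and \<tau> :: "('h \<Rightarrow> 'h) \<Rightarrow> complex"
  assumes N: "von_neumann_algebra H N" and \<tau>: "tracial_state H N \<tau>"
begin

lemma N_ops [simp]: "T \<in> N \<Longrightarrow> T \<in> ops"
  using N by (auto simp: von_neumann_algebra_def)

lemma commutant_ops [simp]: "S \<in> commutant H N \<Longrightarrow> S \<in> ops"
  by (simp add: commutant_def)

lemma N_iff: "T \<in> N \<longleftrightarrow> T \<in> ops \<and> (\<forall>S\<in>commutant H N. \<forall>v\<in>carrier H. T (S v) = S (T v))"
proof -
  have "N = {T \<in> ops. \<forall>S\<in>commutant H N. T \<otimes>\<^bsub>\<B> H\<^esub> S = S \<otimes>\<^bsub>\<B> H\<^esub> T}"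
    using N unfolding von_neumann_algebra_def commutant_def[of H "commutant H N"] by argo
  then have "T \<in> N \<longleftrightarrow> T \<in> ops \<and> (\<forall>S\<in>commutant H N. T \<otimes>\<^bsub>\<B> H\<^esub> S = S \<otimes>\<^bsub>\<B> H\<^esub> T)"
    by blast
  then show ?thesis using op_commute_iff[of T] commutant_ops by meson
qed

lemma N_commute: "T \<in> N \<Longrightarrow> S \<in> commutant H N \<Longrightarrow> v \<in> carrier H \<Longrightarrow> T (S v) = S (T v)"
  using N_iff by blast

lemma N_closed [simp]:
  "S \<in> N \<Longrightarrow> T \<in> N \<Longrightarrow> S \<otimes>\<^bsub>\<B> H\<^esub> T \<in> N" "S \<in> N \<Longrightarrow> T \<in> N \<Longrightarrow> S \<oplus>\<^bsub>\<B> H\<^esub> T \<in> N"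
  "T \<in> N \<Longrightarrow> c \<odot>\<^bsub>\<B> H\<^esub> T \<in> N" "\<one>\<^bsub>\<B> H\<^esub> \<in> N" "\<zero>\<^bsub>\<B> H\<^esub> \<in> N"
  by (subst N_iff, simp add: N_commute op_add op_smult)+

lemma N_adj [simp]: "T \<in> N \<Longrightarrow> op_adj H T \<in> N"
  using N by (auto simp: von_neumann_algebra_def)

lemma \<tau>_rules:
  "S \<in> N \<Longrightarrow> T \<in> N \<Longrightarrow> \<tau> (S \<oplus>\<^bsub>\<B> H\<^esub> T) = \<tau> S + \<tau> T" "T \<in> N \<Longrightarrow> \<tau> (c \<odot>\<^bsub>\<B> H\<^esub> T) = c * \<tau> T"
  "T \<in> N \<Longrightarrow> \<tau> (op_adj H T \<otimes>\<^bsub>\<B> H\<^esub> T) \<in> \<real>\<^sub>\<ge>\<^sub>0" "\<tau> \<one>\<^bsub>\<B> H\<^esub> = 1"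
  "S \<in> N \<Longrightarrow> T \<in> N \<Longrightarrow> \<tau> (S \<otimes>\<^bsub>\<B> H\<^esub> T) = \<tau> (T \<otimes>\<^bsub>\<B> H\<^esub> S)"
  using \<tau> by (auto simp: tracial_state_def)

lemma \<tau>_zero: "\<tau> \<zero>\<^bsub>\<B> H\<^esub> = 0"
proof -
  have "\<zero>\<^bsub>\<B> H\<^esub> = 0 \<odot>\<^bsub>\<B> H\<^esub> \<one>\<^bsub>\<B> H\<^esub>"
    by (rule op_hinner_eqI) (auto simp: hinner_smult)
  then show ?thesis using \<tau>_rules(2)[of "\<one>\<^bsub>\<B> H\<^esub>" 0] by simp
qed

lemma \<tau>_finsum:
  assumes "finite A" "\<And>i. i \<in> A \<Longrightarrow> T i \<in> N"
  shows "finsum (\<B> H) T A \<in> N \<and> \<tau> (finsum (\<B> H) T A) = (\<Sum>i\<in>A. \<tau> (T i))"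
proof -
  interpret O: abelian_monoid "\<B> H" by (rule ops_abelian_monoid)
  show ?thesis
    using assms
  proof (induction A rule: finite_induct)
    case (insert a A)
    then have "finsum (\<B> H) T (insert a A) = T a \<oplus>\<^bsub>\<B> H\<^esub> finsum (\<B> H) T A"
      by (intro O.finsum_insert) auto
    then show ?case using insert by (simp add: \<tau>_rules)
  qed (simp add: \<tau>_zero)
qed

lemma \<tau>_sum_eq:
  assumes A: "finite A" and T: "\<And>i. i \<in> A \<Longrightarrow> T i \<in> N" and R: "R \<in> ops"
    and eq: "\<And>v w. v \<in> carrier H \<Longrightarrow> w \<in> carrier H \<Longrightarrow> (\<Sum>i\<in>A. hinner H (T i v) w) = hinner H (R v) w"
  shows "(\<Sum>i\<in>A. \<tau> (T i)) = \<tau> R"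
proof -
  have "finsum (\<B> H) T A = R"
    by (rule op_hinner_eqI) (use A T R eq in \<open>auto simp: op_finsum_closed hinner_op_finsum\<close>)
  then show ?thesis using \<tau>_finsum[OF A, of T] T by simp
qed

end

locale aligned_bi_unitary = tracial_algebra H N \<tau>
  for H :: "'h hilbert" (structure) and N :: "('h \<Rightarrow> 'h) set" and \<tau> :: "('h \<Rightarrow> 'h) \<Rightarrow> complex" +
  fixes U :: "('x::finite, 'h) opmat"
  assumes U: "bi_unitary H U" and aligned: "aligned H N U"
begin

lemma U_ops [simp]: "U a x \<in> ops"
  using U by (simp add: bi_unitary_def om_unitary_def opmats_def)

lemma entry_ops [simp]: "entry U p \<in> ops"
  by (simp add: entry_def)

lemma letter_op_apply:
  "v \<in> carrier H \<Longrightarrow> letter_op U e v = op_adj H (entry U (fst e)) (entry U (snd e) v)"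
  by (simp add: letter_op_def)

lemma letter_in [simp]: "letter_op U e \<in> N"
  using aligned by (simp add: aligned_def letter_op_def entry_def)

lemma word_in [simp]: "word_op U w \<in> N"
  by (induction w) auto

lemma word_op_append: "word_op U (u @ w) = word_op U u \<otimes>\<^bsub>\<B> H\<^esub> word_op U w"
proof (induction u)
  case Nil
  show ?case by (rule op_eqI) auto
next
  case (Cons e u)
  then show ?case by (simp add: op_mult_assoc)
qed

lemma word_op_star: "word_op U (star w) = op_adj H (word_op U w)"
proof (induction w)
  case Nil
  show ?case by (rule op_adj_eqI[symmetric]) auto
next
  case (Cons e w)
  have "word_op U [prod.swap e] = op_adj H (letter_op U e)"
    by (rule op_eqI) (auto simp: letter_op_def op_adj_mult)
  then show ?case using Cons by (simp add: word_op_append op_adj_mult)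
qed

lemma unitary_sums:
  assumes "v \<in> carrier H" "w \<in> carrier H"
  shows "(\<Sum>a\<in>UNIV. hinner H (U a x v) (U a x' w)) = (if x' = x then hinner H v w else 0)"
    and "(\<Sum>x\<in>UNIV. hinner H (U a x v) (U a' x w)) = (if a' = a then hinner H v w else 0)"
    and "(\<Sum>x\<in>UNIV. hinner H (U a x (op_adj H (U a' x) v)) w) = (if a = a' then hinner H v w else 0)"
    and "(\<Sum>a\<in>UNIV. hinner H (U a x (op_adj H (U a x') v)) w) = (if x = x' then hinner H v w else 0)"
  using om_unitary_sums[of U v w] om_unitary_sums[of "om_transpose U" v w] U assms
  by (simp_all add: bi_unitary_def om_transpose_def)

definition entry_trace :: "'x letter list \<Rightarrow> complex" where
  "entry_trace w = \<tau> (word_op U w)"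

lemma biunitary_trace_entry_trace: "biunitary_trace entry_trace"
proof
  show "pos_kernel (\<lambda>w v. entry_trace (star v @ w))"
    unfolding pos_kernel_def
  proof (intro allI impI)
    fix A :: "'x letter list set" and c assume A: "finite A"
    define X where "X = finsum (\<B> H) (\<lambda>w. c w \<odot>\<^bsub>\<B> H\<^esub> word_op U w) A"
    have X: "X \<in> N" using \<tau>_finsum[OF A, of "\<lambda>w. c w \<odot>\<^bsub>\<B> H\<^esub> word_op U w"] by (simp add: X_def)
    have Xl: "hinner H (X v) u = (\<Sum>w\<in>A. c w * hinner H (word_op U w v) u)"
      if "v \<in> carrier H" "u \<in> carrier H" for v u
      using that A by (simp add: X_def hinner_op_finsum hinner_smult)
    have Xr: "hinner H u (X v) = (\<Sum>w\<in>A. cnj (c w) * hinner H u (word_op U w v))"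
      if "v \<in> carrier H" "u \<in> carrier H" for v u
      using that A by (simp add: X_def op_finsum_apply hinner_finsum_right hinner_smult_right)
    have "(\<Sum>w\<in>A. \<Sum>v\<in>A. c w * cnj (c v) * entry_trace (star v @ w))
        = (\<Sum>(w, v)\<in>A \<times> A. \<tau> ((c w * cnj (c v)) \<odot>\<^bsub>\<B> H\<^esub> word_op U (star v @ w)))"
      by (simp add: sum.cartesian_product entry_trace_def \<tau>_rules)
    also have "\<dots> = (\<Sum>i\<in>A \<times> A. \<tau> ((c (fst i) * cnj (c (snd i))) \<odot>\<^bsub>\<B> H\<^esub> word_op U (star (snd i) @ fst i)))"
      by (simp add: split_beta)
    also have "\<dots> = \<tau> (op_adj H X \<otimes>\<^bsub>\<B> H\<^esub> X)"
    proof (rule \<tau>_sum_eq)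
      fix v u assume vu: "v \<in> carrier H" "u \<in> carrier H"
      have "(\<Sum>i\<in>A \<times> A. hinner H (((c (fst i) * cnj (c (snd i))) \<odot>\<^bsub>\<B> H\<^esub> word_op U (star (snd i) @ fst i)) v) u)
          = (\<Sum>w\<in>A. \<Sum>z\<in>A. c w * (cnj (c z) * hinner H (word_op U w v) (word_op U z u)))"
        using vu by (simp add: sum.cartesian_product split_beta hinner_smult word_op_append word_op_star
            hinner_op_adj_left mult.assoc)
      also have "\<dots> = hinner H (X v) (X u)"
        using vu X by (subst sum.swap) (simp add: Xl Xr sum_distrib_left mult_ac)
      finally show "(\<Sum>i\<in>A \<times> A. hinner H (((c (fst i) * cnj (c (snd i))) \<odot>\<^bsub>\<B> H\<^esub> word_op U (star (snd i) @ fst i)) v) u)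
          = hinner H ((op_adj H X \<otimes>\<^bsub>\<B> H\<^esub> X) v) u"
        using vu X by (simp add: hinner_op_adj_left)
    qed (use A X in auto)
    also have "\<dots> \<in> \<real>\<^sub>\<ge>\<^sub>0" using X by (rule \<tau>_rules)
    finally show "(\<Sum>w\<in>A. \<Sum>v\<in>A. c w * cnj (c v) * entry_trace (star v @ w)) \<in> \<real>\<^sub>\<ge>\<^sub>0" .
  qed
  show "entry_trace (v @ w) = entry_trace (w @ v)" for v w
    by (simp add: entry_trace_def word_op_append \<tau>_rules(5))
  show "entry_trace [] = 1" by (simp add: entry_trace_def \<tau>_rules)
  fix w
  have zero: "(if b then \<tau> T else 0) = \<tau> (if b then T else \<zero>\<^bsub>\<B> H\<^esub>)" for b T by (simp add: \<tau>_zero)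
  show "(\<Sum>a\<in>UNIV. entry_trace (((x, a), (x', a)) # w)) = (if x = x' then entry_trace w else 0)" for x x'
    unfolding entry_trace_def zero
    by (rule \<tau>_sum_eq) (auto simp: letter_op_apply entry_def hinner_op_adj_left unitary_sums)
  show "(\<Sum>x\<in>UNIV. entry_trace (((x, a), (x, a')) # w)) = (if a = a' then entry_trace w else 0)" for a a'
    unfolding entry_trace_def zero
    by (rule \<tau>_sum_eq) (auto simp: letter_op_apply entry_def hinner_op_adj_left unitary_sums)
  show "(\<Sum>x\<in>UNIV. entry_trace ((p, (x, a)) # ((x, a'), q) # w))
      = (if a = a' then entry_trace ((p, q) # w) else 0)" for p q a a'
    unfolding entry_trace_def zero
    by (rule \<tau>_sum_eq) (auto simp: letter_op_apply entry_def hinner_op_adj_left unitary_sums)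
  show "(\<Sum>a\<in>UNIV. entry_trace ((p, (x, a)) # ((x', a), q) # w))
      = (if x = x' then entry_trace ((p, q) # w) else 0)" for p q x x'
    unfolding entry_trace_def zero
    by (rule \<tau>_sum_eq) (auto simp: letter_op_apply entry_def hinner_op_adj_left unitary_sums)
qed

lemma intertwines_entry_trace:
  assumes "op_intertwines H U \<U> \<V>"
  shows "intertwines entry_trace \<U> \<V>"
  unfolding intertwines_def
proof (intro ballI allI)
  fix \<zeta> \<eta> r s w assume \<zeta>: "\<zeta> \<in> \<U>" and \<eta>: "\<eta> \<in> perp \<V>"
  define T where "T = (\<lambda>(p :: 'x \<times> 'x, c :: 'x \<times> 'x). (cnj (\<zeta> $ p) * \<eta> $ c) \<odot>\<^bsub>\<B> H\<^esub>
    word_op U ((r, (fst p, fst c)) # ((snd p, snd c), s) # w))"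
  have T: "T i \<in> N" for i by (cases i) (simp add: T_def del: word_op_simps)
  have pairs: "(\<Sum>i\<in>UNIV. f i) = (\<Sum>p\<in>UNIV. \<Sum>c\<in>UNIV. f (p, c))" for f :: "('x \<times> 'x) \<times> ('x \<times> 'x) \<Rightarrow> complex"
    by (rule sum_UNIV_prod)
  have "(\<Sum>i\<in>UNIV. \<tau> (T i)) = \<tau> \<zero>\<^bsub>\<B> H\<^esub>"
  proof (rule \<tau>_sum_eq)
    fix v u assume vu: "v \<in> carrier H" "u \<in> carrier H"
    have "(\<Sum>i\<in>UNIV. hinner H (T i v) u) = (\<Sum>p\<in>UNIV. \<Sum>c\<in>UNIV. cnj (\<zeta> $ p) * \<eta> $ c *
        hinner H (U (fst c) (fst p) (op_adj H (U (snd c) (snd p)) (entry U s (word_op U w v)))) (entry U r u))"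
      using vu unfolding pairs
      by (simp add: T_def hinner_smult letter_op_def entry_def hinner_op_adj_left)
    also have "\<dots> = 0"
      using assms \<zeta> \<eta> vu unfolding op_intertwines_def by simp
    finally show "(\<Sum>i\<in>UNIV. hinner H (T i v) u) = hinner H (\<zero>\<^bsub>\<B> H\<^esub> v) u" using vu by simp
  qed (use T in auto)
  then show "(\<Sum>p\<in>UNIV. \<Sum>c\<in>UNIV. cnj (\<zeta> $ p) * \<eta> $ c *
      entry_trace ((r, (fst p, fst c)) # ((snd p, snd c), s) # w)) = 0"
    unfolding pairs \<tau>_zero by (simp add: T_def \<tau>_rules entry_trace_def)
qed

end

lemma aligned_transposeD:
  assumes "aligned_bi_unitary H N \<tau> U" and "op_intertwines H (om_transpose U) \<V> \<U>"
  shows "intertwines (transposed (aligned_bi_unitary.entry_trace H \<tau> U)) \<V> \<U>"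
proof -
  interpret A: aligned_bi_unitary H N \<tau> U by (rule assms(1))
  interpret B: aligned_bi_unitary H N \<tau> "om_transpose U"
  proof
    show "bi_unitary H (om_transpose U)"
      using A.U by (simp add: bi_unitary_def om_transpose_def)
    show "aligned H N (om_transpose U)"
      using A.aligned by (simp add: aligned_def om_transpose_def)
  qed
  have "transposed A.entry_trace = B.entry_trace"
    by (rule ext) (simp add: transposed_def A.entry_trace_def B.entry_trace_def A.word_op_transpose)
  then show ?thesis using B.intertwines_entry_trace[OF assms(2)] by simp
qed

section \<open>Rewriting the intertwining conditions\<close>

lemma S_tilde_entry:
  "(\<Sum>x\<in>UNIV. \<Sum>y\<in>UNIV. mscale (\<zeta> $ (x, y)) (munit y x)) $ k $ l = \<zeta> $ (l, k)"
  for \<zeta> :: "complex^('x::finite \<times> 'x)"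
proof -
  have "(\<Sum>x\<in>UNIV. \<Sum>y\<in>UNIV. mscale (\<zeta> $ (x, y)) (munit y x)) $ k $ l
      = (\<Sum>x\<in>UNIV. \<Sum>y\<in>UNIV. if y = k then if x = l then \<zeta> $ (x, y) else 0 else 0)"
    unfolding sum_component by (intro sum.cong refl) (auto simp: mscale_def map_matrix_def munit_def)
  then show ?thesis by simp
qed

context hilbert_space
begin

lemma opmatsD: "A \<in> opmats H \<Longrightarrow> A i j \<in> ops"
  by (simp add: opmats_def)

lemma om_mult_opmats [simp]: "A \<in> opmats H \<Longrightarrow> B \<in> opmats H \<Longrightarrow> A \<star> B \<in> opmats H"
  by (simp add: opmats_def om_mult_def op_finsum_closed)

lemma om_scalar_opmats [simp]: "om_scalar H S \<in> opmats H"
  by (simp add: opmats_def om_tensor_def)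

lemma om_adj_opmats [simp]: "A \<in> opmats H \<Longrightarrow> om_adj H A \<in> opmats H"
  by (simp add: opmats_def om_adj_def)

lemma om_adj_entry: "om_adj H A i j = op_adj H (A j i)"
  by (simp add: om_adj_def)

lemma om_transpose_opmats [simp]: "A \<in> opmats H \<Longrightarrow> om_transpose A \<in> opmats H"
  by (simp add: opmats_def om_transpose_def)

lemma leg_opmats [simp]: "A \<in> opmats H \<Longrightarrow> leg13 H A \<in> opmats H" "A \<in> opmats H \<Longrightarrow> leg23 H A \<in> opmats H"
  by (simp_all add: opmats_def leg13_def leg23_def)

lemma hinner_om_mult:
  "A \<in> opmats H \<Longrightarrow> B \<in> opmats H \<Longrightarrow> v \<in> carrier H \<Longrightarrow> w \<in> carrier H \<Longrightarrow>
    hinner H ((A \<star> B) i j v) w = (\<Sum>k\<in>UNIV. hinner H (A i k (B k j v)) w)"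
  by (simp add: om_mult_def hinner_op_finsum opmats_def)

lemma om_scalar_apply: "v \<in> carrier H \<Longrightarrow> om_scalar H S i j v = (S $ i $ j) \<odot> v"
  by (simp add: om_tensor_def)

lemma opmats_eqI:
  assumes "A \<in> opmats H" "B \<in> opmats H"
    and "\<And>i j v w. v \<in> carrier H \<Longrightarrow> w \<in> carrier H \<Longrightarrow> hinner H (A i j v) w = hinner H (B i j v) w"
  shows "A = B"
proof (rule ext, rule ext)
  fix i j show "A i j = B i j"
    using assms by (intro op_hinner_eqI) (auto simp: opmats_def)
qed

text \<open>
  In the product of the two legs only the intermediate index \<open>(a, y)\<close> contributes.
\<close>

lemma sum_leg_product:
  fixes U :: "('x::finite, 'k) opmat"
  assumes U: "U \<in> opmats H" and vw: "v \<in> carrier H" "w \<in> carrier H"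
  shows "(\<Sum>l\<in>UNIV. hinner H (leg13 H (om_transpose U) p l (leg23 H (om_adj H U) l c v)) w)
    = hinner H (U (fst c) (fst p) (op_adj H (U (snd c) (snd p)) v)) w"
proof -
  have "hinner H (leg13 H (om_transpose U) p (a, y) (leg23 H (om_adj H U) (a, y) c v)) w
      = (if y = snd p then if a = fst c then hinner H (U (fst c) (fst p) (op_adj H (U (snd c) (snd p)) v)) w else 0 else 0)"
    for a y
    using opmatsD[OF U] vw by (auto simp: leg13_def leg23_def om_adj_def om_transpose_def)
  then show ?thesis by (simp add: sum_UNIV_prod)
qed

lemma leg_condition:
  fixes U :: "('x::finite, 'k) opmat"
  assumes U: "U \<in> opmats H"
  shows "om_scalar H S \<star> leg13 H (om_transpose U) \<star> leg23 H (om_adj H U) \<star> om_scalar H R = om_zero H \<longleftrightarrow>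
    (\<forall>v\<in>carrier H. \<forall>w\<in>carrier H. \<forall>i j. (\<Sum>p\<in>UNIV. \<Sum>c\<in>UNIV. S $ i $ p * R $ c $ j *
       hinner H (U (fst c) (fst p) (op_adj H (U (snd c) (snd p)) v)) w) = 0)"
    (is "?M = om_zero H \<longleftrightarrow> _")
proof -
  have entry: "hinner H (?M i j v) w = (\<Sum>p\<in>UNIV. \<Sum>c\<in>UNIV. S $ i $ p * R $ c $ j *
       hinner H (U (fst c) (fst p) (op_adj H (U (snd c) (snd p)) v)) w)"
    if vw: "v \<in> carrier H" "w \<in> carrier H" for i j v w
  proof -
    have "hinner H (?M i j v) w = (\<Sum>c\<in>UNIV. \<Sum>l\<in>UNIV. \<Sum>p\<in>UNIV. S $ i $ p * R $ c $ j *
        hinner H (leg13 H (om_transpose U) p l (leg23 H (om_adj H U) l c v)) w)"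
      using U opmatsD[OF leg_opmats(1)[OF om_transpose_opmats[OF U]]] opmatsD[OF leg_opmats(2)[OF om_adj_opmats[OF U]]] vw
      by (simp add: hinner_om_mult om_scalar_apply op_smult hinner_smult mult_ac)
    also have "\<dots> = (\<Sum>c\<in>UNIV. \<Sum>p\<in>UNIV. \<Sum>l\<in>UNIV. S $ i $ p * R $ c $ j *
        hinner H (leg13 H (om_transpose U) p l (leg23 H (om_adj H U) l c v)) w)"
      by (rule sum.cong[OF refl], rule sum.swap)
    also have "\<dots> = (\<Sum>p\<in>UNIV. \<Sum>c\<in>UNIV. \<Sum>l\<in>UNIV. S $ i $ p * R $ c $ j *
        hinner H (leg13 H (om_transpose U) p l (leg23 H (om_adj H U) l c v)) w)"
      by (rule sum.swap)
    finally show ?thesis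
      using sum_leg_product[OF U vw] by (simp flip: sum_distrib_left)
  qed
  have "?M = om_zero H \<longleftrightarrow> (\<forall>v\<in>carrier H. \<forall>w\<in>carrier H. \<forall>i j. hinner H (?M i j v) w = 0)"
  proof
    assume "?M = om_zero H"
    then show "\<forall>v\<in>carrier H. \<forall>w\<in>carrier H. \<forall>i j. hinner H (?M i j v) w = 0"
      by (simp add: om_zero_def)
  next
    assume 0: "\<forall>v\<in>carrier H. \<forall>w\<in>carrier H. \<forall>i j. hinner H (?M i j v) w = 0"
    show "?M = om_zero H"
    proof (rule opmats_eqI)
      show "?M \<in> opmats H" using U by simp
      show "om_zero H \<in> opmats H" by (simp add: om_zero_def opmats_def)
    qed (simp add: om_zero_def 0[rule_format])
  qed
  then show ?thesis by (simp add: entry)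
qed

lemma op_intertwines_iff_legs:
  fixes U :: "('x::finite, 'k) opmat"
  assumes U: "U \<in> opmats H" and \<U>: "vec.subspace \<U>" and \<V>: "vec.subspace \<V>"
  shows "op_intertwines H U \<U> \<V> \<longleftrightarrow>
    om_scalar H (orth_proj \<U>) \<star> leg13 H (om_transpose U) \<star> leg23 H (om_adj H U)
      \<star> om_scalar H (mat 1 - orth_proj \<V>) = om_zero H"
  unfolding op_intertwines_def leg_condition[OF U] annihilated_iff[OF \<U> \<V>, symmetric] by blast

text \<open>
  Conjugating a projection exchanges its rows and columns. This is why the condition for the transpose of \<open>U\<close>, with
  the two graphs exchanged, appears with the same legs.
\<close>

lemma op_intertwines_transpose_iff_legs:
  fixes U :: "('x::finite, 'k) opmat"
  assumes U: "U \<in> opmats H" and \<U>: "vec.subspace \<U>" and \<V>: "vec.subspace \<V>"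
  shows "op_intertwines H (om_transpose U) \<V> \<U> \<longleftrightarrow>
    om_scalar H (mconj (mat 1 - orth_proj \<U>)) \<star> leg13 H (om_transpose U) \<star> leg23 H (om_adj H U)
      \<star> om_scalar H (mconj (orth_proj \<V>)) = om_zero H"
proof -
  let ?h = "\<lambda>v w p c. hinner H (U (fst c) (fst p) (op_adj H (U (snd c) (snd p)) v)) w"
  have P: "mconj (mat 1 - orth_proj \<U>) $ i $ p = (mat 1 - orth_proj \<U>) $ p $ i" for i p
    by (simp add: mconj_def ctranspose_def map_matrix_def transpose_def cnj_orth_proj[OF \<U>] mat_def)
  have Q: "mconj (orth_proj \<V>) $ c $ j = orth_proj \<V> $ j $ c" for c j
    by (simp add: mconj_def ctranspose_def map_matrix_def transpose_def cnj_orth_proj[OF \<V>])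
  have "(\<forall>i j. (\<Sum>p\<in>UNIV. \<Sum>c\<in>UNIV. mconj (mat 1 - orth_proj \<U>) $ i $ p * mconj (orth_proj \<V>) $ c $ j * ?h v w p c) = 0)
    \<longleftrightarrow> (\<forall>j i. (\<Sum>c\<in>UNIV. \<Sum>p\<in>UNIV. orth_proj \<V> $ j $ c * (mat 1 - orth_proj \<U>) $ p $ i * ?h v w p c) = 0)" for v w
  proof -
    have "(\<Sum>p\<in>UNIV. \<Sum>c\<in>UNIV. mconj (mat 1 - orth_proj \<U>) $ i $ p * mconj (orth_proj \<V>) $ c $ j * ?h v w p c)
      = (\<Sum>c\<in>UNIV. \<Sum>p\<in>UNIV. orth_proj \<V> $ j $ c * (mat 1 - orth_proj \<U>) $ p $ i * ?h v w p c)" for i j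
      unfolding P Q by (subst sum.swap) (simp only: mult.commute[of "(mat 1 - orth_proj \<U>) $ _ $ _"])
    then show ?thesis by auto
  qed
  then have "om_scalar H (mconj (mat 1 - orth_proj \<U>)) \<star> leg13 H (om_transpose U) \<star> leg23 H (om_adj H U)
      \<star> om_scalar H (mconj (orth_proj \<V>)) = om_zero H \<longleftrightarrow>
    (\<forall>v\<in>carrier H. \<forall>w\<in>carrier H. \<forall>\<zeta>\<in>\<V>. \<forall>\<eta>\<in>perp \<U>.
      (\<Sum>c\<in>UNIV. \<Sum>p\<in>UNIV. cnj (\<zeta> $ c) * \<eta> $ p * ?h v w p c) = 0)"
    unfolding leg_condition[OF U] annihilated_iff[OF \<V> \<U>] by simp
  then show ?thesis
    unfolding op_intertwines_def om_transpose_def by blast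
qed

text \<open>
  A matrix of operators is read as a vector of operators indexed by \<open>(b, a)\<close> for row \<open>a\<close> and column \<open>b\<close>. If it is
  orthogonal to the complement, it is fixed by the projection onto \<open>\<V>\<close>, and the columns of the projection
  together with the entries of the matrix are the elementary tensors.
\<close>

lemma tensor_space_iff:
  fixes A :: "('x::finite, 'k) opmat"
  assumes A: "A \<in> opmats H" and \<V>: "vec.subspace \<V>"
  shows "A \<in> om_tensor_space H (S_tilde \<V>) \<longleftrightarrow> (\<forall>\<eta>\<in>perp \<V>. \<forall>v\<in>carrier H. \<forall>w\<in>carrier H.
    (\<Sum>c\<in>UNIV. cnj (\<eta> $ c) * hinner H (A (snd c) (fst c) v) w) = 0)"
proof
  assume "A \<in> om_tensor_space H (S_tilde \<V>)"
  then obtain n S T where ST: "\<And>k. k < n \<Longrightarrow> S k \<in> S_tilde \<V>" "\<And>k. k < n \<Longrightarrow> T k \<in> ops"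
    and Aeq: "A = (\<lambda>i j. \<Oplus>\<^bsub>\<B> H\<^esub>k\<in>{..<n::nat}. om_tensor H (S k) (T k) i j)"
    unfolding om_tensor_space_def by blast
  show "\<forall>\<eta>\<in>perp \<V>. \<forall>v\<in>carrier H. \<forall>w\<in>carrier H.
    (\<Sum>c\<in>UNIV. cnj (\<eta> $ c) * hinner H (A (snd c) (fst c) v) w) = 0"
  proof (intro ballI)
    fix \<eta> v w assume \<eta>: "\<eta> \<in> perp \<V>" and vw: "v \<in> carrier H" "w \<in> carrier H"
    have "(\<Sum>c\<in>UNIV. cnj (\<eta> $ c) * S k $ snd c $ fst c) = 0" if k: "k < n" for k
    proof -
      obtain \<zeta> where \<zeta>: "\<zeta> \<in> \<V>"
        and S: "S k = (\<Sum>x\<in>UNIV. \<Sum>y\<in>UNIV. mscale (\<zeta> $ (x, y)) (munit y x))"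
        using ST(1)[OF k] unfolding S_tilde_def by blast
      have entry: "S k $ a $ b = \<zeta> $ (b, a)" for a b
        unfolding S by (rule S_tilde_entry)
      have "(\<Sum>c\<in>UNIV. cnj (\<eta> $ c) * S k $ snd c $ fst c) = cnj (cinner \<eta> \<zeta>)"
        by (simp add: cinner_def entry)
      then show ?thesis using \<eta> \<zeta> by (simp add: perp_def)
    qed
    then have "(\<Sum>k<n. (\<Sum>c\<in>UNIV. cnj (\<eta> $ c) * S k $ snd c $ fst c) * hinner H (T k v) w) = 0"
      by simp
    moreover have "hinner H (A i j v) w = (\<Sum>k<n. S k $ i $ j * hinner H (T k v) w)" for i j
      unfolding Aeq by (subst hinner_op_finsum) (use vw ST(2) in \<open>auto simp: om_tensor_def hinner_smult\<close>)
    then have "(\<Sum>c\<in>UNIV. cnj (\<eta> $ c) * hinner H (A (snd c) (fst c) v) w)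
        = (\<Sum>c\<in>UNIV. \<Sum>k<n. cnj (\<eta> $ c) * S k $ snd c $ fst c * hinner H (T k v) w)"
      by (simp add: sum_distrib_left mult.assoc)
    moreover have "(\<Sum>c\<in>UNIV. \<Sum>k<n. cnj (\<eta> $ c) * S k $ snd c $ fst c * hinner H (T k v) w)
        = (\<Sum>k<n. (\<Sum>c\<in>UNIV. cnj (\<eta> $ c) * S k $ snd c $ fst c) * hinner H (T k v) w)"
      by (subst sum.swap) (simp add: sum_distrib_right)
    ultimately show "(\<Sum>c\<in>UNIV. cnj (\<eta> $ c) * hinner H (A (snd c) (fst c) v) w) = 0"
      by argo
  qed
next
  assume orth: "\<forall>\<eta>\<in>perp \<V>. \<forall>v\<in>carrier H. \<forall>w\<in>carrier H.
    (\<Sum>c\<in>UNIV. cnj (\<eta> $ c) * hinner H (A (snd c) (fst c) v) w) = 0"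
  define n where "n = CARD('x \<times> 'x)"
  obtain f :: "nat \<Rightarrow> 'x \<times> 'x" where f: "bij_betw f {..<n} UNIV"
    using ex_bij_betw_nat_finite[of "UNIV :: ('x \<times> 'x) set"] by (auto simp: n_def atLeast0LessThan)
  define S where "S k = (\<Sum>x\<in>UNIV. \<Sum>y\<in>UNIV. mscale ((\<chi> i. orth_proj \<V> $ i $ f k) $ (x, y)) (munit y x))" for k
  have S_entry: "S k $ i $ j = orth_proj \<V> $ (j, i) $ f k" for i j k
    unfolding S_def S_tilde_entry by simp
  define T where "T k = A (snd (f k)) (fst (f k))" for k
  have "S k \<in> S_tilde \<V>" for k
    unfolding S_def S_tilde_def by (rule imageI[OF column_orth_proj[OF \<V>]])
  moreover have T: "T k \<in> ops" for k using opmatsD[OF A] by (simp add: T_def)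
  moreover have "A = (\<lambda>i j. \<Oplus>\<^bsub>\<B> H\<^esub>k\<in>{..<n}. om_tensor H (S k) (T k) i j)"
  proof (rule opmats_eqI[OF A])
    show "(\<lambda>i j. \<Oplus>\<^bsub>\<B> H\<^esub>k\<in>{..<n}. om_tensor H (S k) (T k) i j) \<in> opmats H"
      using T by (auto simp: opmats_def om_tensor_def intro!: op_finsum_closed)
    fix i j v w assume vw: "v \<in> carrier H" "w \<in> carrier H"
    let ?h = "\<lambda>c. hinner H (A (snd c) (fst c) v) w"
    have "hinner H ((\<Oplus>\<^bsub>\<B> H\<^esub>k\<in>{..<n}. om_tensor H (S k) (T k) i j) v) w
        = (\<Sum>k<n. orth_proj \<V> $ (j, i) $ f k * ?h (f k))"
      using vw T by (simp add: hinner_op_finsum om_tensor_def hinner_smult S_entry T_def)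
    also have "\<dots> = (\<Sum>c\<in>UNIV. orth_proj \<V> $ (j, i) $ c * ?h c)"
      by (rule sum.reindex_bij_betw[OF f])
    also have "\<dots> = ?h (j, i)"
    proof -
      have "(\<Sum>c\<in>UNIV. cnj ((mat 1 - orth_proj \<V>) $ c $ (j, i)) * ?h c) = 0"
        using orth column_orth_proj_compl[OF \<V>, of "(j, i)"] vw by fastforce
      then have "(\<Sum>c\<in>UNIV. (if c = (j, i) then ?h c else 0) - orth_proj \<V> $ (j, i) $ c * ?h c) = 0"
        by (simp add: cnj_orth_proj[OF \<V>] mat_def left_diff_distrib if_distrib[of cnj] if_distrib[of "\<lambda>x. x * _"] cong: if_cong)
      then show ?thesis by (simp add: sum_subtractf)
    qed
    finally show "hinner H (A i j v) w = hinner H ((\<Oplus>\<^bsub>\<B> H\<^esub>k\<in>{..<n}. om_tensor H (S k) (T k) i j) v) w"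
      by simp
  qed
  ultimately show "A \<in> om_tensor_space H (S_tilde \<V>)"
    unfolding om_tensor_space_def by blast
qed

text \<open>
  The entries of $U (S \otimes 1) U^*$ are combinations of the operators \<open>U\<^sub>p U\<^sub>q\<^sup>*\<close>, and the relations they
  must satisfy are the adjoints of the intertwining relations.
\<close>

lemma op_intertwines_iff_conjugation:
  fixes U :: "('x::finite, 'k) opmat"
  assumes U: "U \<in> opmats H" and \<V>: "vec.subspace \<V>"
  shows "op_intertwines H U \<U> \<V> \<longleftrightarrow>
    (\<lambda>S. U \<star> om_scalar H S \<star> om_adj H U) ` S_tilde \<U> \<subseteq> om_tensor_space H (S_tilde \<V>)"
proof -
  have mat: "U \<star> om_scalar H S \<star> om_adj H U \<in> om_tensor_space H (S_tilde \<V>) \<longleftrightarrow>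
    (\<forall>\<eta>\<in>perp \<V>. \<forall>v\<in>carrier H. \<forall>w\<in>carrier H.
      (\<Sum>p\<in>UNIV. \<Sum>c\<in>UNIV. cnj (\<zeta> $ p) * \<eta> $ c * hinner H (U (fst c) (fst p) (op_adj H (U (snd c) (snd p)) v)) w) = 0)"
    if S: "\<And>k l. S $ k $ l = \<zeta> $ (l, k)" for S and \<zeta> :: "complex^('x \<times> 'x)"
  proof -
    have entry: "(\<Sum>c\<in>UNIV. cnj (\<eta> $ c) * hinner H ((U \<star> om_scalar H S \<star> om_adj H U) (snd c) (fst c) v) w)
      = cnj (\<Sum>p\<in>UNIV. \<Sum>c\<in>UNIV. cnj (\<zeta> $ p) * \<eta> $ c * hinner H (U (fst c) (fst p) (op_adj H (U (snd c) (snd p)) w)) v)"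
      if vw: "v \<in> carrier H" "w \<in> carrier H" for \<eta> v w
    proof -
      have flip: "hinner H (U b k (op_adj H (U a l) v)) w = cnj (hinner H (U a l (op_adj H (U b k) w)) v)" for a b k l
      proof -
        have "hinner H (U b k (op_adj H (U a l) v)) w = hinner H (op_adj H (U a l) v) (op_adj H (U b k) w)"
          using opmatsD[OF U] vw by (simp add: hinner_op_adj_right)
        also have "\<dots> = hinner H v (U a l (op_adj H (U b k) w))"
          using opmatsD[OF U] vw by (simp add: hinner_op_adj_left)
        finally show ?thesis using hinner_commute[of v] opmatsD[OF U] vw by simp
      qed
      have "hinner H ((U \<star> om_scalar H S \<star> om_adj H U) b a v) w
          = (\<Sum>l\<in>UNIV. \<Sum>k\<in>UNIV. \<zeta> $ (l, k) * hinner H (U b k (op_adj H (U a l) v)) w)" for a b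
        using U opmatsD[OF U] vw by (simp add: hinner_om_mult om_scalar_apply om_adj_entry op_smult hinner_smult S)
      then have "(\<Sum>c\<in>UNIV. cnj (\<eta> $ c) * hinner H ((U \<star> om_scalar H S \<star> om_adj H U) (snd c) (fst c) v) w)
          = (\<Sum>c\<in>UNIV. \<Sum>p\<in>UNIV. cnj (\<eta> $ c) * (\<zeta> $ p * hinner H (U (snd c) (snd p) (op_adj H (U (fst c) (fst p)) v)) w))"
        by (simp add: sum_UNIV_prod[of "\<lambda>p. cnj _ * (\<zeta> $ p * _ p)"] sum_distrib_left)
      also have "\<dots> = (\<Sum>p\<in>UNIV. \<Sum>c\<in>UNIV. cnj (\<eta> $ c) * (\<zeta> $ p * hinner H (U (snd c) (snd p) (op_adj H (U (fst c) (fst p)) v)) w))"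
        by (rule sum.swap)
      finally show ?thesis by (simp add: flip mult_ac)
    qed
    define X where "X \<eta> v w = (\<Sum>c\<in>UNIV. cnj (\<eta> $ c) *
        hinner H ((U \<star> om_scalar H S \<star> om_adj H U) (snd c) (fst c) v) w)" for \<eta> :: "complex^('x \<times> 'x)" and v w
    define Y where "Y \<eta> v w = (\<Sum>p\<in>UNIV. \<Sum>c\<in>UNIV. cnj (\<zeta> $ p) * \<eta> $ c *
        hinner H (U (fst c) (fst p) (op_adj H (U (snd c) (snd p)) v)) w)" for \<eta> :: "complex^('x \<times> 'x)" and v w
    have "X \<eta> v w = 0 \<longleftrightarrow> Y \<eta> w v = 0" if "v \<in> carrier H" "w \<in> carrier H" for \<eta> v w
      using entry[OF that, of \<eta>] by (simp only: X_def Y_def complex_cnj_zero_iff)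
    then have "(\<forall>\<eta>\<in>perp \<V>. \<forall>v\<in>carrier H. \<forall>w\<in>carrier H. X \<eta> v w = 0)
        \<longleftrightarrow> (\<forall>\<eta>\<in>perp \<V>. \<forall>v\<in>carrier H. \<forall>w\<in>carrier H. Y \<eta> v w = 0)" by blast
    moreover have "U \<star> om_scalar H S \<star> om_adj H U \<in> opmats H" using U by simp
    ultimately show ?thesis unfolding X_def Y_def by (simp only: tensor_space_iff[OF _ \<V>])
  qed
  have "(\<forall>S\<in>S_tilde \<U>. R S) \<longleftrightarrow>
      (\<forall>\<zeta>\<in>\<U>. R (\<Sum>x\<in>UNIV. \<Sum>y\<in>UNIV. mscale (\<zeta> $ (x, y)) (munit y x)))" for R
    unfolding S_tilde_def by blast
  then show ?thesis
    unfolding op_intertwines_def image_subset_iff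
    by (simp only:) (intro ball_cong refl mat[symmetric] S_tilde_entry)
qed

end

section \<open>Equivalence of the three conditions\<close>

text \<open>
  Both directions pass through a trace on words, which does not depend on the type that carries the
  Hilbert space.
\<close>

lemma qc_isomorphic_iff_op_intertwines:
  fixes \<U> \<V> :: "(complex^('x::finite \<times> 'x)) set"
  assumes \<U>: "vec.subspace \<U>" and \<V>: "vec.subspace \<V>"
    and k: "(UNIV :: real set) \<lesssim> (UNIV :: 'k set)" and h: "(UNIV :: real set) \<lesssim> (UNIV :: 'h set)"
  shows "qc_isomorphic TYPE('k) \<U> \<V> \<longleftrightarrow>
    (\<exists>(H :: 'h hilbert) N (U :: ('x, 'h) opmat).
       hilbert_space H \<and> tracial_von_neumann_algebra H N \<and> bi_unitary H U \<and> aligned H N U \<and>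
       op_intertwines H U \<U> \<V> \<and> op_intertwines H (om_transpose U) \<V> \<U>)"
proof
  assume "qc_isomorphic TYPE('k) \<U> \<V>"
  then obtain \<phi> :: "'x letter list \<Rightarrow> complex" where \<phi>: "biunitary_trace \<phi>"
    "intertwines \<phi> \<U> \<V>" "intertwines (transposed \<phi>) \<V> \<U>"
    using trace_of_qc_isomorphic[OF _ \<U> \<V>] by blast
  obtain H :: "'h hilbert" and g where "trace_space \<phi> H g"
    using trace_space_exists[OF \<phi>(1) h] by blast
  then interpret trace_space \<phi> H g .
  show "\<exists>(H :: 'h hilbert) N (U :: ('x, 'h) opmat).
       hilbert_space H \<and> tracial_von_neumann_algebra H N \<and> bi_unitary H U \<and> aligned H N U \<and>
       op_intertwines H U \<U> \<V> \<and> op_intertwines H (om_transpose U) \<V> \<U>"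
    using hilbert_space_axioms tracial_trace_algebra bi_unitary_big_unitary aligned_big_unitary
      op_intertwines_big_unitary[OF \<phi>(2)] op_intertwines_transposed_big_unitary[OF \<phi>(3)] by blast
next
  assume "\<exists>(H :: 'h hilbert) N (U :: ('x, 'h) opmat).
       hilbert_space H \<and> tracial_von_neumann_algebra H N \<and> bi_unitary H U \<and> aligned H N U \<and>
       op_intertwines H U \<U> \<V> \<and> op_intertwines H (om_transpose U) \<V> \<U>"
  then obtain H :: "'h hilbert" and N U where H: "hilbert_space H" "tracial_von_neumann_algebra H N"
    "bi_unitary H U" "aligned H N U" "op_intertwines H U \<U> \<V>" "op_intertwines H (om_transpose U) \<V> \<U>"
    by blast
  obtain \<tau> where \<tau>: "tracial_state H N \<tau>" using H(2) by (auto simp: tracial_von_neumann_algebra_def)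
  have A: "aligned_bi_unitary H N \<tau> U"
    using H \<tau> by (intro aligned_bi_unitary.intro tracial_algebra.intro tracial_algebra_axioms.intro
        aligned_bi_unitary_axioms.intro) (auto simp: tracial_von_neumann_algebra_def)
  then interpret aligned_bi_unitary H N \<tau> U .
  show "qc_isomorphic TYPE('k) \<U> \<V>"
    by (rule qc_isomorphic_of_trace[OF biunitary_trace_entry_trace k \<U> \<V>
          intertwines_entry_trace[OF H(5)] aligned_transposeD[OF A H(6)]])
qed

lemma op_intertwines_pair_iff:
  fixes U :: "('x::finite, 'h) opmat"
  assumes H: "hilbert_space H" and U: "bi_unitary H U" and \<U>: "vec.subspace \<U>" and \<V>: "vec.subspace \<V>"
  shows op_intertwines_pair_iff_legs: "op_intertwines H U \<U> \<V> \<and> op_intertwines H (om_transpose U) \<V> \<U> \<longleftrightarrow>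
      om_scalar H (orth_proj \<U>) \<star>\<^bsub>H\<^esub> leg13 H (om_transpose U) \<star>\<^bsub>H\<^esub> leg23 H (om_adj H U)
        \<star>\<^bsub>H\<^esub> om_scalar H (mat 1 - orth_proj \<V>) = om_zero H \<and>
      om_scalar H (mconj (mat 1 - orth_proj \<U>)) \<star>\<^bsub>H\<^esub> leg13 H (om_transpose U)
        \<star>\<^bsub>H\<^esub> leg23 H (om_adj H U) \<star>\<^bsub>H\<^esub> om_scalar H (mconj (orth_proj \<V>)) = om_zero H"
    and op_intertwines_pair_iff_conjugation:
      "op_intertwines H U \<U> \<V> \<and> op_intertwines H (om_transpose U) \<V> \<U> \<longleftrightarrow>
      (\<lambda>S. U \<star>\<^bsub>H\<^esub> om_scalar H S \<star>\<^bsub>H\<^esub> om_adj H U) ` S_tilde \<U> \<subseteq> om_tensor_space H (S_tilde \<V>) \<and>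
      (\<lambda>S. om_transpose U \<star>\<^bsub>H\<^esub> om_scalar H S \<star>\<^bsub>H\<^esub> om_adj H (om_transpose U)) ` S_tilde \<V>
        \<subseteq> om_tensor_space H (S_tilde \<U>)"
proof -
  interpret hilbert_space H by (rule H)
  have ops: "U \<in> opmats H" "om_transpose U \<in> opmats H"
    using U by (simp_all add: bi_unitary_def om_unitary_def)
  show "op_intertwines H U \<U> \<V> \<and> op_intertwines H (om_transpose U) \<V> \<U> \<longleftrightarrow>
      om_scalar H (orth_proj \<U>) \<star>\<^bsub>H\<^esub> leg13 H (om_transpose U) \<star>\<^bsub>H\<^esub> leg23 H (om_adj H U)
        \<star>\<^bsub>H\<^esub> om_scalar H (mat 1 - orth_proj \<V>) = om_zero H \<and>
      om_scalar H (mconj (mat 1 - orth_proj \<U>)) \<star>\<^bsub>H\<^esub> leg13 H (om_transpose U)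
        \<star>\<^bsub>H\<^esub> leg23 H (om_adj H U) \<star>\<^bsub>H\<^esub> om_scalar H (mconj (orth_proj \<V>)) = om_zero H"
    by (intro conj_cong op_intertwines_iff_legs op_intertwines_transpose_iff_legs ops \<U> \<V>)
  show "op_intertwines H U \<U> \<V> \<and> op_intertwines H (om_transpose U) \<V> \<U> \<longleftrightarrow>
      (\<lambda>S. U \<star>\<^bsub>H\<^esub> om_scalar H S \<star>\<^bsub>H\<^esub> om_adj H U) ` S_tilde \<U> \<subseteq> om_tensor_space H (S_tilde \<V>) \<and>
      (\<lambda>S. om_transpose U \<star>\<^bsub>H\<^esub> om_scalar H S \<star>\<^bsub>H\<^esub> om_adj H (om_transpose U)) ` S_tilde \<V>
        \<subseteq> om_tensor_space H (S_tilde \<U>)"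
    by (intro conj_cong op_intertwines_iff_conjugation ops \<U> \<V>)
qed

theorem theorem7p4:
  fixes \<U> \<V> :: "(complex^('x::finite \<times> 'x)) set"
    and P Q :: "complex^('x \<times> 'x)^('x \<times> 'x)"
  assumes "quantum_graph \<U>" and "quantum_graph \<V>"
    and "P = orth_proj \<U>" and "Q = orth_proj \<V>"
    and "(UNIV :: real set) \<lesssim> (UNIV :: 'k set)"
    and "(UNIV :: real set) \<lesssim> (UNIV :: 'h set)"
    and "(UNIV :: real set) \<lesssim> (UNIV :: 'g set)"
  shows
    "(qc_isomorphic TYPE('k) \<U> \<V>
      \<longleftrightarrow>
      (\<exists>(H :: 'h hilbert) N (U :: ('x, 'h) opmat).
         hilbert_space H \<and> tracial_von_neumann_algebra H N \<and> bi_unitary H U \<and> aligned H N U \<and>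
         om_scalar H P \<star>\<^bsub>H\<^esub> leg13 H (om_transpose U) \<star>\<^bsub>H\<^esub> leg23 H (om_adj H U)
           \<star>\<^bsub>H\<^esub> om_scalar H (mat 1 - Q) = om_zero H \<and>
         om_scalar H (mconj (mat 1 - P)) \<star>\<^bsub>H\<^esub> leg13 H (om_transpose U)
           \<star>\<^bsub>H\<^esub> leg23 H (om_adj H U) \<star>\<^bsub>H\<^esub> om_scalar H (mconj Q) = om_zero H))
     \<and>
     (qc_isomorphic TYPE('k) \<U> \<V>
      \<longleftrightarrow>
      (\<exists>(H :: 'g hilbert) N (U :: ('x, 'g) opmat).
         hilbert_space H \<and> tracial_von_neumann_algebra H N \<and> bi_unitary H U \<and> aligned H N U \<and>
         (\<lambda>S. U \<star>\<^bsub>H\<^esub> om_scalar H S \<star>\<^bsub>H\<^esub> om_adj H U) ` S_tilde \<U>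
           \<subseteq> om_tensor_space H (S_tilde \<V>) \<and>
         (\<lambda>S. om_transpose U \<star>\<^bsub>H\<^esub> om_scalar H S \<star>\<^bsub>H\<^esub> om_adj H (om_transpose U)) ` S_tilde \<V>
           \<subseteq> om_tensor_space H (S_tilde \<U>)))"
proof -
  have \<U>: "vec.subspace \<U>" and \<V>: "vec.subspace \<V>"
    using assms(1,2) by (simp_all add: quantum_graph_def)
  show ?thesis
    unfolding assms(3,4)
  proof (intro conjI)
    show "qc_isomorphic TYPE('k) \<U> \<V> \<longleftrightarrow>
      (\<exists>(H :: 'h hilbert) N (U :: ('x, 'h) opmat).
         hilbert_space H \<and> tracial_von_neumann_algebra H N \<and> bi_unitary H U \<and> aligned H N U \<and>
         om_scalar H (orth_proj \<U>) \<star>\<^bsub>H\<^esub> leg13 H (om_transpose U) \<star>\<^bsub>H\<^esub> leg23 H (om_adj H U)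
           \<star>\<^bsub>H\<^esub> om_scalar H (mat 1 - orth_proj \<V>) = om_zero H \<and>
         om_scalar H (mconj (mat 1 - orth_proj \<U>)) \<star>\<^bsub>H\<^esub> leg13 H (om_transpose U)
           \<star>\<^bsub>H\<^esub> leg23 H (om_adj H U) \<star>\<^bsub>H\<^esub> om_scalar H (mconj (orth_proj \<V>)) = om_zero H)"
      unfolding qc_isomorphic_iff_op_intertwines[OF \<U> \<V> assms(5,6)]
      by (intro ex_cong1 conj_cong refl op_intertwines_pair_iff_legs \<U> \<V>)
    show "qc_isomorphic TYPE('k) \<U> \<V> \<longleftrightarrow>
      (\<exists>(H :: 'g hilbert) N (U :: ('x, 'g) opmat).
         hilbert_space H \<and> tracial_von_neumann_algebra H N \<and> bi_unitary H U \<and> aligned H N U \<and>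
         (\<lambda>S. U \<star>\<^bsub>H\<^esub> om_scalar H S \<star>\<^bsub>H\<^esub> om_adj H U) ` S_tilde \<U>
           \<subseteq> om_tensor_space H (S_tilde \<V>) \<and>
         (\<lambda>S. om_transpose U \<star>\<^bsub>H\<^esub> om_scalar H S \<star>\<^bsub>H\<^esub> om_adj H (om_transpose U)) ` S_tilde \<V>
           \<subseteq> om_tensor_space H (S_tilde \<U>))"
      unfolding qc_isomorphic_iff_op_intertwines[OF \<U> \<V> assms(5,7)]
      by (intro ex_cong1 conj_cong refl op_intertwines_pair_iff_conjugation \<U> \<V>)
  qed
qed

end
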